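(* Let $\ell\in I_0=\{1,\dots,n\}$, $s\in\mathbb N^*$ and $a,b\in\mathbb C^*$, and consider the tensor product $$V(e^{s\Lambda_\ell}Y_{\ell,a}^{s})\otimes V(e^{-s\Lambda_0}Y_{0,b}^{-s}).$$ Assume that $\frac ab\notin\{q^{-2-d_\ell-m}: m\in\mathbb N\}$. Then the Drinfeld coproduct $\Delta_D$ is well-defined on this tensor product and endows it with a structure of $\mathcal U_q(sl_{n+1}^{tor})$-module.
   Context: Fix an integer $n\ge 2$. $I=\{0,\dots,n\}$ is identified with $\mathbb Z/(n+1)\mathbb Z$; $C=(C_{i,j})_{i,j\in I}$ is the Cartan matrix of type $A_n^{(1)}$ ($C_{i,i}=2$, $C_{i,i\pm1}=-1$, $C_{i,j}=0$ otherwise). $\mathbb N=\{0,1,2,\dots\}$, $\mathbb N^*=\mathbb N\setminus\{0\}$. Fix $t\in\mathbb C$ such that $q=e^t$ is not a root of unity; $q^x=e^{tx}$. $\mathfrak h=\mathbb Qh_0\oplus\dots\oplus\mathbb Qh_n\oplus\mathbb Qd$; $\alpha_i,\Lambda_i\in\mathfrak h^*$ are given by $\alpha_i(h_j)=C_{j,i}$, $\alpha_i(d)=\delta_{0,i}$, $\Lambda_i(h_j)=\delta_{i,j}$, $\Lambda_i(d)=0$. $d_\ell=\min(\ell,n+1-\ell)$. $\mathcal U_q(sl_{n+1}^{tor})$ is the $\mathbb C$-algebra with generators $x_{i,r}^\pm$ ($i\in I,r\in\mathbb Z$), $k_h$ ($h\in\mathfrak h$), $h_{i,m}$ ($i\in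 I$, $m\in\mathbb Z\setminus\{0\}$). Put $x_i^\pm(z)=\sum_{r\in\mathbb Z}x_{i,r}^\pm z^r$, $\delta(z)=\sum_{s\in\mathbb Z}z^s$, $k_i^{\pm1}=k_{\pm h_i}$, $\phi_i^\pm(z)=\sum_{m\ge0}\phi^\pm_{i,\pm m}z^{\pm m}=k_i^{\pm1}\exp(\pm(q-q^{-1})\sum_{m\ge1}h_{i,\pm m}z^{\pm m})$. Relations: $k_hk_{h'}=k_{h+h'}$, $k_0=1$; the $k_h$ and all coefficients of all $\phi_i^\pm(z)$ commute; $k_hx_j^\pm(z)k_{-h}=q^{\pm\alpha_j(h)}x_j^\pm(z)$; $(w-q^{\pm C_{ij}}z)\phi_i^{\epsilon}(z)x_j^\pm(w)=(q^{\pm C_{ij}}w-z)x_j^\pm(w)\phi_i^{\epsilon}(z)$ for $\epsilon=+,-$; $[x_i^+(z),x_j^-(w)]=\frac{\delta_{i,j}}{q-q^{-1}}(\delta(\frac wz)\phi_i^+(w)-\delta(\frac zw)\phi_i^-(z))$; $(w-q^{\pm C_{ij}}z)x_i^\pm(z)x_j^\pm(w)=(q^{\pm C_{ij}}w-z)x_j^\pm(w)x_i^\pm(z)$; for $j=i\pm1$: $x_i^\pm(z_1)x_i^\pm(z_2)x_j^\pm(w)-(q+q^{-1})x_i^\pm(z_1)x_j^\pm(w)x_i^\pm(z_2)+x_j^\pm(w)x_i^\pm(z_1)x_i^\pm(z_2)+(z_1\leftrightarrow z_2)=0$; $[x_i^\pm(z),x_j^\pm(w)]=0$ for $i\ne j,j\pm1$.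 Let $\psi(z)=\frac{q-q^{-1}z}{1-z}$. $V(e^{s\Lambda_\ell}Y_{\ell,a}^s)$ is the simple $\ell$-highest weight module: the simple module generated by a vector $v^+$ with $x_{i,r}^+v^+=0$ for all $i,r$, $k_hv^+=q^{s\Lambda_\ell(h)}v^+$, $\phi_i^\pm(z)v^+=\psi(aqz)^{s\delta_{i,\ell}}v^+$. $V(e^{-s\Lambda_0}Y_{0,b}^{-s})$ is the simple $\ell$-lowest weight module: the simple module generated by a vector $v^-$ with $x_{i,r}^-v^-=0$ for all $i,r$, $k_hv^-=q^{-s\Lambda_0(h)}v^-$, $\phi_i^\pm(z)v^-=\psi(bqz)^{-s\delta_{i,0}}v^-$. Rational functions are expanded at $z=0$ for $\phi_i^+$ and at $z=\infty$ for $\phi_i^-$. Drinfeld coproduct: $\Delta_D(x_i^+(z))=x_i^+(z)\otimes1+\phi_i^-(z)\otimes x_i^+(z)$, $\Delta_D(x_i^-(z))=x_i^-(z)\otimes\phi_i^+(z)+1\otimes x_i^-(z)$, $\Delta_D(\phi_i^\pm(z))=\phi_i^\pm(z)\otimes\phi_i^\pm(z)$, $\Delta_D(k_h)=k_h\otimes k_h$. The infinite sums are understood as follows. For modules $V,W$, $v\in V$, $w\in W$, $m\in\mathbb Z$, consider the formal Laurent series in $u$ $$x_{i,m}^+v\otimes w+\sum_{r\ge0}u^{m+r}\phi^-_{i,-r}v\otimes x^+_{i,m+r}w,\qquad \sum_{r\ge0}u^{r}x^-_{i,m-r}v\otimes\phi^+_{i,r}w+u^mv\otimes x^-_{i,m}w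 .$$ $\Delta_D$ is well-defined on $V\otimes W$ if all these series are expansions at $u=0$ of elements of $(V\otimes W)\otimes\mathbb C(u)$ regular at $u=1$; then $x^\pm_{i,m}$ acts on $v\otimes w$ by the value at $u=1$. *)

theory Defs
  imports
    Complex_Main
    "HOL-Library.Poly_Mapping"
    "HOL-Computational_Algebra.Computational_Algebra"
begin

section \<open>Complex vector spaces and their tensor product\<close>

class complex_vector = ab_group_add +
  fixes scaleC :: "complex \<Rightarrow> 'a \<Rightarrow> 'a"  (infixr "*\<^sub>C" 75)
  assumes scaleC_add_right: "c *\<^sub>C (x + y) = c *\<^sub>C x + c *\<^sub>C y"
    and scaleC_add_left: "(c + d) *\<^sub>C x = c *\<^sub>C x + d *\<^sub>C x"
    and scaleC_scaleC: "c *\<^sub>C d *\<^sub>C x = (c * d) *\<^sub>C x"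
    and scaleC_one: "1 *\<^sub>C x = x"

lemma vector_space_scaleC: "vector_space (scaleC :: complex \<Rightarrow> 'a::complex_vector \<Rightarrow> 'a)"
  by standard (simp_all add: scaleC_add_right scaleC_add_left scaleC_scaleC scaleC_one)

abbreviation clinear :: "('a::complex_vector \<Rightarrow> 'b::complex_vector) \<Rightarrow> bool"
  where "clinear \<equiv> Vector_Spaces.linear scaleC scaleC"

abbreviation csubspace :: "'a::complex_vector set \<Rightarrow> bool"
  where "csubspace \<equiv> module.subspace scaleC"

definition free_scale :: "complex \<Rightarrow> ('a \<Rightarrow>\<^sub>0 complex) \<Rightarrow> 'a \<Rightarrow>\<^sub>0 complex"
  where "free_scale c p = Poly_Mapping.map ((*) c) p"

lemma lookup_free_scale: "Poly_Mapping.lookup (free_scale c p) x = c * Poly_Mapping.lookup p x"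
  unfolding free_scale_def by transfer (simp add: when_def)

global_interpretation free_space: vector_space free_scale
  by standard (auto intro!: poly_mapping_eqI simp: lookup_free_scale lookup_add algebra_simps)

definition tensor_relators :: "(('v::complex_vector \<times> 'w::complex_vector) \<Rightarrow>\<^sub>0 complex) set" where
  "tensor_relators =
     {Poly_Mapping.single (v + v', w) 1 - Poly_Mapping.single (v, w) 1
        - Poly_Mapping.single (v', w) 1 | v v' w. True} \<union>
     {Poly_Mapping.single (v, w + w') 1 - Poly_Mapping.single (v, w) 1
        - Poly_Mapping.single (v, w') 1 | v w w'. True} \<union>
     {Poly_Mapping.single (c *\<^sub>C v, w) 1 - free_scale c (Poly_Mapping.single (v, w) 1) | c v w. True} \<union>
     {Poly_Mapping.single (v, c *\<^sub>C w) 1 - free_scale c (Poly_Mapping.single (v, w) 1) | c v w. True}"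

definition tensor_eq :: "(('v::complex_vector \<times> 'w::complex_vector) \<Rightarrow>\<^sub>0 complex) \<Rightarrow>
    (('v \<times> 'w) \<Rightarrow>\<^sub>0 complex) \<Rightarrow> bool" where
  "tensor_eq p p' \<longleftrightarrow> p - p' \<in> free_space.span tensor_relators"

lemma equivp_tensor_eq: "equivp tensor_eq"
proof (rule equivpI)
  show "reflp tensor_eq"
    by (rule reflpI) (simp add: tensor_eq_def free_space.span_zero)
  show "symp tensor_eq"
  proof (rule sympI)
    fix x y assume "tensor_eq x y"
    then have "- (x - y) \<in> free_space.span tensor_relators"
      unfolding tensor_eq_def by (rule free_space.span_neg)
    then show "tensor_eq y x" by (simp add: tensor_eq_def)
  qed
  show "transp tensor_eq"
  proof (rule transpI)
    fix x y z assume "tensor_eq x y" "tensor_eq y z"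
    then have "(x - y) + (y - z) \<in> free_space.span tensor_relators"
      unfolding tensor_eq_def by (rule free_space.span_add)
    then show "tensor_eq x z" by (simp add: tensor_eq_def)
  qed
qed

quotient_type (overloaded) ('v, 'w) tensor =
  "(('v::complex_vector \<times> 'w::complex_vector) \<Rightarrow>\<^sub>0 complex)" / tensor_eq
  by (rule equivp_tensor_eq)

instantiation tensor :: (complex_vector, complex_vector) complex_vector
begin

lift_definition zero_tensor :: "('a, 'b) tensor" is 0 .

lift_definition plus_tensor :: "('a, 'b) tensor \<Rightarrow> ('a, 'b) tensor \<Rightarrow> ('a, 'b) tensor" is "(+)"
  unfolding tensor_eq_def by (simp only: add_diff_add free_space.span_add)

lift_definition uminus_tensor :: "('a, 'b) tensor \<Rightarrow> ('a, 'b) tensor" is uminus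
  unfolding tensor_eq_def by (simp only: minus_diff_minus free_space.span_neg)

lift_definition minus_tensor :: "('a, 'b) tensor \<Rightarrow> ('a, 'b) tensor \<Rightarrow> ('a, 'b) tensor" is "(-)"
proof -
  fix x y x' y' :: "('a \<times> 'b) \<Rightarrow>\<^sub>0 complex"
  assume "tensor_eq x y" "tensor_eq x' y'"
  then have "(x - y) - (x' - y') \<in> free_space.span tensor_relators"
    unfolding tensor_eq_def by (rule free_space.span_diff)
  also have "(x - y) - (x' - y') = (x - x') - (y - y')" by simp
  finally show "tensor_eq (x - x') (y - y')" by (simp only: tensor_eq_def)
qed

lift_definition scaleC_tensor :: "complex \<Rightarrow> ('a, 'b) tensor \<Rightarrow> ('a, 'b) tensor" is free_scale
  unfolding tensor_eq_def
  by (simp only: free_space.scale_right_diff_distrib[symmetric] free_space.span_scale)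

lemma tensor_eq_refl: "tensor_eq p p"
  by (rule equivp_reflp[OF equivp_tensor_eq])

instance
proof
  fix x y z :: "('a, 'b) tensor" and c d :: complex
  show "x + y + z = x + (y + z)"
    by transfer (simp add: add.assoc tensor_eq_refl)
  show "x + y = y + x"
    by transfer (simp add: add.commute tensor_eq_refl)
  show "0 + x = x"
    by transfer (simp add: tensor_eq_refl)
  show "- x + x = 0"
    by transfer (simp add: tensor_eq_refl)
  show "x - y = x + - y"
    by transfer (simp add: tensor_eq_refl)
  show "c *\<^sub>C (x + y) = c *\<^sub>C x + c *\<^sub>C y"
    by transfer (simp add: free_space.scale_right_distrib tensor_eq_refl)
  show "(c + d) *\<^sub>C x = c *\<^sub>C x + d *\<^sub>C x"
    by transfer (simp add: free_space.scale_left_distrib tensor_eq_refl)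
  show "c *\<^sub>C d *\<^sub>C x = (c * d) *\<^sub>C x"
    by transfer (simp add: tensor_eq_refl)
  show "1 *\<^sub>C x = x"
    by transfer (simp add: tensor_eq_refl)
qed

end

lift_definition tens :: "'v::complex_vector \<Rightarrow> 'w::complex_vector \<Rightarrow> ('v, 'w) tensor"  (infixl "\<otimes>\<^sub>V" 70)
  is "\<lambda>v w. Poly_Mapping.single (v, w) 1" .

lemma tens_add_left: "(v + v') \<otimes>\<^sub>V w = v \<otimes>\<^sub>V w + v' \<otimes>\<^sub>V w"
  by transfer (unfold tensor_eq_def tensor_relators_def diff_diff_eq[symmetric],
      rule free_space.span_base, blast)

lemma tens_add_right: "v \<otimes>\<^sub>V (w + w') = v \<otimes>\<^sub>V w + v \<otimes>\<^sub>V w'"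
  by transfer (unfold tensor_eq_def tensor_relators_def diff_diff_eq[symmetric],
      rule free_space.span_base, blast)

lemma tens_scaleC_left: "(c *\<^sub>C v) \<otimes>\<^sub>V w = c *\<^sub>C (v \<otimes>\<^sub>V w)"
  by transfer (unfold tensor_eq_def tensor_relators_def, rule free_space.span_base, blast)

lemma tens_scaleC_right: "v \<otimes>\<^sub>V (c *\<^sub>C w) = c *\<^sub>C (v \<otimes>\<^sub>V w)"
  by transfer (unfold tensor_eq_def tensor_relators_def, rule free_space.span_base, blast)


section \<open>Cartan data of type \<open>A\<^sub>n\<^sup>(\<^sup>1\<^sup>)\<close>\<close>

text \<open>The index set \<open>I = \<int>/(n+1)\<int>\<close> is represented by \<open>{0..n} :: nat set\<close>.\<close>

definition cartan_matrix :: "nat \<Rightarrow> nat \<Rightarrow> nat \<Rightarrow> int" where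
  "cartan_matrix n i j =
     (if i = j then 2
      else if j = (i + 1) mod (n + 1) \<or> i = (j + 1) mod (n + 1) then - 1
      else 0)"

datatype cartan_index = Hgen nat | Dgen

text \<open>The rational space with basis \<open>h\<^sub>0, \<dots>, h\<^sub>n, d\<close>: the vector with coordinates \<open>c\<close> is the
  finitely supported function \<open>c\<close>, and only the basis vectors \<open>h\<^sub>i\<close> with \<open>i \<le> n\<close> are allowed.\<close>

type_synonym cartan = "cartan_index \<Rightarrow>\<^sub>0 rat"

definition cartan_space :: "nat \<Rightarrow> cartan set" where
  "cartan_space n = {h. Poly_Mapping.keys h \<subseteq> insert Dgen (Hgen ` {..n})}"

definition coroot :: "nat \<Rightarrow> cartan" where
  "coroot i = Poly_Mapping.single (Hgen i) 1"

definition simple_root :: "nat \<Rightarrow> nat \<Rightarrow> cartan \<Rightarrow> rat" where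
  "simple_root n i h =
     (\<Sum>j\<le>n. Poly_Mapping.lookup h (Hgen j) * of_int (cartan_matrix n j i))
     + Poly_Mapping.lookup h Dgen * (if i = 0 then 1 else 0)"

definition fund_weight :: "nat \<Rightarrow> cartan \<Rightarrow> rat" where
  "fund_weight i h = Poly_Mapping.lookup h (Hgen i)"

definition dmin :: "nat \<Rightarrow> nat \<Rightarrow> nat" where
  "dmin n l = min l (n + 1 - l)"

definition qpow :: "complex \<Rightarrow> rat \<Rightarrow> complex" where
  "qpow t x = exp (t * of_rat x)"

abbreviation qq :: "complex \<Rightarrow> complex" where
  "qq t \<equiv> exp t"


section \<open>Modules over the quantum toroidal algebra\<close>

datatype pm = Pos | Neg

fun pmi :: "pm \<Rightarrow> int" where
  "pmi Pos = 1"
| "pmi Neg = - 1"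

text \<open>The action of the generators \<open>x\<^sup>\<plusminus>\<^bsub>i,r\<^esub>\<close>, \<open>k\<^sub>h\<close>, \<open>h\<^bsub>i,m\<^esub>\<close> on a space \<open>'v\<close>. Values at indices
  that do not label a generator (\<open>i > n\<close>, \<open>h \<notin> cartan_space n\<close>, or \<open>m = 0\<close> for \<open>h\<^bsub>i,m\<^esub>\<close>) are
  irrelevant.\<close>

record 'v toroidal_ops =
  xop :: "pm \<Rightarrow> nat \<Rightarrow> int \<Rightarrow> 'v \<Rightarrow> 'v"
  kop :: "cartan \<Rightarrow> 'v \<Rightarrow> 'v"
  hop :: "nat \<Rightarrow> int \<Rightarrow> 'v \<Rightarrow> 'v"

text \<open>Power series over the algebra of operators, given by their coefficient sequences:
  \<open>op_power_coeff A j m\<close> is the coefficient of \<open>z^m\<close> in \<open>A(z)^j\<close>, and \<open>op_exp_coeff A m\<close> that of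
  \<open>exp (A(z))\<close> if \<open>A\<close> has no constant term (so that \<open>A(z)^j\<close> contributes only for \<open>j \<le> m\<close>).\<close>

fun op_power_coeff :: "(nat \<Rightarrow> 'v \<Rightarrow> 'v::complex_vector) \<Rightarrow> nat \<Rightarrow> nat \<Rightarrow> 'v \<Rightarrow> 'v" where
  "op_power_coeff A 0 m v = (if m = 0 then v else 0)"
| "op_power_coeff A (Suc j) m v = (\<Sum>p\<le>m. A p (op_power_coeff A j (m - p) v))"

definition op_exp_coeff :: "(nat \<Rightarrow> 'v \<Rightarrow> 'v::complex_vector) \<Rightarrow> nat \<Rightarrow> 'v \<Rightarrow> 'v" where
  "op_exp_coeff A m v = (\<Sum>j\<le>m. (1 / fact j) *\<^sub>C op_power_coeff A j m v)"

text \<open>\<open>phi t \<rho> \<epsilon> i m\<close> is the coefficient of \<open>z^m\<close>, \<open>m \<in> \<int>\<close>, in \<open>\<phi>\<^sup>\<epsilon>\<^sub>i(z)\<close>; it vanishes unless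
  \<open>m\<close> has the sign \<open>\<epsilon>\<close> or is zero.\<close>

definition phi :: "complex \<Rightarrow> 'v::complex_vector toroidal_ops \<Rightarrow> pm \<Rightarrow> nat \<Rightarrow> int \<Rightarrow> 'v \<Rightarrow> 'v" where
  "phi t \<rho> \<epsilon> i m v =
     (if 0 \<le> pmi \<epsilon> * m
      then kop \<rho> (if \<epsilon> = Pos then coroot i else - coroot i)
             (op_exp_coeff
                (\<lambda>p u. if p = 0 then 0
                       else (of_int (pmi \<epsilon>) * (qq t - inverse (qq t))) *\<^sub>C hop \<rho> i (pmi \<epsilon> * int p) u)
                (nat (pmi \<epsilon> * m)) v)
      else 0)"

text \<open>A module is a space with linear operators satisfying the defining relations of the algebra.
  The relations between generating series are written as the equalities of the coefficients of
  \<open>z^m w^r\<close> (of \<open>z\<^sub>1^m\<^sub>1 z\<^sub>2^m\<^sub>2 w^r\<close> for the Serre relations) on both sides.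
  In the relation for \<open>[x\<^sup>+, x\<^sup>-]\<close> one uses that the coefficient of \<open>z^m w^r\<close> in both
  \<open>\<delta>(w/z) f(w)\<close> and \<open>\<delta>(z/w) f(z)\<close> is the coefficient of index \<open>m + r\<close> of \<open>f\<close>.\<close>

definition toroidal_module :: "nat \<Rightarrow> complex \<Rightarrow> 'v::complex_vector toroidal_ops \<Rightarrow> bool" where
  "toroidal_module n t \<rho> \<longleftrightarrow>
     (\<forall>\<epsilon>. \<forall>i\<le>n. \<forall>r. clinear (xop \<rho> \<epsilon> i r)) \<and>
     (\<forall>h\<in>cartan_space n. clinear (kop \<rho> h)) \<and>
     (\<forall>i\<le>n. \<forall>m. m \<noteq> 0 \<longrightarrow> clinear (hop \<rho> i m)) \<and>
     \<comment> \<open>\<open>k\<^sub>h k\<^sub>h' = k\<^sub>h\<^sub>+\<^sub>h'\<close>, \<open>k\<^sub>0 = 1\<close>\<close>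
     (\<forall>h\<in>cartan_space n. \<forall>h'\<in>cartan_space n. \<forall>v. kop \<rho> h (kop \<rho> h' v) = kop \<rho> (h + h') v) \<and>
     (\<forall>v. kop \<rho> 0 v = v) \<and>
     \<comment> \<open>the \<open>k\<^sub>h\<close> and the coefficients of the \<open>\<phi>\<^sup>\<plusminus>\<^sub>i(z)\<close> commute\<close>
     (\<forall>h\<in>cartan_space n. \<forall>\<epsilon>. \<forall>i\<le>n. \<forall>m v.
        kop \<rho> h (phi t \<rho> \<epsilon> i m v) = phi t \<rho> \<epsilon> i m (kop \<rho> h v)) \<and>
     (\<forall>\<epsilon> \<epsilon>'. \<forall>i\<le>n. \<forall>j\<le>n. \<forall>m m' v.
        phi t \<rho> \<epsilon> i m (phi t \<rho> \<epsilon>' j m' v) = phi t \<rho> \<epsilon>' j m' (phi t \<rho> \<epsilon> i m v)) \<and>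
     \<comment> \<open>\<open>k\<^sub>h x\<^sup>\<plusminus>\<^sub>j(z) k\<^sub>-\<^sub>h = q^(\<plusminus>\<alpha>\<^sub>j(h)) x\<^sup>\<plusminus>\<^sub>j(z)\<close>\<close>
     (\<forall>h\<in>cartan_space n. \<forall>\<epsilon>. \<forall>j\<le>n. \<forall>r v.
        kop \<rho> h (xop \<rho> \<epsilon> j r (kop \<rho> (- h) v))
          = qpow t (of_int (pmi \<epsilon>) * simple_root n j h) *\<^sub>C xop \<rho> \<epsilon> j r v) \<and>
     \<comment> \<open>\<open>(w - q^(\<plusminus>C\<^sub>i\<^sub>j) z) \<phi>\<^sup>\<eta>\<^sub>i(z) x\<^sup>\<plusminus>\<^sub>j(w) = (q^(\<plusminus>C\<^sub>i\<^sub>j) w - z) x\<^sup>\<plusminus>\<^sub>j(w) \<phi>\<^sup>\<eta>\<^sub>i(z)\<close>\<close>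
     (\<forall>\<eta> \<epsilon>. \<forall>i\<le>n. \<forall>j\<le>n. \<forall>m r v.
        phi t \<rho> \<eta> i m (xop \<rho> \<epsilon> j (r - 1) v)
          - qq t powi (pmi \<epsilon> * cartan_matrix n i j) *\<^sub>C phi t \<rho> \<eta> i (m - 1) (xop \<rho> \<epsilon> j r v)
        = qq t powi (pmi \<epsilon> * cartan_matrix n i j) *\<^sub>C xop \<rho> \<epsilon> j (r - 1) (phi t \<rho> \<eta> i m v)
          - xop \<rho> \<epsilon> j r (phi t \<rho> \<eta> i (m - 1) v)) \<and>
     (\<forall>i\<le>n. \<forall>j\<le>n. \<forall>m r v.
        xop \<rho> Pos i m (xop \<rho> Neg j r v) - xop \<rho> Neg j r (xop \<rho> Pos i m v)
        = (if i = j
           then (1 / (qq t - inverse (qq t))) *\<^sub>C (phi t \<rho> Pos i (m + r) v - phi t \<rho> Neg i (m + r) v)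
           else 0)) \<and>
     \<comment> \<open>\<open>(w - q^(\<plusminus>C\<^sub>i\<^sub>j) z) x\<^sup>\<plusminus>\<^sub>i(z) x\<^sup>\<plusminus>\<^sub>j(w) = (q^(\<plusminus>C\<^sub>i\<^sub>j) w - z) x\<^sup>\<plusminus>\<^sub>j(w) x\<^sup>\<plusminus>\<^sub>i(z)\<close>\<close>
     (\<forall>\<epsilon>. \<forall>i\<le>n. \<forall>j\<le>n. \<forall>m r v.
        xop \<rho> \<epsilon> i m (xop \<rho> \<epsilon> j (r - 1) v)
          - qq t powi (pmi \<epsilon> * cartan_matrix n i j) *\<^sub>C xop \<rho> \<epsilon> i (m - 1) (xop \<rho> \<epsilon> j r v)
        = qq t powi (pmi \<epsilon> * cartan_matrix n i j) *\<^sub>C xop \<rho> \<epsilon> j (r - 1) (xop \<rho> \<epsilon> i m v)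
          - xop \<rho> \<epsilon> j r (xop \<rho> \<epsilon> i (m - 1) v)) \<and>
     (\<forall>\<epsilon>. \<forall>i\<le>n. \<forall>j\<le>n. cartan_matrix n i j = - 1 \<longrightarrow> (\<forall>m\<^sub>1 m\<^sub>2 r v.
        (let X = xop \<rho> \<epsilon> i; Y = xop \<rho> \<epsilon> j;
             S = (\<lambda>a b. X a (X b (Y r v)) - (qq t + inverse (qq t)) *\<^sub>C X a (Y r (X b v))
                        + Y r (X a (X b v)))
         in S m\<^sub>1 m\<^sub>2 + S m\<^sub>2 m\<^sub>1 = 0))) \<and>
     (\<forall>\<epsilon>. \<forall>i\<le>n. \<forall>j\<le>n. cartan_matrix n i j = 0 \<longrightarrow> (\<forall>m r v.
        xop \<rho> \<epsilon> i m (xop \<rho> \<epsilon> j r v) = xop \<rho> \<epsilon> j r (xop \<rho> \<epsilon> i m v)))"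

definition toroidal_submodule :: "nat \<Rightarrow> 'v::complex_vector toroidal_ops \<Rightarrow> 'v set \<Rightarrow> bool" where
  "toroidal_submodule n \<rho> S \<longleftrightarrow>
     csubspace S \<and>
     (\<forall>\<epsilon>. \<forall>i\<le>n. \<forall>r. \<forall>v\<in>S. xop \<rho> \<epsilon> i r v \<in> S) \<and>
     (\<forall>h\<in>cartan_space n. \<forall>v\<in>S. kop \<rho> h v \<in> S) \<and>
     (\<forall>i\<le>n. \<forall>m. m \<noteq> 0 \<longrightarrow> (\<forall>v\<in>S. hop \<rho> i m v \<in> S))"

definition simple_toroidal_module :: "nat \<Rightarrow> complex \<Rightarrow> 'v::complex_vector toroidal_ops \<Rightarrow> bool" where
  "simple_toroidal_module n t \<rho> \<longleftrightarrow>
     toroidal_module n t \<rho> \<and> (\<exists>v::'v. v \<noteq> 0) \<and>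
     (\<forall>S. toroidal_submodule n \<rho> S \<longrightarrow> S = {0} \<or> S = UNIV)"


section \<open>Simple l-highest and l-lowest weight modules\<close>

text \<open>The rational function \<open>\<psi>(z) = (q - q\<inverse> z) / (1 - z)\<close>, evaluated in the field of formal
  Laurent series.\<close>

definition psi :: "complex \<Rightarrow> complex fls \<Rightarrow> complex fls" where
  "psi q z = (fls_const q - fls_const (inverse q) * z) / (1 - z)"

text \<open>A rational function \<open>f\<close> in \<open>z\<close> is expanded at \<open>z = 0\<close> by evaluating it at the variable of
  the Laurent series field, and at \<open>z = \<infinity>\<close> by evaluating it at the inverse of that variable; in the
  latter case the coefficient of \<open>z^(-m)\<close> is the one of index \<open>m\<close>.\<close>

definition expansion :: "pm \<Rightarrow> (complex fls \<Rightarrow> complex fls) \<Rightarrow> complex fls" where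
  "expansion \<epsilon> f = f (if \<epsilon> = Pos then fls_X else fls_X_inv)"

text \<open>The simple module generated by a vector \<open>v\<close> killed by all \<open>x\<^sup>\<epsilon>\<^bsub>i,r\<^esub>\<close>, of weight
  \<open>q^\<mu>\<close>, and such that \<open>\<phi>\<^sup>\<plusminus>\<^sub>i(z) v = \<Psi>\<^sub>i(z) v\<close>: l-highest weight for
  \<open>\<epsilon> = Pos\<close>, l-lowest weight for \<open>\<epsilon> = Neg\<close>.\<close>

definition simple_l_extremal_module ::
  "pm \<Rightarrow> nat \<Rightarrow> complex \<Rightarrow> (cartan \<Rightarrow> rat) \<Rightarrow> (nat \<Rightarrow> complex fls \<Rightarrow> complex fls) \<Rightarrow>
   'v::complex_vector toroidal_ops \<Rightarrow> bool" where
  "simple_l_extremal_module \<epsilon> n t \<mu> \<Psi> \<rho> \<longleftrightarrow>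
     simple_toroidal_module n t \<rho> \<and>
     (\<exists>v.
        (\<forall>S. toroidal_submodule n \<rho> S \<and> v \<in> S \<longrightarrow> S = UNIV) \<and>
        (\<forall>i\<le>n. \<forall>r. xop \<rho> \<epsilon> i r v = 0) \<and>
        (\<forall>h\<in>cartan_space n. kop \<rho> h v = qpow t (\<mu> h) *\<^sub>C v) \<and>
        (\<forall>\<eta>. \<forall>i\<le>n. \<forall>m::nat.
           phi t \<rho> \<eta> i (pmi \<eta> * int m) v = fls_nth (expansion \<eta> (\<Psi> i)) (int m) *\<^sub>C v))"

text \<open>\<open>V(e^(s\<Lambda>\<^sub>l) Y\<^bsub>l,a\<^esub>^s)\<close> and \<open>V(e^(-s\<Lambda>\<^sub>0) Y\<^bsub>0,b\<^esub>^(-s))\<close>, up to isomorphism.\<close>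

definition is_V_highest ::
  "nat \<Rightarrow> complex \<Rightarrow> nat \<Rightarrow> nat \<Rightarrow> complex \<Rightarrow> 'v::complex_vector toroidal_ops \<Rightarrow> bool" where
  "is_V_highest n t l s a =
     simple_l_extremal_module Pos n t
       (\<lambda>h. of_nat s * fund_weight l h)
       (\<lambda>i z. psi (qq t) (fls_const (a * qq t) * z) powi (if i = l then int s else 0))"

definition is_V_lowest ::
  "nat \<Rightarrow> complex \<Rightarrow> nat \<Rightarrow> complex \<Rightarrow> 'v::complex_vector toroidal_ops \<Rightarrow> bool" where
  "is_V_lowest n t s b =
     simple_l_extremal_module Neg n t
       (\<lambda>h. - of_nat s * fund_weight 0 h)
       (\<lambda>i z. psi (qq t) (fls_const (b * qq t) * z) powi (if i = 0 then - int s else 0))"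


section \<open>The Drinfeld coproduct on a tensor product\<close>

text \<open>The formal series with coefficients \<open>S k \<in> 'x\<close> is the expansion at \<open>u = 0\<close> of an
  element of \<open>'x \<otimes> \<complex>(u)\<close>, i.e. of a finite sum of terms \<open>x\<^sub>j \<otimes> P\<^sub>j(u)/Q\<^sub>j(u)\<close>, which is
  regular at \<open>u = 1\<close> and has the value \<open>y\<close> there.\<close>

definition regular_with_value :: "(int \<Rightarrow> 'x::complex_vector) \<Rightarrow> 'x \<Rightarrow> bool" where
  "regular_with_value S y \<longleftrightarrow>
     (\<exists>(N::nat) (x :: nat \<Rightarrow> 'x) (P :: nat \<Rightarrow> complex poly) (Q :: nat \<Rightarrow> complex poly).
        (\<forall>j<N. poly (Q j) 1 \<noteq> 0) \<and>
        (\<forall>k. S k = (\<Sum>j<N.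
           fls_nth (fps_to_fls (fps_of_poly (P j)) / fps_to_fls (fps_of_poly (Q j))) k *\<^sub>C x j)) \<and>
        y = (\<Sum>j<N. (poly (P j) 1 / poly (Q j) 1) *\<^sub>C x j))"

text \<open>The coefficient of \<open>u^k\<close> in the series defining \<open>x\<^sup>\<epsilon>\<^bsub>i,m\<^esub> (v \<otimes> w)\<close>.\<close>

fun drinfeld_series ::
  "complex \<Rightarrow> 'v::complex_vector toroidal_ops \<Rightarrow> 'w::complex_vector toroidal_ops \<Rightarrow>
   pm \<Rightarrow> nat \<Rightarrow> int \<Rightarrow> 'v \<Rightarrow> 'w \<Rightarrow> int \<Rightarrow> ('v, 'w) tensor" where
  "drinfeld_series t V W Pos i m v w k =
     (if k = 0 then xop V Pos i m v \<otimes>\<^sub>V w else 0)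
     + (if m \<le> k then phi t V Neg i (- (k - m)) v \<otimes>\<^sub>V xop W Pos i k w else 0)"
| "drinfeld_series t V W Neg i m v w k =
     (if 0 \<le> k then xop V Neg i (m - k) v \<otimes>\<^sub>V phi t W Pos i k w else 0)
     + (if k = m then v \<otimes>\<^sub>V xop W Neg i m w else 0)"

definition drinfeld_well_defined ::
  "nat \<Rightarrow> complex \<Rightarrow> 'v::complex_vector toroidal_ops \<Rightarrow> 'w::complex_vector toroidal_ops \<Rightarrow> bool" where
  "drinfeld_well_defined n t V W \<longleftrightarrow>
     (\<forall>\<epsilon>. \<forall>i\<le>n. \<forall>m v w. \<exists>y. regular_with_value (drinfeld_series t V W \<epsilon> i m v w) y)"

text \<open>The operators \<open>\<rho>\<close> on the tensor product act through the Drinfeld coproduct. The operators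
  \<open>h\<^bsub>i,m\<^esub>\<close> are determined by the \<open>k\<^sub>h\<close> and the coefficients of \<open>\<phi>\<^sup>\<plusminus>\<^sub>i(z)\<close>.\<close>

definition acts_by_drinfeld_coproduct ::
  "nat \<Rightarrow> complex \<Rightarrow> 'v::complex_vector toroidal_ops \<Rightarrow> 'w::complex_vector toroidal_ops \<Rightarrow>
   ('v, 'w) tensor toroidal_ops \<Rightarrow> bool" where
  "acts_by_drinfeld_coproduct n t V W \<rho> \<longleftrightarrow>
     (\<forall>\<epsilon>. \<forall>i\<le>n. \<forall>m v w.
        regular_with_value (drinfeld_series t V W \<epsilon> i m v w) (xop \<rho> \<epsilon> i m (v \<otimes>\<^sub>V w))) \<and>
     (\<forall>h\<in>cartan_space n. \<forall>v w. kop \<rho> h (v \<otimes>\<^sub>V w) = kop V h v \<otimes>\<^sub>V kop W h w) \<and>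
     (\<forall>\<epsilon>. \<forall>i\<le>n. \<forall>(m::nat) v w.
        phi t \<rho> \<epsilon> i (pmi \<epsilon> * int m) (v \<otimes>\<^sub>V w)
        = (\<Sum>p\<le>m. phi t V \<epsilon> i (pmi \<epsilon> * int p) v \<otimes>\<^sub>V phi t W \<epsilon> i (pmi \<epsilon> * int (m - p)) w))"

end

theory Submission
  imports Defs
begin

text \<open>
  On the simple \<open>l\<close>-highest weight module a vector of positive depth that is killed by all raising
  currents vanishes, since it generates a proper submodule. Hence \<open>x\<^sub>i\<^sup>-(z)v\<^sup>+\<close> is supported in the
  set \<open>\<Gamma> i\<close> of all \<open>aq^k\<close> with \<open>k\<close> larger than the cyclic distance of \<open>i\<close> and \<open>l\<close>. The
  quadratic relations move supports to neighbouring nodes by the factor \<open>q\<close>, and the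
  possible move by \<open>q\<^sup>-\<^sup>2\<close> at one node is excluded by the Serre relations. So on every vector the
  currents and the poles of \<open>\<phi>\<^sub>i(z)\<close> are supported in \<open>\<Gamma> i\<close>. An involution of the algebra
  reduces the lowest weight module to the highest weight case with parameter \<open>b\<^sup>-\<^sup>1\<close>, and the hypothesis on
  \<open>a / b\<close> makes the two supports disjoint at every node.

  The Drinfeld series in \<open>u\<close> are truncated products of sequences annihilated by polynomials, and their
  poles are the quotients of points of the two supports; thus they are rational and regular at \<open>u = 1\<close>. The
  defining relations hold between operator valued Laurent series in \<open>u\<close>: the two summands of
  \<open>\<Delta>\<^sub>D(x\<^sub>i\<^sup>\<plusminus>(z))\<close> cross with inverse factors, and the denominators can be cancelled because the series
  are bounded below. Evaluation at \<open>u = 1\<close> is multiplicative, so the relations survive.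
\<close>

text \<open>The obstacle is the quadratic relation at a single node: moving x_i^-(z) past x_i^-(w)
  permits the new support z = q^-2 w, which would carry a point below the least exponent allowed in
  \<open>\<Gamma> i\<close>. The bound 2 + d_l arises as follows. The exponents of the highest
  weight module at node i start at 1 plus the distance of i and l, those of the lowest weight
  module, b q^-k, at k = 1 plus the distance of i and 0; the two distances add up to at least d_l.
  Rationality in u holds only vector by vector: the polynomial annihilating a current depends on the
  vector it acts on, and no polynomial need serve the whole module. Evaluation at u = 1 is therefore
  defined on each tensor separately, and its multiplicativity needs an argument.\<close>

interpretation cvec: vector_space "scaleC :: complex \<Rightarrow> 'a \<Rightarrow> 'a::complex_vector"
  by (rule vector_space_scaleC)

lemma clinearI:
  fixes f :: "'a::complex_vector \<Rightarrow> 'b::complex_vector"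
  assumes "\<And>x y. f (x + y) = f x + f y" "\<And>c x. f (c *\<^sub>C x) = c *\<^sub>C f x"
  shows "clinear f"
  using assms by unfold_locales

lemma clinear_add: "clinear f \<Longrightarrow> f (x + y) = f x + f y"
  and clinear_scale: "clinear f \<Longrightarrow> f (c *\<^sub>C x) = c *\<^sub>C f x"
  by (auto simp: Vector_Spaces.linear_def module_hom_def module_hom_axioms_def)

lemma clinear_zero: "clinear f \<Longrightarrow> f 0 = 0"
  using clinear_scale[of f 0 0] by simp

lemma clinear_neg: "clinear f \<Longrightarrow> f (- x) = - f x"
  using clinear_scale[of f "-1" x] by (simp add: scaleC_one)

lemma clinear_diff: "clinear f \<Longrightarrow> f (x - y) = f x - f y"
  using clinear_add[of f x "- y"] by (simp add: clinear_neg)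

lemma clinear_sum: "clinear f \<Longrightarrow> f (sum g S) = (\<Sum>a\<in>S. f (g a))"
  by (induction S rule: infinite_finite_induct) (simp_all add: clinear_zero clinear_add)

lemmas clinear_simps = clinear_add clinear_scale clinear_zero clinear_neg clinear_diff clinear_sum

section \<open>Polynomials acting on sequences by shifts\<close>

text \<open>Sequences form a module over C[T], T being the shift. On the generating series of S the
  shift is multiplication by z^-1, so T - \<gamma> kills the coefficients of \<delta>(\<gamma>z),
  and statements about supports become statements about annihilating polynomials.\<close>

definition act :: "complex poly \<Rightarrow> (int \<Rightarrow> 'v::complex_vector) \<Rightarrow> int \<Rightarrow> 'v" where
  "act p S r = (\<Sum>k\<le>degree p. coeff p k *\<^sub>C S (r + int k))"

lemma act_bound: "degree p \<le> d \<Longrightarrow> act p S r = (\<Sum>k\<le>d. coeff p k *\<^sub>C S (r + int k))"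
  unfolding act_def by (rule sum.mono_neutral_left) (auto simp: coeff_eq_0)

lemma act_0 [simp]: "act 0 S = (\<lambda>r. 0)"
  by (simp add: act_def fun_eq_iff)

lemma act_zero_seq [simp]: "act p (\<lambda>r. 0) = (\<lambda>r. 0)"
  by (simp add: act_def fun_eq_iff)

lemma act_1 [simp]: "act 1 S = S"
  by (simp add: act_def fun_eq_iff scaleC_one)

lemma act_const [simp]: "act [:c:] S r = c *\<^sub>C S r"
  by (simp add: act_def)

lemma act_pCons: "act (pCons c p) S r = c *\<^sub>C S r + act p S (r + 1)"
proof -
  have "act (pCons c p) S r = (\<Sum>k\<le>Suc (degree p). coeff (pCons c p) k *\<^sub>C S (r + int k))"
    by (rule act_bound) (simp add: degree_pCons_le)
  also have "\<dots> = c *\<^sub>C S r + (\<Sum>k\<le>degree p. coeff p k *\<^sub>C S (r + int (Suc k)))"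
    by (subst sum.atMost_Suc_shift) simp
  finally show ?thesis by (simp add: act_def algebra_simps)
qed

lemma act_linear_factor: "act [:- c, 1:] S r = S (r + 1) - c *\<^sub>C S r"
  by (simp add: act_pCons scaleC_one)

lemma act_add: "act (p + q) S r = act p S r + act q S r"
proof -
  define d where "d = max (degree p) (degree q)"
  have "act (p + q) S r = (\<Sum>k\<le>d. coeff (p + q) k *\<^sub>C S (r + int k))"
    by (rule act_bound) (simp add: d_def degree_add_le_max)
  moreover have "act p S r = (\<Sum>k\<le>d. coeff p k *\<^sub>C S (r + int k))"
    "act q S r = (\<Sum>k\<le>d. coeff q k *\<^sub>C S (r + int k))"
    by (rule act_bound; simp add: d_def)+
  ultimately show ?thesis
    by (simp add: scaleC_add_left sum.distrib)
qed

lemma act_smult: "act (smult c p) S r = c *\<^sub>C act p S r"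
proof -
  have "act (smult c p) S r = (\<Sum>k\<le>degree p. coeff (smult c p) k *\<^sub>C S (r + int k))"
    by (rule act_bound) simp
  then show ?thesis by (simp add: act_def scaleC_scaleC cvec.scale_sum_right)
qed

lemma act_mult: "act (p * q) S = act p (act q S)"
proof (induction p)
  case 0
  then show ?case by simp
next
  case (pCons a p)
  have "act (pCons a p * q) S r = act (pCons a p) (act q S) r" for r
  proof -
    have "pCons a p * q = smult a q + pCons 0 (p * q)" by simp
    then have "act (pCons a p * q) S r = a *\<^sub>C act q S r + act (p * q) S (r + 1)"
      by (simp only: act_add act_smult act_pCons[of 0]) simp
    then show ?thesis by (simp add: act_pCons pCons.IH)
  qed
  then show ?case by (simp add: fun_eq_iff)
qed

lemma act_comm: "act p (act q S) = act q (act p S)"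
  by (metis act_mult mult.commute)

lemma act_seq_add: "act p (\<lambda>r. S r + S' r) = (\<lambda>r. act p S r + act p S' r)"
  by (simp add: fun_eq_iff act_def scaleC_add_right sum.distrib)

lemma act_seq_scale: "act p (\<lambda>r. c *\<^sub>C S r) = (\<lambda>r. c *\<^sub>C act p S r)"
  by (simp add: fun_eq_iff act_def cvec.scale_sum_right scaleC_scaleC mult.commute)

lemma act_seq_diff: "act p (\<lambda>r. S r - S' r) = (\<lambda>r. act p S r - act p S' r)"
  by (simp add: fun_eq_iff act_def cvec.scale_right_diff_distrib sum_subtractf)

lemma act_seq_sum: "act p (\<lambda>r. \<Sum>a\<in>A. S a r) = (\<lambda>r. \<Sum>a\<in>A. act p (S a) r)"
  by (induction A rule: infinite_finite_induct) (simp_all add: act_seq_add)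

lemma act_linear: "clinear f \<Longrightarrow> act p (\<lambda>r. f (S r)) = (\<lambda>r. f (act p S r))"
  by (simp add: fun_eq_iff act_def clinear_simps)

lemma act_shift: "act p (\<lambda>r. S (r + m)) = (\<lambda>r. act p S (r + m))"
  by (simp add: fun_eq_iff act_def algebra_simps)

lemma act_shift': "act p (\<lambda>r. S (m + r)) = (\<lambda>r. act p S (m + r))"
  by (simp add: fun_eq_iff act_def algebra_simps)

lemma act_scalar_seq: "act p (\<lambda>r. e r *\<^sub>C v) r = (\<Sum>k\<le>degree p. coeff p k * e (r + int k)) *\<^sub>C v"
  by (simp add: act_def scaleC_scaleC cvec.scale_sum_left)

lemma act_swap: "act p (\<lambda>a. act q (\<lambda>b. F a b) b) a = act q (\<lambda>b. act p (\<lambda>a. F a b) a) b"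
  unfolding act_def
  by (simp add: cvec.scale_sum_right scaleC_scaleC, subst sum.swap) (simp add: mult.commute)

lemma act_geometric:
  assumes "act [:- c, 1:] S = (\<lambda>r. 0)"
  shows "act q S r = poly q c *\<^sub>C S r"
proof -
  have "S (r + 1) = c *\<^sub>C S r" for r
    using fun_cong[OF assms, of r] by (simp add: act_linear_factor)
  then show ?thesis
    by (induction q arbitrary: r)
      (simp_all add: act_pCons scaleC_add_left scaleC_scaleC mult.commute)
qed

lemma constant_annihilator:
  assumes "act u S = (\<lambda>r. 0)" "degree u = 0" "u \<noteq> 0"
  shows "S = (\<lambda>r. 0)"
proof -
  obtain c where "u = [:c:]" using \<open>degree u = 0\<close> by (rule degree_eq_zeroE)
  then show ?thesis using assms by (auto simp: fun_eq_iff)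
qed

text \<open>If \<alpha> is a root of p, the sequence (T - \<alpha>)S is killed by q and by the
  remaining factor of p, hence vanishes by induction. So S is geometric with ratio \<alpha>, and q
  acts on it by the non-zero scalar q(\<alpha>).\<close>

lemma coprime_annihilators:
  assumes "act p S = (\<lambda>r. 0)" "act q S = (\<lambda>r. 0)" "p \<noteq> 0"
    and "\<And>z. poly p z = 0 \<Longrightarrow> poly q z \<noteq> 0"
  shows "S = (\<lambda>r. 0)"
  using assms
proof (induction "degree p" arbitrary: p S)
  case 0
  then show ?case using constant_annihilator[of p S] by simp
next
  case (Suc d)
  then obtain \<alpha> where \<alpha>: "poly p \<alpha> = 0"
    using fundamental_theorem_of_algebra[of p] by (auto simp: constant_degree)
  then obtain p' where p': "p = [:- \<alpha>, 1:] * p'"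
    by (metis dvdE poly_eq_0_iff_dvd)
  have "p' \<noteq> 0" using Suc.prems p' by auto
  then have "degree p = Suc (degree p')" unfolding p' by (subst degree_mult_eq) simp_all
  then have "d = degree p'" using Suc.hyps(2) by simp
  moreover have "act p' (act [:- \<alpha>, 1:] S) = (\<lambda>r. 0)"
    using Suc.prems(1) unfolding p' act_mult by (subst act_comm)
  moreover have "act q (act [:- \<alpha>, 1:] S) = (\<lambda>r. 0)"
    by (subst act_comm) (simp add: Suc.prems(2))
  moreover have "poly q z \<noteq> 0" if "poly p' z = 0" for z
    using Suc.prems(4)[of z] that by (simp add: p')
  ultimately have "act [:- \<alpha>, 1:] S = (\<lambda>r. 0)"
    using Suc.hyps(1) \<open>p' \<noteq> 0\<close> by blast
  then have "act q S r = poly q \<alpha> *\<^sub>C S r" for r by (rule act_geometric)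
  then show ?case using Suc.prems(2) Suc.prems(4)[OF \<alpha>] by (simp add: fun_eq_iff)
qed

text \<open>\<open>supported G S\<close>: the generating series of \<open>S\<close> is a combination of derivatives of
  \<open>\<delta>(\<gamma>z)\<close>, \<open>\<gamma> \<in> G\<close>.\<close>

definition ann :: "complex set \<Rightarrow> complex poly \<Rightarrow> bool" where
  "ann G p \<longleftrightarrow> p \<noteq> 0 \<and> (\<forall>z. poly p z = 0 \<longrightarrow> z \<in> G)"

definition supported :: "complex set \<Rightarrow> (int \<Rightarrow> 'v::complex_vector) \<Rightarrow> bool" where
  "supported G S \<longleftrightarrow> (\<exists>p. ann G p \<and> act p S = (\<lambda>r. 0))"

lemma ann_1 [simp]: "ann G 1" by (simp add: ann_def)

lemma ann_mult: "ann G p \<Longrightarrow> ann G q \<Longrightarrow> ann G (p * q)"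
  by (auto simp: ann_def)

lemma ann_power: "ann G p \<Longrightarrow> ann G (p ^ k)"
  by (induction k) (auto intro: ann_mult)

lemma ann_linear: "c \<in> G \<Longrightarrow> ann G [:- c, 1:]"
  by (auto simp: ann_def)

lemma ann_pcompose:
  assumes "ann G p" "c \<noteq> 0" "\<And>g. g \<in> G \<Longrightarrow> c * g \<in> G'"
  shows "ann G' (pcompose p [:0, inverse c:])"
proof -
  have "pcompose p [:0, inverse c:] \<noteq> 0"
    using assms by (simp add: ann_def pcompose_eq_0_iff)
  moreover have "z \<in> G'" if "poly (pcompose p [:0, inverse c:]) z = 0" for z
  proof -
    have "z * inverse c \<in> G" using that assms by (simp add: ann_def poly_pcompose)
    then show ?thesis using assms(3)[of "z * inverse c"] assms(2) by (simp add: field_simps)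
  qed
  ultimately show ?thesis by (auto simp: ann_def)
qed

lemma coeff_pcompose_scale: "coeff (pcompose p [:0, c:]) k = c ^ k * coeff p k"
  for p :: "complex poly"
proof (induction p arbitrary: k)
  case 0
  then show ?case by simp
next
  case (pCons a p)
  then show ?case by (cases k) (simp_all add: pcompose_pCons)
qed

lemma act_pcompose_scale:
  "act (pcompose p [:0, c:]) S r = (\<Sum>k\<le>degree p. coeff p k *\<^sub>C c ^ k *\<^sub>C S (r + int k))"
proof -
  have "degree (pcompose p [:0, c:]) \<le> degree p"
    by (rule degree_le) (simp add: coeff_pcompose_scale coeff_eq_0)
  from act_bound[OF this, of S r] show ?thesis
    by (simp add: coeff_pcompose_scale scaleC_scaleC mult.commute)
qed

lemma supported_add:
  assumes "supported G S" "supported G S'"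
  shows "supported G (\<lambda>r. S r + S' r)"
proof -
  obtain p q where "ann G p" "act p S = (\<lambda>r. 0)" "ann G q" "act q S' = (\<lambda>r. 0)"
    using assms unfolding supported_def by blast
  moreover have "act (p * q) (\<lambda>r. S r + S' r) = (\<lambda>r. act q (act p S) r + act p (act q S') r)"
    by (simp add: fun_eq_iff act_seq_add act_mult act_comm[of p q])
  ultimately show ?thesis
    unfolding supported_def by (intro exI[of _ "p * q"]) (simp add: ann_mult)
qed

lemma supported_zero [simp]: "supported G (\<lambda>r. 0)"
  unfolding supported_def by (intro exI[of _ 1]) simp

lemma supported_linear: "supported G S \<Longrightarrow> clinear f \<Longrightarrow> supported G (\<lambda>r. f (S r))"
  unfolding supported_def by (metis act_linear clinear_zero ext)

lemma clinear_scaleC: "clinear (\<lambda>x::'a::complex_vector. c *\<^sub>C x)"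
  by (rule clinearI) (simp_all add: scaleC_add_right scaleC_scaleC mult.commute)

lemma supported_scale: "supported G S \<Longrightarrow> supported G (\<lambda>r. c *\<^sub>C S r)"
  by (rule supported_linear[OF _ clinear_scaleC])

lemma supported_diff:
  assumes "supported G S" "supported G S'"
  shows "supported G (\<lambda>r. S r - S' r)"
  using supported_add[OF assms(1) supported_scale[OF assms(2), of "-1"]]
  by (simp add: scaleC_one)

lemma supported_shift: "supported G S \<Longrightarrow> supported G (\<lambda>r. S (r + m))"
  unfolding supported_def by (metis act_shift ext)

text \<open>Multiplication of the r-th term by c^r conjugates T into T/c; an annihilator p(T)
  becomes p(T/c), whose roots are those of p multiplied by c.\<close>

lemma supported_twist:
  assumes "supported G S" "c \<noteq> 0" "\<And>g. g \<in> G \<Longrightarrow> c * g \<in> G'"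
  shows "supported G' (\<lambda>r. c powi r *\<^sub>C S r)"
proof -
  obtain p where p: "ann G p" "act p S = (\<lambda>r. 0)"
    using assms unfolding supported_def by blast
  have "act (pcompose p [:0, inverse c:]) (\<lambda>r. c powi r *\<^sub>C S r) r = 0" for r
  proof -
    have "act (pcompose p [:0, inverse c:]) (\<lambda>r. c powi r *\<^sub>C S r) r = c powi r *\<^sub>C act p S r"
      unfolding act_pcompose_scale unfolding act_def using \<open>c \<noteq> 0\<close>
      by (simp add: cvec.scale_sum_right scaleC_scaleC power_int_add field_simps)
    then show ?thesis by (simp add: p)
  qed
  then show ?thesis
    unfolding supported_def using ann_pcompose[OF p(1) assms(2,3)] by (auto simp: fun_eq_iff)
qed

text \<open>The case of two variables: on \<open>H\<close> one has \<open>T\<^sub>z = c T\<^sub>w\<close>.\<close>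

lemma transfer_annihilator:
  assumes "\<And>z w. H (z + 1) w = c *\<^sub>C H z (w + 1)" and "c \<noteq> 0"
    and "\<And>z. act p (\<lambda>w. H z w) = (\<lambda>w. 0)"
  shows "act (pcompose p [:0, inverse c:]) (\<lambda>z. H z w) = (\<lambda>z. 0)"
proof
  fix z
  have *: "H (z + int k) w = c ^ k *\<^sub>C H z (w + int k)" for k z w
  proof (induction k arbitrary: w)
    case 0
    then show ?case by (simp add: scaleC_one)
  next
    case (Suc k)
    have "H (z + int (Suc k)) w = H ((z + int k) + 1) w" by (simp add: algebra_simps)
    also have "\<dots> = c *\<^sub>C H (z + int k) (w + 1)" by (rule assms(1))
    also have "\<dots> = c ^ Suc k *\<^sub>C H z (w + 1 + int k)" by (simp add: Suc.IH scaleC_scaleC)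
    finally show ?case by (simp add: algebra_simps)
  qed
  have "act (pcompose p [:0, inverse c:]) (\<lambda>z. H z w) z = act p (\<lambda>w. H z w) w"
    unfolding act_pcompose_scale unfolding act_def * using \<open>c \<noteq> 0\<close>
    by (simp add: scaleC_scaleC power_inverse)
  then show "act (pcompose p [:0, inverse c:]) (\<lambda>z. H z w) z = 0"
    by (simp add: assms(3))
qed

text \<open>The model case F(a, b) = \<alpha>^a \<gamma>^b has the ratio \<gamma>/\<alpha> along an
  antidiagonal. In general T - \<gamma>/\<alpha> turns the antidiagonal of F into those of (T_b -
  \<gamma>)F and (T_a - \<alpha>)F, which have annihilators of smaller degree. This step replaces m
  by m - 1, so the polynomial is found for all antidiagonals at once.\<close>

lemma supported_product:
  fixes F :: "int \<Rightarrow> int \<Rightarrow> 'v::complex_vector"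
  assumes "ann A p" "ann B q" "0 \<notin> A"
    and "\<And>b. act p (\<lambda>a. F a b) = (\<lambda>a. 0)" "\<And>a. act q (\<lambda>b. F a b) = (\<lambda>b. 0)"
  shows "\<exists>Q. ann {\<gamma> / \<alpha> | \<gamma> \<alpha>. \<gamma> \<in> B \<and> \<alpha> \<in> A} Q \<and> (\<forall>m. act Q (\<lambda>r. F (m - r) r) = (\<lambda>r. 0))"
  using assms
proof (induction "degree p + degree q" arbitrary: p q F rule: less_induct)
  case less
  note ap = less.prems(1) and aq = less.prems(2)
  show ?case
  proof (cases "degree p = 0 \<or> degree q = 0")
    case True
    have "F a b = 0" for a b
      using True constant_annihilator[OF less.prems(4)[of b]]
        constant_annihilator[OF less.prems(5)[of a]] ap aq
      by (auto simp: ann_def fun_eq_iff)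
    then show ?thesis by (intro exI[of _ 1]) simp
  next
    case False
    then obtain \<alpha> \<gamma> where root: "poly p \<alpha> = 0" "poly q \<gamma> = 0"
      using fundamental_theorem_of_algebra[of p] fundamental_theorem_of_algebra[of q]
      by (auto simp: constant_degree)
    then have in_AB: "\<alpha> \<in> A" "\<gamma> \<in> B" using ap aq by (auto simp: ann_def)
    then have "\<alpha> \<noteq> 0" using assms(3) by auto
    obtain p' q' where p': "p = [:- \<alpha>, 1:] * p'" and q': "q = [:- \<gamma>, 1:] * q'"
      using root by (metis dvdE poly_eq_0_iff_dvd)
    have nz: "p' \<noteq> 0" "q' \<noteq> 0" using ap aq p' q' by (auto simp: ann_def)
    have ann': "ann A p'" "ann B q'" using ap aq nz unfolding p' q' ann_def by auto
    have deg: "degree p' < degree p" "degree q' < degree q"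
      using nz unfolding p' q' by (subst degree_mult_eq; simp)+
    define F1 where "F1 = (\<lambda>a b. act [:- \<alpha>, 1:] (\<lambda>a. F a b) a)"
    define F2 where "F2 = (\<lambda>a b. act [:- \<gamma>, 1:] (\<lambda>b. F a b) b)"
    have "act p' (\<lambda>a. F1 a b) = (\<lambda>a. 0)" for b
      using less.prems(4)[of b] unfolding F1_def p' act_mult by (subst act_comm)
    moreover have "act q (\<lambda>b. F1 a b) = (\<lambda>b. 0)" for a
      unfolding F1_def act_swap[of "[:- \<alpha>, 1:]" q F a for a, symmetric]
      by (simp add: less.prems(5))
    ultimately obtain Q1 where Q1: "ann {\<gamma> / \<alpha> | \<gamma> \<alpha>. \<gamma> \<in> B \<and> \<alpha> \<in> A} Q1"
      "\<And>m. act Q1 (\<lambda>r. F1 (m - r) r) = (\<lambda>r. 0)"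
      using less.hyps[of p' q F1] deg ann' aq assms(3) by auto
    have "act p (\<lambda>a. F2 a b) = (\<lambda>a. 0)" for b
      unfolding F2_def act_swap[of p "[:- \<gamma>, 1:]" F] by (simp add: less.prems(4))
    moreover have "act q' (\<lambda>b. F2 a b) = (\<lambda>b. 0)" for a
      using less.prems(5)[of a] unfolding F2_def q' act_mult by (subst act_comm)
    ultimately obtain Q2 where Q2: "ann {\<gamma> / \<alpha> | \<gamma> \<alpha>. \<gamma> \<in> B \<and> \<alpha> \<in> A} Q2"
      "\<And>m. act Q2 (\<lambda>r. F2 (m - r) r) = (\<lambda>r. 0)"
      using less.hyps[of p q' F2] deg ann' ap assms(3) by auto
    let ?L = "[:- (\<gamma> / \<alpha>), 1:]"
    have L: "act ?L (\<lambda>r. F (m - r) r)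
        = (\<lambda>r. F2 (m - 1 - r) r - (\<gamma> / \<alpha>) *\<^sub>C F1 (m - 1 - r) r)" for m
      by (simp add: fun_eq_iff act_linear_factor F1_def F2_def scaleC_scaleC \<open>\<alpha> \<noteq> 0\<close>
          cvec.scale_right_diff_distrib algebra_simps)
    have "act (Q1 * Q2 * ?L) (\<lambda>r. F (m - r) r) r = 0" for m r
    proof -
      have "act (Q1 * Q2 * ?L) (\<lambda>r. F (m - r) r)
          = act (Q1 * Q2) (\<lambda>r. F2 (m - 1 - r) r - (\<gamma> / \<alpha>) *\<^sub>C F1 (m - 1 - r) r)"
        by (simp only: act_mult L)
      moreover have "act (Q1 * Q2) (\<lambda>r. F2 (m - 1 - r) r) = (\<lambda>r. 0)"
        by (simp add: act_mult Q2)
      moreover have "act (Q1 * Q2) (\<lambda>r. F1 (m - 1 - r) r) = (\<lambda>r. 0)"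
        by (simp add: mult.commute[of Q1 Q2] act_mult Q1)
      ultimately show ?thesis by (simp add: act_seq_diff act_seq_scale)
    qed
    then have "\<forall>m. act (Q1 * Q2 * ?L) (\<lambda>r. F (m - r) r) = (\<lambda>r. 0)"
      by blast
    moreover have "\<gamma> / \<alpha> \<in> {\<gamma> / \<alpha> | \<gamma> \<alpha>. \<gamma> \<in> B \<and> \<alpha> \<in> A}"
      using in_AB by blast
    then have "ann {\<gamma> / \<alpha> | \<gamma> \<alpha>. \<gamma> \<in> B \<and> \<alpha> \<in> A} (Q1 * Q2 * ?L)"
      by (intro ann_mult Q1(1) Q2(1) ann_linear)
    ultimately show ?thesis by blast
  qed
qed

section \<open>Exponentials of operator series\<close>

lemma op_power_coeff_cong:
  "(\<And>p. p \<le> m \<Longrightarrow> A p = A' p) \<Longrightarrow> op_power_coeff A j m v = op_power_coeff A' j m v"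
  by (induction j arbitrary: m) (auto intro!: sum.cong)

lemma op_exp_coeff_cong:
  "(\<And>p. p \<le> m \<Longrightarrow> A p = A' p) \<Longrightarrow> op_exp_coeff A m v = op_exp_coeff A' m v"
  unfolding op_exp_coeff_def using op_power_coeff_cong[of m A A'] by simp

lemma op_power_coeff_linear:
  assumes "\<And>p. clinear (A p)"
  shows "clinear (op_power_coeff A j m)"
proof (induction j arbitrary: m)
  case 0
  show ?case by (rule clinearI) simp_all
next
  case (Suc j)
  show ?case
    by (rule clinearI) (simp_all add: clinear_simps[OF assms] clinear_simps[OF Suc.IH]
        sum.distrib cvec.scale_sum_right)
qed

lemma op_exp_coeff_linear:
  assumes "\<And>p. clinear (A p)"
  shows "clinear (op_exp_coeff A m)"
  by (rule clinearI) (simp_all add: op_exp_coeff_def clinear_simps[OF op_power_coeff_linear[OF assms]]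
      sum.distrib cvec.scale_sum_right scaleC_scaleC scaleC_add_right mult.commute)

lemma op_power_coeff_mem:
  assumes "\<And>p u. p \<le> m \<Longrightarrow> u \<in> S \<Longrightarrow> A p u \<in> S" "csubspace S" "v \<in> S" "m' \<le> m"
  shows "op_power_coeff A j m' v \<in> S"
  using assms(4)
proof (induction j arbitrary: m')
  case 0
  then show ?case using assms by (simp add: cvec.subspace_0)
next
  case (Suc j)
  then show ?case using assms by (auto intro!: cvec.subspace_sum)
qed

lemma op_exp_coeff_mem:
  assumes "\<And>p u. p \<le> m \<Longrightarrow> u \<in> S \<Longrightarrow> A p u \<in> S" "csubspace S" "v \<in> S"
  shows "op_exp_coeff A m v \<in> S"
  unfolding op_exp_coeff_def using assms
  by (intro cvec.subspace_sum cvec.subspace_scale op_power_coeff_mem[where m = m]) auto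

lemma op_power_coeff_0:
  assumes "A 0 = (\<lambda>u. 0)" "j > 0"
  shows "op_power_coeff A j 0 v = 0"
  using assms by (cases j) simp_all

text \<open>The top coefficient of \<open>A\<close> enters the coefficient of an exponential only linearly.\<close>

lemma op_exp_coeff_top:
  assumes "A 0 = (\<lambda>u. 0)" "\<And>p. A p 0 = 0" "m > 0"
  shows "op_exp_coeff A m v = A m v + op_exp_coeff (A(m := \<lambda>u. 0)) m v"
proof -
  let ?B = "A(m := \<lambda>u. 0)"
  have zero: "op_power_coeff A' 1 m v = A' m v" if "\<And>p. A' p 0 = 0" for A' :: "nat \<Rightarrow> 'a \<Rightarrow> 'a"
  proof -
    have "A' p (op_power_coeff A' 0 (m - p) v) = (if p = m then A' m v else 0)" if "p \<le> m" for p
      using that by (simp add: \<open>\<And>p. A' p 0 = 0\<close>)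
    then have "op_power_coeff A' 1 m v = (\<Sum>p\<le>m. if p = m then A' m v else 0)"
      by (simp add: One_nat_def del: op_power_coeff.simps(1))
    then show ?thesis by simp
  qed
  have one: "op_power_coeff A 1 m v = A m v" "op_power_coeff ?B 1 m v = 0"
    using zero[of A] zero[of ?B] assms by simp_all
  \<comment> \<open>In a product of at least two factors the index m in one of them forces the index
    0 in all others, where \<open>A\<close> vanishes; so the top coefficient cannot occur.\<close>
  have ge2: "op_power_coeff A (Suc j) m v = op_power_coeff ?B (Suc j) m v" if "j > 0" for j
  proof -
    have "A p (op_power_coeff A j (m - p) v) = ?B p (op_power_coeff ?B j (m - p) v)"
      if "p \<le> m" for p
    proof -
      consider "p = 0" | "p = m" "p > 0" | "0 < p" "p < m"
        using \<open>p \<le> m\<close> by (cases "p = 0"; cases "p = m") auto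
      then show ?thesis
      proof cases
        case 1
        then show ?thesis using assms by simp
      next
        case 2
        then show ?thesis using assms \<open>j > 0\<close> op_power_coeff_0[of A j v] by simp
      next
        case 3
        have "op_power_coeff A j (m - p) v = op_power_coeff ?B j (m - p) v"
          by (rule op_power_coeff_cong) (use 3 in auto)
        then show ?thesis using 3 by simp
      qed
    qed
    then show ?thesis by (auto intro!: sum.cong)
  qed
  have "(1 / fact j) *\<^sub>C op_power_coeff A j m v
      = (if j = 1 then A m v else 0) + (1 / fact j) *\<^sub>C op_power_coeff ?B j m v" for j
  proof (cases j)
    case 0
    then show ?thesis by simp
  next
    case (Suc i)
    show ?thesis
    proof (cases "i = 0")
      case True
      then show ?thesis using Suc one by (simp del: op_power_coeff.simps add: scaleC_one)
    next
      case False
      then show ?thesis using Suc ge2[of i] by (simp del: op_power_coeff.simps)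
    qed
  qed
  then have "op_exp_coeff A m v
      = (\<Sum>j\<le>m. (if j = 1 then A m v else 0) + (1 / fact j) *\<^sub>C op_power_coeff ?B j m v)"
    unfolding op_exp_coeff_def by simp
  then show ?thesis
    unfolding op_exp_coeff_def sum.distrib using \<open>m > 0\<close> by simp
qed

text \<open>A logarithm found coefficient by coefficient: the z^m coefficient of exp(A(z)) is A_m
  plus an expression in the lower A_p, and can be solved for A_m even when the coefficients do not
  commute.\<close>

primrec op_log_approx :: "(nat \<Rightarrow> 'v \<Rightarrow> 'v::complex_vector) \<Rightarrow> nat \<Rightarrow> nat \<Rightarrow> 'v \<Rightarrow> 'v" where
  "op_log_approx c 0 = (\<lambda>p u. 0)"
| "op_log_approx c (Suc m) = (op_log_approx c m)
     (Suc m := \<lambda>u. c (Suc m) u - op_exp_coeff (op_log_approx c m) (Suc m) u)"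

definition op_log_coeff :: "(nat \<Rightarrow> 'v \<Rightarrow> 'v::complex_vector) \<Rightarrow> nat \<Rightarrow> 'v \<Rightarrow> 'v" where
  "op_log_coeff c m = op_log_approx c m m"

lemma op_log_approx_beyond: "p > m \<Longrightarrow> op_log_approx c m p = (\<lambda>u. 0)"
  by (induction m) auto

lemma op_log_approx_stable: "p \<le> m \<Longrightarrow> op_log_approx c m p = op_log_coeff c p"
  by (induction m) (auto simp: op_log_coeff_def le_Suc_eq)

lemma op_log_coeff_0 [simp]: "op_log_coeff c 0 = (\<lambda>u. 0)"
  by (simp add: op_log_coeff_def)

lemma op_log_coeff_linear:
  assumes "\<And>m. clinear (c m)"
  shows "clinear (op_log_coeff c m)"
proof -
  have "clinear (op_log_approx c m p)" for p
  proof (induction m arbitrary: p)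
    case 0
    show ?case by (rule clinearI) simp_all
  next
    case (Suc m)
    have "clinear (\<lambda>u. c (Suc m) u - op_exp_coeff (op_log_approx c m) (Suc m) u)"
      by (rule clinearI) (simp_all add: clinear_simps[OF assms]
          clinear_simps[OF op_exp_coeff_linear[OF Suc.IH]] cvec.scale_right_diff_distrib)
    then show ?case using Suc.IH by simp
  qed
  then show ?thesis by (simp add: op_log_coeff_def)
qed

lemma op_exp_log_coeff:
  assumes "\<And>m. clinear (c m)" "m > 0"
  shows "op_exp_coeff (op_log_coeff c) m v = c m v"
proof -
  obtain k where k: "m = Suc k" using \<open>m > 0\<close> gr0_implies_Suc by blast
  let ?A = "op_log_coeff c"
  have "op_exp_coeff ?A m v = ?A m v + op_exp_coeff (?A(m := \<lambda>u. 0)) m v"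
    using \<open>m > 0\<close> by (intro op_exp_coeff_top) (auto simp: clinear_zero[OF op_log_coeff_linear[OF assms(1)]])
  also have "op_exp_coeff (?A(m := \<lambda>u. 0)) m v = op_exp_coeff (op_log_approx c k) m v"
    by (rule op_exp_coeff_cong) (auto simp: k op_log_approx_beyond op_log_approx_stable le_Suc_eq)
  also have "?A m v = c m v - op_exp_coeff (op_log_approx c k) m v"
    by (simp add: op_log_coeff_def k)
  finally show ?thesis by simp
qed

section \<open>Modules over the quantum toroidal algebra\<close>

locale toroidal =
  fixes n :: nat and t :: complex and \<rho> :: "'v::complex_vector toroidal_ops"
  assumes module: "toroidal_module n t \<rho>"
    and q_not_root: "\<And>m::nat. 0 < m \<Longrightarrow> exp t ^ m \<noteq> 1"
begin

abbreviation x where "x \<equiv> xop \<rho>"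
abbreviation k where "k \<equiv> kop \<rho>"
abbreviation \<phi> where "\<phi> \<equiv> phi t \<rho>"
abbreviation q where "q \<equiv> exp t"

lemma q_sq: "q * q \<noteq> 1" using q_not_root[of 2] by (simp add: power2_eq_square)

lemma q_diff_nz: "q - inverse q \<noteq> 0"
  using q_sq by (simp add: field_simps)

lemma q_powi_neq_1: "m \<noteq> 0 \<Longrightarrow> q powi m \<noteq> 1"
  using q_not_root[of "nat m"] q_not_root[of "nat (- m)"]
  by (cases "m \<ge> 0") (auto simp: power_int_def power_inverse)

lemmas relations = module[unfolded toroidal_module_def]
lemmas relations1 = relations[THEN conjunct2]
lemmas relations2 = relations1[THEN conjunct2]
lemmas relations3 = relations2[THEN conjunct2]
lemmas relations4 = relations3[THEN conjunct2]
lemmas relations5 = relations4[THEN conjunct2]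
lemmas relations6 = relations5[THEN conjunct2]
lemmas relations7 = relations6[THEN conjunct2]
lemmas relations8 = relations7[THEN conjunct2]
lemmas relations9 = relations8[THEN conjunct2]
lemmas relations10 = relations9[THEN conjunct2]
lemmas relations11 = relations10[THEN conjunct2]
lemmas relations12 = relations11[THEN conjunct2]

lemma lin_x: "i \<le> n \<Longrightarrow> clinear (x \<epsilon> i r)"
  using relations[THEN conjunct1] by simp

lemma lin_k: "h \<in> cartan_space n \<Longrightarrow> clinear (k h)"
  using relations1[THEN conjunct1] by simp

lemma lin_h: "i \<le> n \<Longrightarrow> m \<noteq> 0 \<Longrightarrow> clinear (hop \<rho> i m)"
  using relations2[THEN conjunct1] by simp

lemma k_mult: "h \<in> cartan_space n \<Longrightarrow> h' \<in> cartan_space n \<Longrightarrow> k h (k h' v) = k (h + h') v"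
  using relations3[THEN conjunct1] by simp

lemma k_0 [simp]: "k 0 v = v"
  using relations4[THEN conjunct1] by simp

lemma k_phi: "h \<in> cartan_space n \<Longrightarrow> i \<le> n \<Longrightarrow> k h (\<phi> \<epsilon> i m v) = \<phi> \<epsilon> i m (k h v)"
  using relations5[THEN conjunct1] by simp

lemma phi_phi: "i \<le> n \<Longrightarrow> j \<le> n \<Longrightarrow> \<phi> \<epsilon> i m (\<phi> \<epsilon>' j m' v) = \<phi> \<epsilon>' j m' (\<phi> \<epsilon> i m v)"
  using relations6[THEN conjunct1] by simp

lemma k_x_k: "h \<in> cartan_space n \<Longrightarrow> j \<le> n \<Longrightarrow>
    k h (x \<epsilon> j r (k (- h) v)) = qpow t (of_int (pmi \<epsilon>) * simple_root n j h) *\<^sub>C x \<epsilon> j r v"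
  using relations7[THEN conjunct1] by simp

lemma phi_x: "i \<le> n \<Longrightarrow> j \<le> n \<Longrightarrow>
    \<phi> \<eta> i m (x \<epsilon> j (r - 1) v) - q powi (pmi \<epsilon> * cartan_matrix n i j) *\<^sub>C \<phi> \<eta> i (m - 1) (x \<epsilon> j r v)
    = q powi (pmi \<epsilon> * cartan_matrix n i j) *\<^sub>C x \<epsilon> j (r - 1) (\<phi> \<eta> i m v) - x \<epsilon> j r (\<phi> \<eta> i (m - 1) v)"
  using relations8[THEN conjunct1] by simp

lemma x_x: "i \<le> n \<Longrightarrow> j \<le> n \<Longrightarrow>
    x \<epsilon> i m (x \<epsilon> j (r - 1) v) - q powi (pmi \<epsilon> * cartan_matrix n i j) *\<^sub>C x \<epsilon> i (m - 1) (x \<epsilon> j r v)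
    = q powi (pmi \<epsilon> * cartan_matrix n i j) *\<^sub>C x \<epsilon> j (r - 1) (x \<epsilon> i m v) - x \<epsilon> j r (x \<epsilon> i (m - 1) v)"
  using relations10[THEN conjunct1] by simp

lemma x_pos_neg: "i \<le> n \<Longrightarrow> j \<le> n \<Longrightarrow>
    x Pos i m (x Neg j r v) - x Neg j r (x Pos i m v)
    = (if i = j then (1 / (q - inverse q)) *\<^sub>C (\<phi> Pos i (m + r) v - \<phi> Neg i (m + r) v) else 0)"
  using relations9[THEN conjunct1] by simp

lemma x_commute: "i \<le> n \<Longrightarrow> j \<le> n \<Longrightarrow> cartan_matrix n i j = 0 \<Longrightarrow>
    x \<epsilon> i m (x \<epsilon> j r v) = x \<epsilon> j r (x \<epsilon> i m v)"
  using relations12 by blast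

lemma serre:
  assumes "i \<le> n" "j \<le> n" "cartan_matrix n i j = - 1"
  shows "x \<epsilon> i m1 (x \<epsilon> i m2 (x \<epsilon> j r v)) - (q + inverse q) *\<^sub>C x \<epsilon> i m1 (x \<epsilon> j r (x \<epsilon> i m2 v))
      + x \<epsilon> j r (x \<epsilon> i m1 (x \<epsilon> i m2 v))
      + (x \<epsilon> i m2 (x \<epsilon> i m1 (x \<epsilon> j r v)) - (q + inverse q) *\<^sub>C x \<epsilon> i m2 (x \<epsilon> j r (x \<epsilon> i m1 v))
      + x \<epsilon> j r (x \<epsilon> i m2 (x \<epsilon> i m1 v))) = 0"
  using relations11[THEN conjunct1] assms by (simp add: Let_def)

lemma coroot_space: "i \<le> n \<Longrightarrow> coroot i \<in> cartan_space n"
  by (auto simp: cartan_space_def coroot_def)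

lemma uminus_space: "h \<in> cartan_space n \<Longrightarrow> - h \<in> cartan_space n"
  unfolding cartan_space_def using in_keys_iff by fastforce

lemma add_space: "h \<in> cartan_space n \<Longrightarrow> h' \<in> cartan_space n \<Longrightarrow> h + h' \<in> cartan_space n"
  using Poly_Mapping.keys_add[of h h'] by (auto simp: cartan_space_def)

lemma k_x:
  assumes "h \<in> cartan_space n" "j \<le> n"
  shows "k h (x \<epsilon> j r v) = qpow t (of_int (pmi \<epsilon>) * simple_root n j h) *\<^sub>C x \<epsilon> j r (k h v)"
  using k_x_k[OF assms, of \<epsilon> r "k h v"] k_mult[of "- h" h] assms uminus_space by simp

definition hcoeff :: "pm \<Rightarrow> nat \<Rightarrow> nat \<Rightarrow> 'v \<Rightarrow> 'v" where
  "hcoeff \<epsilon> i p u = (if p = 0 then 0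
     else (of_int (pmi \<epsilon>) * (q - inverse q)) *\<^sub>C hop \<rho> i (pmi \<epsilon> * int p) u)"

definition kpm :: "pm \<Rightarrow> nat \<Rightarrow> cartan" where
  "kpm \<epsilon> i = (if \<epsilon> = Pos then coroot i else - coroot i)"

lemma pmi_sq [simp]: "pmi \<epsilon> * (pmi \<epsilon> * m) = m" "pmi \<epsilon> * pmi \<epsilon> = 1" "pmi \<epsilon> \<noteq> 0"
  by (cases \<epsilon>; simp)+

lemma phi_nat: "\<phi> \<epsilon> i (pmi \<epsilon> * int m) v = k (kpm \<epsilon> i) (op_exp_coeff (hcoeff \<epsilon> i) m v)"
  by (simp add: phi_def hcoeff_def[abs_def] kpm_def)

lemma phi_wrong_sign: "pmi \<epsilon> * m < 0 \<Longrightarrow> \<phi> \<epsilon> i m v = 0"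
  by (simp add: phi_def)

lemma phi_pos_neg_index: "m < 0 \<Longrightarrow> \<phi> Pos i m v = 0" "m > 0 \<Longrightarrow> \<phi> Neg i m v = 0"
  by (simp_all add: phi_wrong_sign)

lemma phi_index_cases:
  obtains a where "m = pmi \<epsilon> * int a" | "pmi \<epsilon> * m < 0"
proof (cases "pmi \<epsilon> * m < 0")
  case False
  then have "m = pmi \<epsilon> * int (nat (pmi \<epsilon> * m))" by simp
  then show thesis using that by blast
qed (use that in blast)

lemma lin_hcoeff: "i \<le> n \<Longrightarrow> clinear (hcoeff \<epsilon> i p)"
proof -
  assume "i \<le> n"
  show ?thesis
  proof (cases "p = 0")
    case True
    then show ?thesis by (intro clinearI) (simp_all add: hcoeff_def)
  next
    case False
    then have "clinear (hop \<rho> i (pmi \<epsilon> * int p))" using \<open>i \<le> n\<close> by (intro lin_h) auto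
    then show ?thesis using False
      by (intro clinearI) (simp_all add: hcoeff_def clinear_simps scaleC_add_right scaleC_scaleC mult.commute)
  qed
qed

lemma kpm_space: "i \<le> n \<Longrightarrow> kpm \<epsilon> i \<in> cartan_space n"
  by (simp add: kpm_def coroot_space uminus_space)

lemma lin_phi: "i \<le> n \<Longrightarrow> clinear (\<phi> \<epsilon> i m)"
proof (rule phi_index_cases[of m \<epsilon>])
  fix a assume i: "i \<le> n" and a: "m = pmi \<epsilon> * int a"
  have "clinear (op_exp_coeff (hcoeff \<epsilon> i) a)" by (intro op_exp_coeff_linear lin_hcoeff i)
  then show ?thesis unfolding a using lin_k[OF kpm_space[OF i]]
    by (intro clinearI) (simp_all add: phi_nat clinear_simps)
next
  assume "pmi \<epsilon> * m < 0"
  then show ?thesis by (intro clinearI) (simp_all add: phi_wrong_sign)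
qed

text \<open>The exponential is triangular: up to the factor k_i^(+-1), the m-th coefficient of
  \<phi>_i is a multiple of h_(i,m) plus an expression in h's of smaller index. Induction on the
  index recovers h_(i,m) from k and \<phi>.\<close>

lemma hop_stable:
  assumes "csubspace S" and "i \<le> n"
    and "\<And>h u. h \<in> cartan_space n \<Longrightarrow> u \<in> S \<Longrightarrow> k h u \<in> S"
    and "\<And>\<epsilon> m u. u \<in> S \<Longrightarrow> \<phi> \<epsilon> i m u \<in> S"
    and "m \<noteq> 0" "u \<in> S"
  shows "hop \<rho> i m u \<in> S"
proof -
  have *: "hcoeff \<epsilon> i a u \<in> S" if "u \<in> S" for \<epsilon> a u
    using that
  proof (induction a arbitrary: u rule: less_induct)
    case (less a)
    show ?case
    proof (cases "a = 0")
      case True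
      then show ?thesis using assms(1) by (simp add: hcoeff_def cvec.subspace_0)
    next
      case False
      have 1: "op_exp_coeff (hcoeff \<epsilon> i) a u
          = hcoeff \<epsilon> i a u + op_exp_coeff ((hcoeff \<epsilon> i)(a := \<lambda>u. 0)) a u"
        using False by (intro op_exp_coeff_top)
          (auto simp: fun_eq_iff hcoeff_def clinear_zero[OF lin_hcoeff[OF assms(2)], unfolded hcoeff_def])
      have "op_exp_coeff ((hcoeff \<epsilon> i)(a := \<lambda>u. 0)) a u \<in> S"
        using less assms(1) by (intro op_exp_coeff_mem) (auto simp: cvec.subspace_0)
      moreover have "op_exp_coeff (hcoeff \<epsilon> i) a u = k (- kpm \<epsilon> i) (\<phi> \<epsilon> i (pmi \<epsilon> * int a) u)"
        using assms(2) by (simp add: phi_nat k_mult kpm_space uminus_space)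
      then have "op_exp_coeff (hcoeff \<epsilon> i) a u \<in> S"
        using assms less.prems by (simp add: kpm_space uminus_space)
      ultimately show ?thesis using 1 cvec.subspace_diff[OF assms(1)]
        by (metis add_diff_cancel_right')
    qed
  qed
  define \<epsilon> where "\<epsilon> = (if m > 0 then Pos else Neg)"
  have "pmi \<epsilon> * int (nat \<bar>m\<bar>) = m" by (simp add: \<epsilon>_def)
  then have "hop \<rho> i m u = (1 / (of_int (pmi \<epsilon>) * (q - inverse q))) *\<^sub>C hcoeff \<epsilon> i (nat \<bar>m\<bar>) u"
    using \<open>m \<noteq> 0\<close> q_diff_nz by (simp add: hcoeff_def scaleC_scaleC scaleC_one)
  then show ?thesis using *[OF assms(6)] assms(1) by (simp add: cvec.subspace_scale)
qed

text \<open>A substitute for a triangular decomposition: only lowering operators are applied. When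
  \<open>U\<close> is stable under k and \<phi> and killed by x^+, the closure under the other
  generators is a theorem.\<close>

inductive_set gen :: "'v set \<Rightarrow> 'v set" for U where
  gen_base: "u \<in> U \<Longrightarrow> u \<in> gen U"
| gen_zero: "0 \<in> gen U"
| gen_add: "u \<in> gen U \<Longrightarrow> w \<in> gen U \<Longrightarrow> u + w \<in> gen U"
| gen_scale: "u \<in> gen U \<Longrightarrow> c *\<^sub>C u \<in> gen U"
| gen_x: "u \<in> gen U \<Longrightarrow> i \<le> n \<Longrightarrow> x Neg i r u \<in> gen U"

lemma gen_subspace: "csubspace (gen U)"
  by (rule cvec.subspaceI) (auto intro: gen.intros)

lemmas gen_diff = cvec.subspace_diff[OF gen_subspace]

text \<open>The exchange relation between \<phi>(z) and x^-(w) is a recursion in the index of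
  \<phi>, modulo terms in which \<phi> already stands on the right. It is solved upwards for
  \<phi>^+ and downwards for \<phi>^-.\<close>

lemma gen_phi:
  assumes U: "\<And>\<epsilon> i m u. i \<le> n \<Longrightarrow> u \<in> U \<Longrightarrow> \<phi> \<epsilon> i m u \<in> U"
  shows "u \<in> gen U \<Longrightarrow> i \<le> n \<Longrightarrow> \<phi> \<epsilon> i m u \<in> gen U"
proof (induction arbitrary: m rule: gen.induct)
  case (gen_x u j r)
  let ?c = "q powi (pmi Neg * cartan_matrix n i j)"
  have IH: "x Neg j r (\<phi> \<epsilon> i m u) \<in> gen U" for m r
    using gen_x by (intro gen.gen_x) auto
  show ?case
  proof (cases \<epsilon>)
    case Pos
    \<comment> \<open>The index is offset by one so that the induction starts at -1, where \<phi>^+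
      is zero; for \<phi>^- the start is the index 1.\<close>
    have "\<phi> Pos i (int a - 1) (x Neg j r u) \<in> gen U" for a r
    proof (induction a arbitrary: r)
      case 0
      then show ?case by (simp add: phi_pos_neg_index gen.gen_zero)
    next
      case (Suc a)
      have "\<phi> Pos i (int a) (x Neg j r u) = ?c *\<^sub>C \<phi> Pos i (int a - 1) (x Neg j (r + 1) u)
          + (?c *\<^sub>C x Neg j r (\<phi> Pos i (int a) u) - x Neg j (r + 1) (\<phi> Pos i (int a - 1) u))"
        using phi_x[of i j Pos "int a" Neg "r + 1" u] gen_x by (simp add: algebra_simps)
      also have "\<dots> \<in> gen U"
        using Suc[of "r + 1"] IH Pos by (intro gen.gen_add gen.gen_scale gen_diff) auto
      finally show ?case by simp
    qed
    from this[of "nat (m + 1)"] Pos show ?thesis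
      by (cases "m < 0") (auto simp: phi_pos_neg_index gen.gen_zero)
  next
    case Neg
    have "\<phi> Neg i (1 - int a) (x Neg j r u) \<in> gen U" for a r
    proof (induction a arbitrary: r)
      case 0
      then show ?case by (simp add: phi_pos_neg_index gen.gen_zero)
    next
      case (Suc a)
      have "?c *\<^sub>C \<phi> Neg i (- int a) (x Neg j r u) = \<phi> Neg i (1 - int a) (x Neg j (r - 1) u)
          - (?c *\<^sub>C x Neg j (r - 1) (\<phi> Neg i (1 - int a) u) - x Neg j r (\<phi> Neg i (- int a) u))"
        using phi_x[of i j Neg "1 - int a" Neg r u] gen_x by (simp add: algebra_simps)
      also have "\<dots> \<in> gen U"
        using Suc[of "r - 1"] IH Neg by (intro gen.gen_scale gen_diff) auto
      finally have "inverse ?c *\<^sub>C ?c *\<^sub>C \<phi> Neg i (- int a) (x Neg j r u) \<in> gen U"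
        by (rule gen.gen_scale)
      then show ?case by (simp add: scaleC_scaleC scaleC_one)
    qed
    from this[of "nat (1 - m)"] Neg show ?thesis
      by (cases "m > 0") (auto simp: phi_pos_neg_index gen.gen_zero)
  qed
qed (auto simp: clinear_simps lin_phi intro: gen.intros U)

text \<open>Moving x^+ to the right past a lowering operator costs only \<phi>^+ - \<phi>^-, and
  \<phi> preserves the span; at the right end x^+ meets \<open>U\<close> and gives zero.\<close>

lemma gen_submodule:
  assumes phi: "\<And>\<epsilon> i m u. i \<le> n \<Longrightarrow> u \<in> U \<Longrightarrow> \<phi> \<epsilon> i m u \<in> U"
    and k: "\<And>h u. h \<in> cartan_space n \<Longrightarrow> u \<in> U \<Longrightarrow> k h u \<in> U"
    and x: "\<And>i r u. i \<le> n \<Longrightarrow> u \<in> U \<Longrightarrow> x Pos i r u = 0"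
  shows "toroidal_submodule n \<rho> (gen U)"
proof -
  have kk: "k h u \<in> gen U" if "u \<in> gen U" "h \<in> cartan_space n" for h u
    using that by induction (auto simp: clinear_simps lin_k k_x intro: gen.intros k)
  have pp: "\<phi> \<epsilon> i m u \<in> gen U" if "i \<le> n" "u \<in> gen U" for \<epsilon> i m u
    using gen_phi phi that by blast
  have "x Pos i r u \<in> gen U" if "u \<in> gen U" "i \<le> n" for i r u
    using that
  proof induction
    case (gen_x u j s)
    have "x Pos i r (x Neg j s u) = x Neg j s (x Pos i r u) +
        (if i = j then (1 / (q - inverse q)) *\<^sub>C (\<phi> Pos i (r + s) u - \<phi> Neg i (r + s) u) else 0)"
      using x_pos_neg[of i j r s u] gen_x by (simp add: algebra_simps)
    also have "\<dots> \<in> gen U"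
      using gen_x pp by (auto intro!: gen.intros(2-) gen_diff)
    finally show ?case .
  qed (auto simp: x clinear_simps lin_x intro: gen.intros)
  then have "x \<epsilon> i r u \<in> gen U" if "u \<in> gen U" "i \<le> n" for \<epsilon> i r u
    using that by (cases \<epsilon>) (auto intro: gen.intros)
  moreover have "hop \<rho> i m u \<in> gen U" if "u \<in> gen U" "i \<le> n" "m \<noteq> 0" for i m u
    using that kk pp by (intro hop_stable gen_subspace) auto
  ultimately show ?thesis unfolding toroidal_submodule_def using kk gen_subspace by blast
qed

end

lemma pcompose_power_smult:
  "pcompose p r = smult d p' \<Longrightarrow> pcompose (p ^ k) r = smult (d ^ k) (p' ^ k)"
  for p :: "complex poly"
  by (induction k) (simp_all add: pcompose_1 pcompose_mult mult.commute)

section \<open>The affine Cartan matrix\<close>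

lemma cartan_matrix_delta:
  assumes "2 \<le> n" "i \<le> n" "j \<le> n"
  shows "cartan_matrix n j i = (if j = i then 2 else 0) - (if j = (if i = n then 0 else i + 1) then 1 else 0)
    - (if j = (if i = 0 then n else i - 1) then 1 else 0)"
proof -
  have succ: "(m + 1) mod (n + 1) = (if m = n then 0 else m + 1)" if "m \<le> n" for m
    using that by auto
  show ?thesis
    unfolding cartan_matrix_def succ[OF assms(2)] succ[OF assms(3)] using assms by auto
qed

lemma cartan_matrix_diag [simp]: "cartan_matrix n i i = 2"
  by (simp add: cartan_matrix_def)

lemma cartan_matrix_sym: "cartan_matrix n i j = cartan_matrix n j i"
  by (auto simp: cartan_matrix_def)

lemma cartan_matrix_off_diag: "i \<noteq> j \<Longrightarrow> cartan_matrix n i j = 0 \<or> cartan_matrix n i j = - 1"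
  by (simp add: cartan_matrix_def)

definition cyc_dist :: "nat \<Rightarrow> nat \<Rightarrow> nat \<Rightarrow> int" where
  "cyc_dist n l i = min \<bar>int i - int l\<bar> (int n + 1 - \<bar>int i - int l\<bar>)"

lemma cyc_dist_self [simp]: "cyc_dist n l l = 0"
  by (simp add: cyc_dist_def)

lemma cyc_dist_step:
  assumes "2 \<le> n" "i \<le> n" "j \<le> n" "l \<le> n" "cartan_matrix n i j = - 1"
  shows "cyc_dist n l i \<le> cyc_dist n l j + 1"
proof -
  have "int j = int i + 1 \<or> int i = int j + 1 \<or> int i = 0 \<and> int j = int n \<or> int j = 0 \<and> int i = int n"
    using assms unfolding cartan_matrix_delta[OF assms(1,3,2)] by (auto split: if_splits)
  then show ?thesis
    using assms(2-4) unfolding cyc_dist_def by (elim disjE conjE) linarith+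
qed

text \<open>The triangle inequality on the cycle of n + 1 nodes, \<open>dmin n l\<close> being the
  distance of 0 and l. This is where d_l enters the bound on a / b.\<close>

lemma cyc_dist_dmin: "l \<le> n \<Longrightarrow> i \<le> n \<Longrightarrow> int (dmin n l) \<le> cyc_dist n l i + cyc_dist n 0 i"
  unfolding cyc_dist_def dmin_def by auto

text \<open>A multiple of \<open>\<rho>\<^sup>\<or>\<close>: every simple root takes the value \<open>r\<close> on \<open>height_coweight n r\<close>.\<close>

definition height_coweight :: "nat \<Rightarrow> int \<Rightarrow> cartan" where
  "height_coweight n r =
     (\<Sum>j\<le>n. Poly_Mapping.single (Hgen j) (of_int r * (of_nat j * of_nat (n + 1 - j) / 2)))
     + Poly_Mapping.single Dgen (of_int r * of_nat (n + 1))"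

lemma lookup_height_coweight:
  "Poly_Mapping.lookup (height_coweight n r) (Hgen j)
     = (if j \<le> n then of_int r * (of_nat j * of_nat (n + 1 - j) / 2) else 0)"
  "Poly_Mapping.lookup (height_coweight n r) Dgen = of_int r * of_nat (n + 1)"
  by (simp_all add: height_coweight_def lookup_add lookup_sum lookup_single when_def)

lemma height_coweight_space: "height_coweight n r \<in> cartan_space n"
  unfolding cartan_space_def
proof (rule CollectI, rule subsetI)
  fix h assume "h \<in> Poly_Mapping.keys (height_coweight n r)"
  then show "h \<in> insert Dgen (Hgen ` {..n})"
    by (cases h) (auto simp: in_keys_iff lookup_height_coweight split: if_splits)
qed

lemma simple_root_height_coweight:
  assumes "2 \<le> n" "i \<le> n"
  shows "simple_root n i (height_coweight n r) = of_int r"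
proof -
  define c :: "nat \<Rightarrow> rat" where "c j = of_int r * (of_nat j * of_nat (n + 1 - j) / 2)" for j
  define su pr where "su = (if i = n then 0 else i + 1)" and "pr = (if i = 0 then n else i - 1)"
  have le: "su \<le> n" "pr \<le> n" using assms by (auto simp: su_def pr_def)
  have "(\<Sum>j\<le>n. Poly_Mapping.lookup (height_coweight n r) (Hgen j) * of_int (cartan_matrix n j i))
      = (\<Sum>j\<le>n. (if j = i then 2 * c j else 0) - (if j = su then c j else 0) - (if j = pr then c j else 0))"
    using assms by (intro sum.cong)
      (auto simp: lookup_height_coweight cartan_matrix_delta c_def su_def pr_def)
  also have "\<dots> = 2 * c i - c su - c pr"
    using le assms by (simp add: sum_subtractf)
  finally have sum: "(\<Sum>j\<le>n. Poly_Mapping.lookup (height_coweight n r) (Hgen j)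
      * of_int (cartan_matrix n j i)) = 2 * c i - c su - c pr" .
  \<comment> \<open>j(n + 1 - j)/2 has second difference -1, which settles the nodes other than 0.
    At node 0 the neighbours 1 and n contribute -n/2 each, and the coefficient n + 1 of d brings the
    total to 1, all times r.\<close>
  show ?thesis
    unfolding simple_root_def sum lookup_height_coweight(2)
    using assms by (auto simp: c_def su_def pr_def of_nat_diff field_simps)
qed

section \<open>Supports of the currents on a simple l-highest weight module\<close>

text \<open>In \<open>phi_v0\<close> denominators are cleared: \<psi>(aqz) = (q z^-1 - a)/(z^-1 -
  aq) and T is multiplication by z^-1, so both expansions, multiplied by (T - aq)^e, become the same
  Laurent polynomial (q z^-1 - a)^e. No expansion of a rational function is needed after this
  point.\<close>

locale highest_weight = toroidal +
  fixes l s :: nat and a :: complex and v0 :: 'a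
  assumes n_ge_2: "2 \<le> n" and l_le: "l \<le> n" and a_nz: "a \<noteq> 0"
    and simple: "simple_toroidal_module n t \<rho>"
    and generates: "\<And>S. toroidal_submodule n \<rho> S \<Longrightarrow> v0 \<in> S \<Longrightarrow> S = UNIV"
    and x_v0: "\<And>i r. i \<le> n \<Longrightarrow> x Pos i r v0 = 0"
    and k_v0: "\<And>h. h \<in> cartan_space n \<Longrightarrow> k h v0 = qpow t (of_nat s * fund_weight l h) *\<^sub>C v0"
    and phi_v0_eigen: "\<And>\<eta> i m. i \<le> n \<Longrightarrow> \<exists>c. \<phi> \<eta> i m v0 = c *\<^sub>C v0"
    and phi_v0: "\<And>\<eta> i r. i \<le> n \<Longrightarrow>
      act ([:- (a * q), 1:] ^ (if i = l then s else 0)) (\<lambda>m. \<phi> \<eta> i m v0) r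
      = (if r \<le> 0 then coeff ([:- a, q:] ^ (if i = l then s else 0)) (nat (- r)) else 0) *\<^sub>C v0"
begin

lemma zero_submodule: "toroidal_submodule n \<rho> {0}"
  by (auto simp: toroidal_submodule_def cvec.subspace_def clinear_simps[OF lin_x] clinear_simps[OF lin_k]
      clinear_simps[OF lin_h])

lemma v0_nz: "v0 \<noteq> 0"
  using generates[OF zero_submodule] simple unfolding simple_toroidal_module_def by auto

text \<open>The coweight \<rho>^\<or> measures depth: on a vector obtained from \<open>v0\<close> by
  N lowering operators, \<open>kh r\<close> is the scalar (\<kappa> q^-N)^r. The sequence of the
  vectors \<open>kh r u\<close> thus records the depths occurring in u as a support, and
  \<open>supported\<close> applies to it as to a current.\<close>

definition \<kappa> :: complex where
  "\<kappa> = qpow t (of_nat s * fund_weight l (height_coweight n 1))"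

lemma \<kappa>_nz: "\<kappa> \<noteq> 0" by (simp add: \<kappa>_def qpow_def)

abbreviation kh :: "int \<Rightarrow> 'a \<Rightarrow> 'a" where "kh r \<equiv> k (height_coweight n r)"

lemma lin_kh: "clinear (kh r)" by (intro lin_k height_coweight_space)

lemma kh_v0: "kh r v0 = \<kappa> powi r *\<^sub>C v0"
proof -
  have "fund_weight l (height_coweight n r) = of_int r * fund_weight l (height_coweight n 1)"
    by (simp add: fund_weight_def lookup_height_coweight)
  then have "t * of_rat (of_nat s * fund_weight l (height_coweight n r))
      = of_int r * (t * of_rat (of_nat s * fund_weight l (height_coweight n 1)))"
    by (simp add: of_rat_mult algebra_simps)
  then have "qpow t (of_nat s * fund_weight l (height_coweight n r)) = \<kappa> powi r"
    by (simp only: \<kappa>_def qpow_def exp_power_int)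
  then show ?thesis
    by (simp add: k_v0 height_coweight_space)
qed

lemma kh_x:
  assumes "j \<le> n" shows "kh r (x Neg j m u) = inverse q powi r *\<^sub>C x Neg j m (kh r u)"
proof -
  have "qpow t (- of_int r) = inverse q powi r"
    by (simp add: qpow_def of_rat_minus exp_minus exp_power_int power_int_inverse mult.commute)
  then show ?thesis
    using assms by (simp add: k_x height_coweight_space simple_root_height_coweight n_ge_2)
qed

text \<open>On a vector killed by x^+ the exchange relation between \<phi> and x^+ becomes a
  homogeneous recursion in the index of \<phi>, starting where \<phi> vanishes.\<close>

lemma x_pos_phi:
  assumes "\<And>j r. j \<le> n \<Longrightarrow> x Pos j r u = 0" "i \<le> n" "j \<le> n"
  shows "x Pos j r (\<phi> \<eta> i m u) = 0"
proof -
  let ?c = "q powi (pmi Pos * cartan_matrix n i j)"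
  have rel: "?c *\<^sub>C x Pos j (r - 1) (\<phi> \<eta> i m u) = x Pos j r (\<phi> \<eta> i (m - 1) u)" for r m
    using phi_x[OF assms(2,3), of \<eta> m Pos r u] assms
    by (simp add: clinear_zero[OF lin_phi])
  show ?thesis
  proof (cases \<eta>)
    case Pos
    have "x Pos j r (\<phi> Pos i (int b - 1) u) = 0" for b r
    proof (induction b arbitrary: r)
      case 0
      then show ?case using assms by (simp add: phi_pos_neg_index clinear_zero[OF lin_x])
    next
      case (Suc b)
      have "?c *\<^sub>C x Pos j r (\<phi> Pos i (int b) u) = 0"
        using rel[of "r + 1" "int b"] Suc.IH Pos by simp
      then show ?case by (simp add: cvec.scale_eq_0_iff)
    qed
    from this[of _ "nat (m + 1)"] Pos assms show ?thesis
      by (cases "m < 0") (auto simp: phi_pos_neg_index clinear_zero[OF lin_x])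
  next
    case Neg
    have "x Pos j r (\<phi> Neg i (1 - int b) u) = 0" for b r
    proof (induction b arbitrary: r)
      case 0
      then show ?case using assms by (simp add: phi_pos_neg_index clinear_zero[OF lin_x])
    next
      case (Suc b)
      show ?case using rel[of r "1 - int b"] Suc.IH Neg by simp
    qed
    from this[of _ "nat (1 - m)"] Neg assms show ?thesis
      by (cases "m > 0") (auto simp: phi_pos_neg_index clinear_zero[OF lin_x])
  qed
qed

text \<open>A simple module has no singular vectors of positive depth: the submodule generated by such a
  vector does not contain the weight of \<open>v0\<close>.\<close>

lemma no_singular_vectors:
  assumes sing: "\<And>j r. j \<le> n \<Longrightarrow> x Pos j r u = 0"
    and weight: "\<And>r. kh r u = (\<kappa> * q powi (- int N)) powi r *\<^sub>C u" and "N > 0"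
  shows "u = 0"
proof -
  \<comment> \<open>The single vector is enlarged to all singular vectors of its depth, because
    \<open>gen_submodule\<close> requires stability under k and \<phi>.\<close>
  define U where "U = {u. (\<forall>r. kh r u = (\<kappa> * q powi (- int N)) powi r *\<^sub>C u) \<and>
    (\<forall>j\<le>n. \<forall>r. x Pos j r u = 0)}"
  \<comment> \<open>These are the ratios belonging to depths at least 1. The ratio \<kappa> of
    \<open>v0\<close> is not among them since q is not a root of unity, so \<open>v0\<close> cannot
    lie in the generated submodule.\<close>
  define G where "G = {\<kappa> * q powi (- m) | m. m \<ge> 1}"
  have sub: "toroidal_submodule n \<rho> (gen U)"
  proof (rule gen_submodule)
    fix \<epsilon> i m u assume i: "i \<le> n" and u: "u \<in> U"
    show "\<phi> \<epsilon> i m u \<in> U"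
      using u x_pos_phi[OF _ i] i unfolding U_def
      by (auto simp: k_phi height_coweight_space clinear_scale[OF lin_phi])
  next
    fix h u assume h: "h \<in> cartan_space n" and u: "u \<in> U"
    have "x Pos j r (k h u) = 0" if "j \<le> n" for j r
    proof -
      have "qpow t (of_int (pmi Pos) * simple_root n j h) *\<^sub>C x Pos j r (k h u) = 0"
        using k_x[OF h that, of Pos r u] u that h
        by (simp add: U_def clinear_zero[OF lin_k])
      then show ?thesis by (simp add: cvec.scale_eq_0_iff qpow_def)
    qed
    moreover have "kh r (k h u) = k h (kh r u)" for r
      using h by (simp add: k_mult height_coweight_space add.commute)
    ultimately show "k h u \<in> U"
      using u h by (simp add: U_def clinear_scale[OF lin_k])
  next
    show "x Pos i r u = 0" if "i \<le> n" "u \<in> U" for i r u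
      using that by (simp add: U_def)
  qed
  have geometric: "act [:- c, 1:] (\<lambda>r. c powi r *\<^sub>C u) = (\<lambda>r. 0)" if "c \<noteq> 0" for c and u :: 'a
    using that by (simp add: fun_eq_iff act_linear_factor power_int_add scaleC_scaleC mult.commute)
  have "supported G (\<lambda>r. kh r y)" if "y \<in> gen U" for y
    using that
  proof induction
    case (gen_base u)
    let ?c = "\<kappa> * q powi (- int N)"
    have "?c \<in> G" using \<open>N > 0\<close> by (auto simp: G_def intro!: exI[of _ "int N"])
    moreover have "(\<lambda>r. kh r u) = (\<lambda>r. ?c powi r *\<^sub>C u)"
      using gen_base by (auto simp: U_def)
    moreover have "?c \<noteq> 0" by (simp add: \<kappa>_nz)
    ultimately show ?case
      unfolding supported_def using geometric[of ?c u] ann_linear by metis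
  next
    case (gen_x u i m)
    have "inverse q * g \<in> G" if g: "g \<in> G" for g
    proof -
      obtain m where m: "g = \<kappa> * q powi (- m)" "m \<ge> 1" using g unfolding G_def by blast
      have "inverse q * g = \<kappa> * q powi (- (m + 1))"
        unfolding m(1) by (simp add: power_int_diff power_int_minus field_simps)
      then show ?thesis using m(2) by (auto simp: G_def intro!: exI[of _ "m + 1"])
    qed
    then have "supported G (\<lambda>r. inverse q powi r *\<^sub>C x Neg i m (kh r u))"
      using supported_twist[OF supported_linear[OF gen_x.IH lin_x[OF gen_x.hyps(2)]], of "inverse q" G]
      by simp
    then show ?case using gen_x by (simp add: kh_x)
  qed (simp_all add: clinear_simps[OF lin_kh] supported_add supported_scale)
  moreover have "\<not> supported G (\<lambda>r. kh r v0)"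
  proof
    assume "supported G (\<lambda>r. kh r v0)"
    then obtain p where p: "ann G p" "act p (\<lambda>r. kh r v0) = (\<lambda>r. 0)" unfolding supported_def by blast
    have "act p (\<lambda>r. kh r v0) 0 = poly p \<kappa> *\<^sub>C kh 0 v0"
      by (rule act_geometric) (simp add: kh_v0 geometric[OF \<kappa>_nz])
    then have "poly p \<kappa> = 0"
      using p v0_nz by (simp add: kh_v0 cvec.scale_eq_0_iff)
    then have "\<kappa> \<in> G" using p by (simp add: ann_def)
    then obtain m where "q powi (- m) = 1" "m \<ge> 1" using \<kappa>_nz by (auto simp: G_def)
    then show False using q_powi_neq_1[of "- m"] by simp
  qed
  ultimately have "gen U \<noteq> UNIV" by blast
  then have "gen U = {0}"
    using sub simple unfolding simple_toroidal_module_def by blast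
  moreover have "u \<in> U" using sing weight by (simp add: U_def)
  ultimately show ?thesis using gen_base by blast
qed

section \<open>Lowering currents of one node near the highest weight vector\<close>

abbreviation e :: "nat \<Rightarrow> nat" where "e i \<equiv> if i = l then s else 0"
abbreviation pol :: "nat \<Rightarrow> complex poly" where "pol i \<equiv> [:- (a * q), 1:] ^ e i"
abbreviation num :: "nat \<Rightarrow> complex poly" where "num i \<equiv> [:- a, q:] ^ e i"
abbreviation xm where "xm \<equiv> x Neg"

lemma lin_xm: "i \<le> n \<Longrightarrow> clinear (xm i r)" by (rule lin_x)

lemma act_kh: "kh r (act p S m) = act p (\<lambda>m. kh r (S m)) m"
  by (simp add: act_linear[OF lin_kh])

text \<open>Applying x_i^+ yields (T - aq)^e on \<phi>_i^+ - \<phi>_i^-, which vanishes on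
  \<open>v0\<close> because the two expansions agree after the denominators are cleared. The vector
  is singular of depth 1, hence zero. For i different from l the polynomial is 1 and the current
  itself kills \<open>v0\<close>.\<close>

lemma base_0:
  assumes i: "i \<le> n"
  shows "act (pol i) (\<lambda>r. xm i r v0) = (\<lambda>r. 0)"
proof
  fix m
  show "act (pol i) (\<lambda>r. xm i r v0) m = 0"
  proof (rule no_singular_vectors[where N = 1])
    fix j r assume j: "j \<le> n"
    have D: "x Pos j r (xm i m v0) = (if j = i then (1 / (q - inverse q)) *\<^sub>C
        (\<phi> Pos i (r + m) v0 - \<phi> Neg i (r + m) v0) else 0)" for m
      using x_pos_neg[OF j i, of r m v0] x_v0[OF j] i by (simp add: clinear_zero[OF lin_x])
    have "x Pos j r (act (pol i) (\<lambda>m. xm i m v0) m) = act (pol i) (\<lambda>m. x Pos j r (xm i m v0)) m"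
      by (simp only: act_linear[OF lin_x[OF j]])
    also have "\<dots> = 0"
    proof (cases "j = i")
      case True
      have "act (pol i) (\<lambda>m. \<phi> \<eta> i (r + m) v0) m
          = (if r + m \<le> 0 then coeff (num i) (nat (- (r + m))) else 0) *\<^sub>C v0" for \<eta>
        by (subst act_shift'[of "pol i" "\<lambda>m. \<phi> \<eta> i m v0"]) (simp only: phi_v0[OF i])
      moreover have "x Pos j r (xm i m v0)
          = (1 / (q - inverse q)) *\<^sub>C (\<phi> Pos i (r + m) v0 - \<phi> Neg i (r + m) v0)" for m
        using D True by simp
      ultimately show ?thesis by (simp only: act_seq_scale act_seq_diff) simp
    next
      case False
      then show ?thesis by (simp add: D)
    qed
    finally show "x Pos j r (act (pol i) (\<lambda>r. xm i r v0) m) = 0" .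
  next
    fix r
    have "kh r (act (pol i) (\<lambda>r. xm i r v0) m)
        = act (pol i) (\<lambda>m. (\<kappa> * q powi (- int 1)) powi r *\<^sub>C xm i m v0) m"
      by (simp add: act_kh kh_x i kh_v0 clinear_scale[OF lin_xm[OF i]] scaleC_scaleC
          power_int_mult_distrib power_int_minus mult.commute)
    then show "kh r (act (pol i) (\<lambda>r. xm i r v0) m)
        = (\<kappa> * q powi (- int 1)) powi r *\<^sub>C act (pol i) (\<lambda>r. xm i r v0) m"
      by (simp only: act_seq_scale)
  qed simp
qed

text \<open>Passing x_i^-(w) could add to \<phi>_i(z) a pole with T_z = c T_w, c = q^-2, that is at
  a q^-1, since T_w = aq on x_i^-(w)v0. This is precisely the zero of the numerator q T - a, so the
  old denominator still suffices.\<close>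

lemma phi_x_v0:
  assumes i: "i \<le> n"
  shows "act (pol i) (\<lambda>z. \<phi> Pos i z (xm i w v0)) m = act (pol i) (\<lambda>z. \<phi> Neg i z (xm i w v0)) m"
proof -
  define c where "c = inverse (q * q)"
  have c_nz: "c \<noteq> 0" by (simp add: c_def)
  have c_powi: "q powi (pmi Neg * cartan_matrix n i i) = c"
    by (simp add: c_def power_int_minus power2_eq_square power_int_def)
  define nn where "nn r = (if r \<le> 0 then coeff (num i) (nat (- r)) else 0)" for r
  define R where "R \<eta> r w = act (pol i) (\<lambda>z. \<phi> \<eta> i z (xm i w v0)) r" for \<eta> r w
  have R_rel: "R \<eta> r w = c *\<^sub>C R \<eta> (r - 1) (w + 1) + (c * nn r) *\<^sub>C xm i w v0 - nn (r - 1) *\<^sub>C xm i (w + 1) v0"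
    for \<eta> r w
  proof -
    have rel: "\<phi> \<eta> i z (xm i w v0) = c *\<^sub>C \<phi> \<eta> i (z + - 1) (xm i (w + 1) v0)
        + c *\<^sub>C xm i w (\<phi> \<eta> i z v0) - xm i (w + 1) (\<phi> \<eta> i (z + - 1) v0)" for z
      using phi_x[OF i i, of \<eta> z Neg "w + 1" v0] unfolding c_powi by (simp add: algebra_simps)
    have "act (pol i) (\<lambda>z. xm i w' (\<phi> \<eta> i z v0)) r = nn r *\<^sub>C xm i w' v0" for w' r
      by (simp only: act_linear[OF lin_xm[OF i]] phi_v0[OF i] nn_def clinear_scale[OF lin_xm[OF i]])
    moreover have "act (pol i) (\<lambda>z. xm i w' (\<phi> \<eta> i (z + - 1) v0)) r = nn (r - 1) *\<^sub>C xm i w' v0" for w' r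
      using act_shift[of "pol i" "\<lambda>z. xm i w' (\<phi> \<eta> i z v0)" "-1"] calculation by simp
    moreover have "act (pol i) (\<lambda>z. \<phi> \<eta> i (z + - 1) (xm i (w + 1) v0)) r = R \<eta> (r - 1) (w + 1)"
      using act_shift[of "pol i" "\<lambda>z. \<phi> \<eta> i z (xm i (w + 1) v0)" "-1"] by (simp add: R_def)
    ultimately show ?thesis
      unfolding R_def rel[of _] act_seq_diff act_seq_add act_seq_scale
      by (simp add: scaleC_scaleC flip: R_def)
  qed
  define E where "E r w = R Pos r w - R Neg r w" for r w
  have E_rel: "E (r + 1) w = c *\<^sub>C E r (w + 1)" for r w
    unfolding E_def using R_rel[of Pos "r + 1" w] R_rel[of Neg "r + 1" w]
    by (simp add: cvec.scale_right_diff_distrib)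
  have deg_pol: "degree (pol i) = e i" by (simp add: degree_power_eq)
  have deg_num: "degree (num i) = e i" by (simp add: degree_power_eq)
  \<comment> \<open>Removing the term in x_i^-(w) leaves a recursion whose inhomogeneity involves
    x_i^-(w + 1) alone and which can be summed explicitly.\<close>
  define R' where "R' r w = R Pos r w - (c * nn r) *\<^sub>C xm i w v0" for r w
  have R'_rel: "R' (r + 1) w = c *\<^sub>C R' r (w + 1) + ((c * c - 1) * nn r) *\<^sub>C xm i (w + 1) v0" for r w
    unfolding R'_def using R_rel[of Pos "r + 1" w]
    by (simp add: cvec.scale_right_diff_distrib scaleC_scaleC algebra_simps cvec.scale_left_diff_distrib)
  \<comment> \<open>The summation starts at the index -e - 1: a polynomial of degree e in T reaches
    from there only up to the index -1, where \<phi>^+ vanishes.\<close>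
  have R'_sum: "R' (- int (e i) - 1 + int b) w
      = (c * c - 1) *\<^sub>C (\<Sum>k<b. c ^ k *\<^sub>C nn (- int (e i) - 2 + int b - int k) *\<^sub>C xm i (w + 1 + int k) v0)"
    for b w
  proof (induction b arbitrary: w)
    case 0
    have "\<phi> Pos i (- int (e i) - 1 + int k) u = 0" if "k \<le> e i" for k u
      using that by (intro phi_pos_neg_index) linarith
    then have "R Pos (- int (e i) - 1) w = 0"
      unfolding R_def act_def deg_pol by (intro sum.neutral) (simp add: algebra_simps)
    moreover have "nn (- int (e i) - 1) = 0"
      unfolding nn_def using deg_num by (simp add: coeff_eq_0 nat_add_distrib)
    ultimately show ?case by (simp add: R'_def)
  next
    case (Suc b)
    have "R' (- int (e i) - 1 + int (Suc b)) w
        = c *\<^sub>C R' (- int (e i) - 1 + int b) (w + 1)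
          + ((c * c - 1) * nn (- int (e i) - 1 + int b)) *\<^sub>C xm i (w + 1) v0"
      using R'_rel[of "- int (e i) - 1 + int b" w] by (simp add: algebra_simps)
    also have "\<dots> = (c * c - 1) *\<^sub>C
        ((\<Sum>k<b. c ^ Suc k *\<^sub>C nn (- int (e i) - 2 + int b - int k) *\<^sub>C xm i (w + 1 + int (Suc k)) v0)
          + nn (- int (e i) - 1 + int b) *\<^sub>C xm i (w + 1) v0)"
      unfolding Suc.IH
      by (simp add: scaleC_add_right cvec.scale_sum_right scaleC_scaleC algebra_simps)
    also have "(\<Sum>k<b. c ^ Suc k *\<^sub>C nn (- int (e i) - 2 + int b - int k) *\<^sub>C xm i (w + 1 + int (Suc k)) v0)
          + nn (- int (e i) - 1 + int b) *\<^sub>C xm i (w + 1) v0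
        = (\<Sum>k<Suc b. c ^ k *\<^sub>C nn (- int (e i) - 2 + int (Suc b) - int k) *\<^sub>C xm i (w + 1 + int k) v0)"
      by (subst sum.lessThan_Suc_shift) (simp add: algebra_simps scaleC_one)
    finally show ?case .
  qed
  have num_pol: "pcompose (num i) [:0, c:] = smult (inverse q ^ e i) (pol i)"
  proof -
    have "pcompose [:- a, q:] [:0, c:] = smult (inverse q) [:- (a * q), 1:]"
      by (simp add: pcompose_pCons c_def)
    then show ?thesis by (rule pcompose_power_smult)
  qed
  \<comment> \<open>At index 1 the series \<phi>^- contributes nothing, and the explicit sum for
    \<phi>^+ is num(cT) on x_i^-(w + 1)v0. As num(cT) is a multiple of (T - aq)^e, it vanishes by
    \<open>base_0\<close>. The relation T_z E = c T_w E then carries the zero to every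
    index.\<close>
  have E_1: "E 1 w = 0" for w
  proof -
    have "\<phi> Neg i (1 + int k) u = 0" for k u by (intro phi_pos_neg_index) linarith
    then have "R Neg 1 w = 0" unfolding R_def act_def by simp
    moreover have "R Pos 1 w = R' (- int (e i) - 1 + int (e i + 2)) w"
      by (simp add: R'_def nn_def)
    moreover have "(\<Sum>k<e i + 2. c ^ k *\<^sub>C nn (- int (e i) - 2 + int (e i + 2) - int k) *\<^sub>C xm i (w + 1 + int k) v0)
        = (\<Sum>k\<le>e i. coeff (num i) k *\<^sub>C c ^ k *\<^sub>C xm i (w + 1 + int k) v0)"
      unfolding nn_def using deg_num
      by (intro sum.mono_neutral_cong_right)
        (auto simp: scaleC_scaleC mult.commute coeff_eq_0 not_le)
    moreover have "\<dots> = act (pcompose (num i) [:0, c:]) (\<lambda>r. xm i r v0) (w + 1)"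
      by (simp only: act_pcompose_scale deg_num)
    moreover have "\<dots> = 0"
      unfolding num_pol act_smult base_0[OF i] by simp
    ultimately show ?thesis unfolding E_def using R'_sum[of "e i + 2" w] by simp
  qed
  have up: "E (1 + int b) w = 0" for b w
  proof (induction b arbitrary: w)
    case (Suc b)
    show ?case using E_rel[of "1 + int b" w] Suc.IH by (simp add: algebra_simps)
  qed (simp add: E_1)
  have down: "E (1 - int b) w = 0" for b w
  proof (induction b arbitrary: w)
    case (Suc b)
    have "c *\<^sub>C E (1 - int (Suc b)) w = 0"
      using E_rel[of "1 - int (Suc b)" "w - 1"] Suc.IH[of "w - 1"] by simp
    then show ?case using c_nz by (simp add: cvec.scale_eq_0_iff)
  qed (simp add: E_1)
  have "E m w = 0"
    using up[of "nat (m - 1)" w] down[of "nat (1 - m)" w] by (cases "m \<ge> 1") simp_all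
  then show ?thesis by (simp add: E_def R_def)
qed

end

context highest_weight
begin

text \<open>x_i^+ produces a multiple of (T - aq)^e x_i^-(z)v0 and (T - aq)^e on the difference of
  \<phi>_i^+ and \<phi>_i^- at x_i^-(w)v0; both vanish. The polynomial is the same one as on
  \<open>v0\<close>, as the induction through \<open>triple\<close> requires.\<close>

lemma base_1:
  assumes i: "i \<le> n"
  shows "act (pol i) (\<lambda>z. xm i z (xm i w v0)) = (\<lambda>z. 0)"
proof
  fix m
  let ?d = "1 / (q - inverse q)"
  show "act (pol i) (\<lambda>z. xm i z (xm i w v0)) m = 0"
  proof (rule no_singular_vectors[where N = 2])
    fix j r assume j: "j \<le> n"
    have zero: "xm i z 0 = 0" "x Pos j z 0 = 0" for z
      using i j by (simp_all add: clinear_zero[OF lin_x])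
    have Dx: "x Pos j r (xm i w v0) = (if j = i then ?d *\<^sub>C (\<phi> Pos i (r + w) v0 - \<phi> Neg i (r + w) v0) else 0)"
      using x_pos_neg[OF j i, of r w v0] x_v0[OF j] zero by simp
    have swap: "x Pos j r (xm i z (xm i w v0)) = xm i z (x Pos j r (xm i w v0))
        + (if j = i then ?d *\<^sub>C (\<phi> Pos i (r + z) (xm i w v0) - \<phi> Neg i (r + z) (xm i w v0)) else 0)" for z
      using x_pos_neg[OF j i, of r z "xm i w v0"] by (simp add: algebra_simps)
    have "x Pos j r (act (pol i) (\<lambda>z. xm i z (xm i w v0)) m) = act (pol i) (\<lambda>z. x Pos j r (xm i z (xm i w v0))) m"
      by (simp only: act_linear[OF lin_x[OF j]])
    also have "\<dots> = 0"
    proof (cases "j = i")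
      case True
      obtain c1 c2 where c: "\<phi> Pos i (r + w) v0 = c1 *\<^sub>C v0" "\<phi> Neg i (r + w) v0 = c2 *\<^sub>C v0"
        using phi_v0_eigen[OF i] by metis
      have "x Pos j r (xm i w v0) = (?d * (c1 - c2)) *\<^sub>C v0"
        unfolding Dx c by (simp only: True simp_thms if_True scaleC_scaleC cvec.scale_left_diff_distrib[symmetric])
      then have "x Pos j r (xm i z (xm i w v0)) = (?d * (c1 - c2)) *\<^sub>C xm i z v0
        + ?d *\<^sub>C (\<phi> Pos i (r + z) (xm i w v0) - \<phi> Neg i (r + z) (xm i w v0))" for z
        using swap[of z] True by (simp add: clinear_scale[OF lin_xm[OF i]])
      moreover have "act (pol i) (\<lambda>z. \<phi> \<eta> i (r + z) (xm i w v0)) m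
          = act (pol i) (\<lambda>z. \<phi> \<eta> i z (xm i w v0)) (r + m)" for \<eta>
        using act_shift'[of "pol i" "\<lambda>z. \<phi> \<eta> i z (xm i w v0)" r] by simp
      moreover have "act (pol i) (\<lambda>z. xm i z v0) m = 0"
        using base_0[OF i] by simp
      ultimately show ?thesis
        by (simp only: act_seq_scale act_seq_diff act_seq_add phi_x_v0[OF i]) simp
    next
      case False
      then have "x Pos j r (xm i z (xm i w v0)) = 0" for z
        using swap[of z] by (simp add: Dx zero)
      then show ?thesis by (simp only: act_zero_seq)
    qed
    finally show "x Pos j r (act (pol i) (\<lambda>z. xm i z (xm i w v0)) m) = 0" .
  next
    fix r
    have "q powi (- int 2) = inverse q * inverse q"
      by (simp add: power_int_minus power2_eq_square)
    then have "inverse q powi r * (inverse q powi r * \<kappa> powi r) = (\<kappa> * q powi (- int 2)) powi r"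
      by (simp only: power_int_mult_distrib ac_simps)
    then have "kh r (xm i z (xm i w v0)) = (\<kappa> * q powi (- int 2)) powi r *\<^sub>C xm i z (xm i w v0)" for z
      by (simp add: kh_x i kh_v0 clinear_scale[OF lin_xm[OF i]] scaleC_scaleC)
    then show "kh r (act (pol i) (\<lambda>z. xm i z (xm i w v0)) m)
        = (\<kappa> * q powi (- int 2)) powi r *\<^sub>C act (pol i) (\<lambda>z. xm i z (xm i w v0)) m"
      by (simp only: act_kh act_seq_scale)
  qed simp
qed

lemma cartan_Neg_diag: "q powi (pmi Neg * cartan_matrix n i i) = inverse (q * q)"
  by (simp add: power_int_minus power2_eq_square power_int_def)

text \<open>If \<open>x(z)\<close> has support \<open>\<gamma>\<close> on both \<open>x(w)u\<close> and \<open>u\<close>, the part of \<open>x(z)x(w)x(w')u\<close> away from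
  \<open>z = \<gamma>\<close> sits at \<open>z = q\<^sup>-\<^sup>2w\<close>, hence also at \<open>z = q\<^sup>-\<^sup>2w'\<close>; so it is supported on \<open>w = w'\<close>, where
  the quadratic relation makes it antisymmetric in \<open>w\<close> and \<open>w'\<close>.\<close>

lemma triple:
  assumes i: "i \<le> n" and p: "p = [:- g, 1:] ^ N" and g: "g \<noteq> 0"
    and u: "act p (\<lambda>z. xm i z u) = (\<lambda>z. 0)"
    and u1: "\<And>w. act p (\<lambda>z. xm i z (xm i w u)) = (\<lambda>z. 0)"
  shows "act p (\<lambda>z. xm i z (xm i w (xm i w' u))) = (\<lambda>z. 0)"
proof -
  define c where "c = inverse (q * q)"
  have c: "c \<noteq> 0" "c \<noteq> 1"
    using q_sq unfolding c_def by (simp, metis inverse_eq_1_iff)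
  define B where "B z w w' = act p (\<lambda>z. xm i z (xm i w (xm i w' u))) z" for z w w'
  have zero: "xm i z 0 = 0" for z using i by (simp add: clinear_zero[OF lin_x])
  have xx: "xm i m (xm i (r - 1) y) = c *\<^sub>C xm i (m - 1) (xm i r y)
      + c *\<^sub>C xm i (r - 1) (xm i m y) - xm i r (xm i (m - 1) y)" for m r y
    using x_x[OF i i, of Neg m r y] unfolding cartan_Neg_diag c_def[symmetric] by (simp add: algebra_simps)
  \<comment> \<open>In the two terms of the quadratic relation where x(w) stands on the left, p(T_z)
    meets x(z)x(w')u and gives zero. What remains says T_z = c T_w on \<open>B\<close>.\<close>
  have B_zw: "B (z + 1) w w' = c *\<^sub>C B z (w + 1) w'" for z w w'
  proof -
    have r: "xm i (z + 1) (xm i w (xm i w' u)) = c *\<^sub>C xm i z (xm i (w + 1) (xm i w' u))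
      + c *\<^sub>C xm i w (xm i (z + 1) (xm i w' u)) - xm i (w + 1) (xm i z (xm i w' u))" for z
      using xx[of "z + 1" "w + 1"] by simp
    have "act p (\<lambda>z. xm i (z + 1) (xm i w (xm i w' u))) z = c *\<^sub>C B z (w + 1) w'"
      unfolding r act_seq_add act_seq_diff act_seq_scale act_linear[OF lin_x[OF i]]
        act_shift[of p "\<lambda>z. xm i z (xm i w' u)"] u1 zero B_def by simp
    then show ?thesis
      using act_shift[of p "\<lambda>z. xm i z (xm i w (xm i w' u))" 1] by (simp add: B_def)
  qed
  have B_ww: "B z (w + 1) w' = c *\<^sub>C B z w (w' + 1) + c *\<^sub>C B z w' (w + 1) - B z (w' + 1) w" for z w w'
  proof -
    have "xm i z (xm i (w + 1) (xm i w' u)) = c *\<^sub>C xm i z (xm i w (xm i (w' + 1) u))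
        + c *\<^sub>C xm i z (xm i w' (xm i (w + 1) u)) - xm i z (xm i (w' + 1) (xm i w u))" for z
      using xx[of "w + 1" "w' + 1" u] by (simp add: clinear_simps[OF lin_x[OF i]])
    then show ?thesis unfolding B_def by (simp only: act_seq_add act_seq_diff act_seq_scale)
  qed
  have B_w: "act p (\<lambda>w. B z w w') = (\<lambda>w. 0)" for z w'
  proof
    fix w
    have "act p (\<lambda>w. B z w w') w = act p (\<lambda>z. act p (\<lambda>w. xm i z (xm i w (xm i w' u))) w) z"
      unfolding B_def by (rule act_swap)
    also have "\<dots> = 0"
      by (simp only: act_linear[OF lin_x[OF i]] u1 zero act_zero_seq)
    finally show "act p (\<lambda>w. B z w w') w = 0" .
  qed
  have B_w': "act p (\<lambda>w'. B z w w') = (\<lambda>w. 0)" for z w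
  proof
    fix w'
    have "act p (\<lambda>w'. B z w w') w' = act p (\<lambda>z. act p (\<lambda>w'. xm i z (xm i w (xm i w' u))) w') z"
      unfolding B_def by (rule act_swap)
    also have "\<dots> = 0"
      by (simp only: act_linear[OF lin_x[OF i]] u zero act_zero_seq)
    finally show "act p (\<lambda>w'. B z w w') w' = 0" .
  qed
  \<comment> \<open>\<open>L\<close> is (T_w - c T_w')B, and the quadratic relation makes it
    antisymmetric in w and w'. Reading T_z = c T_w in both of its forms gives T_w L = T_w'
    L.\<close>
  define L where "L z w w' = B z (w + 1) w' - c *\<^sub>C B z w (w' + 1)" for z w w'
  have L_alt: "L z w w' = c *\<^sub>C B z w' (w + 1) - B z (w' + 1) w" for z w w'
    unfolding L_def B_ww[of z w w'] by simp
  have "c *\<^sub>C L z (w + 1) w' = c *\<^sub>C L z w (w' + 1)" for z w w'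
  proof -
    have "c *\<^sub>C L z (w + 1) w' = L (z + 1) w w'"
      unfolding L_def B_zw by (simp add: cvec.scale_right_diff_distrib)
    also have "\<dots> = c *\<^sub>C L z w (w' + 1)"
      unfolding L_alt B_zw by (simp add: cvec.scale_right_diff_distrib)
    finally show ?thesis .
  qed
  then have L_sum: "L z (w + 1) w' = L z w (w' + 1)" for z w w'
    using c by (simp add: cvec.scale_left_imp_eq)
  \<comment> \<open>\<open>C\<close> is (T_w - T_w')B, and (T_w - T_w')L = 0 becomes T_w C = c T_w'
    C. Both shifts have only the eigenvalue g, and c differs from 1, so the annihilators are
    coprime.\<close>
  define C where "C z w w' = B z (w + 1) w' - B z w (w' + 1)" for z w w'
  have C_step: "C z (w + 1) w' = c *\<^sub>C C z w (w' + 1)" for z w w'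
    using L_sum[of z w w'] by (simp add: L_def C_def cvec.scale_right_diff_distrib algebra_simps)
  have C_act: "act p (\<lambda>w. C z w w') = (\<lambda>w. 0)" "act p (\<lambda>w'. C z w w') = (\<lambda>w'. 0)" for z w w'
    unfolding C_def using act_shift[of p "\<lambda>w. B z w w'" 1] act_shift[of p "\<lambda>w'. B z w w'" 1]
    by (simp_all add: act_seq_diff B_w B_w')
  have "(\<lambda>w. C z w w') = (\<lambda>w. 0)" for z w'
  proof (rule coprime_annihilators)
    show "act p (\<lambda>w. C z w w') = (\<lambda>w. 0)" by (rule C_act)
    show "act (pcompose p [:0, inverse c:]) (\<lambda>w. C z w w') = (\<lambda>w. 0)"
      by (rule transfer_annihilator[where H = "C z"]) (use C_step c C_act in auto)
    show "p \<noteq> 0" by (simp add: p)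
    show "poly (pcompose p [:0, inverse c:]) y \<noteq> 0" if "poly p y = 0" for y
      using that c g by (auto simp: p poly_pcompose field_simps)
  qed
  then have "C z w w' = 0" for z w w' by (rule fun_cong)
  then have B_sum: "B z (w + 1) w' = B z w (w' + 1)" for z w w'
    by (simp add: C_def)
  have B_sum_nat: "B z (w + int k) w' = B z w (w' + int k)" for z w w' k
  proof (induction k arbitrary: w')
    case (Suc k)
    have "B z (w + int (Suc k)) w' = B z (w + int k) (w' + 1)"
      using B_sum[of z "w + int k" w'] by (simp add: algebra_simps)
    then show ?case using Suc.IH[of "w' + 1"] by (simp add: algebra_simps)
  qed simp
  have B_sym: "B z w w' = B z w' w" for z w w'
    using B_sum_nat[of z w "nat (w' - w)" w] B_sum_nat[of z w' "nat (w - w')" w'] by (cases "w \<le> w'") auto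
  \<comment> \<open>Now \<open>B\<close> depends on w + w' only. Then \<open>L\<close> is (1 - c)TB
    and, by the antisymmetric form, also its negative.\<close>
  have "B z (w + 1) w' = 0" for z w w'
  proof -
    have "(1 - c) *\<^sub>C B z (w + 1) w' = L z w w'"
      unfolding L_def B_sum[symmetric] by (simp add: cvec.scale_left_diff_distrib scaleC_one)
    also have "\<dots> = (c - 1) *\<^sub>C B z (w + 1) w'"
      unfolding L_alt B_sum[symmetric, of z w' w] B_sym[of z "w' + 1" w]
      unfolding B_sum[symmetric] by (simp add: cvec.scale_left_diff_distrib scaleC_one)
    finally have "((1 - c) - (c - 1)) *\<^sub>C B z (w + 1) w' = 0"
      by (simp only: cvec.scale_left_diff_distrib) simp
    moreover have "(1 - c) - (c - 1) \<noteq> 0" using c by (simp add: algebra_simps)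
    ultimately show ?thesis by (simp add: cvec.scale_eq_0_iff)
  qed
  from this[of _ "w - 1" w'] have "B z w w' = 0" for z by simp
  then show ?thesis by (simp add: B_def fun_eq_iff)
qed

section \<open>Supports of lowering currents on words of given node sequence\<close>

inductive word :: "nat list \<Rightarrow> 'a \<Rightarrow> bool" where
  word_Nil: "word [] v0"
| word_Cons: "word I u \<Longrightarrow> i \<le> n \<Longrightarrow> word (i # I) (xm i r u)"

inductive_cases word_NilE: "word [] u"
inductive_cases word_ConsE: "word (i # I) u"

definition \<Gamma> :: "nat \<Rightarrow> complex set" where
  "\<Gamma> i = {a * q powi m | m. m \<ge> cyc_dist n l i + 1}"

text \<open>One polynomial must serve all words with the node sequence \<open>I\<close>, whatever
  their mode indices: the exchange arguments sum over these indices and let a polynomial act on one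
  of them.\<close>

definition bounded_support :: "nat \<Rightarrow> nat list \<Rightarrow> bool" where
  "bounded_support i I \<longleftrightarrow>
     (\<exists>p. ann (\<Gamma> i) p \<and> (\<forall>u. word I u \<longrightarrow> act p (\<lambda>r. xm i r u) = (\<lambda>r. 0)))"

lemma ann_pol: "ann (\<Gamma> i) (pol i)"
proof -
  have "a * q \<in> \<Gamma> l" unfolding \<Gamma>_def by (auto intro!: exI[of _ 1])
  then show ?thesis by (auto intro!: ann_power ann_linear)
qed

lemma act_xm_0: "i \<le> n \<Longrightarrow> xm i r 0 = 0" by (simp add: clinear_zero[OF lin_x])

text \<open>The polynomial does not grow with the length: \<open>triple\<close> deduces the case of
  N letters from those of N - 1 and N - 2, and \<open>base_0\<close>, \<open>base_1\<close> are the
  two starting cases.\<close>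

lemma replicate_support:
  assumes i: "i \<le> n"
  shows "word (replicate N i) u \<Longrightarrow> act (pol i) (\<lambda>r. xm i r u) = (\<lambda>r. 0)"
proof (induction N arbitrary: u rule: less_induct)
  case (less N)
  consider "N = 0" | "N = 1" | M where "N = Suc (Suc M)"
    by (metis One_nat_def old.nat.exhaust)
  then show ?case
  proof cases
    case 1
    then show ?thesis using less.prems base_0[OF i] by (auto elim: word_NilE)
  next
    case 2
    then show ?thesis using less.prems base_1[OF i] by (auto elim!: word_ConsE word_NilE)
  next
    case (3 M)
    then obtain w w' u' where u: "u = xm i w (xm i w' u')" "word (replicate M i) u'"
      using less.prems by (auto elim!: word_ConsE)
    have "act (pol i) (\<lambda>z. xm i z (xm i w u')) = (\<lambda>z. 0)" for w
      using u(2) i by (intro less.IH[of "Suc M"]) (auto simp: 3 intro: word_Cons)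
    moreover have "act (pol i) (\<lambda>z. xm i z u') = (\<lambda>z. 0)"
      using u(2) by (intro less.IH[of M]) (auto simp: 3)
    ultimately show ?thesis
      unfolding u(1) using a_nz by (intro triple[OF i refl]) auto
  qed
qed

lemma support_far:
  assumes "i \<le> n" "cartan_matrix n i j = 0" "bounded_support i J"
  shows "bounded_support i (j # J)"
proof -
  obtain p where p: "ann (\<Gamma> i) p" "\<And>u. word J u \<Longrightarrow> act p (\<lambda>r. xm i r u) = (\<lambda>r. 0)"
    using assms(3) unfolding bounded_support_def by blast
  have "act p (\<lambda>r. xm i r u) = (\<lambda>r. 0)" if "word (j # J) u" for u
  proof -
    obtain r u' where u: "u = xm j r u'" "word J u'" "j \<le> n" using \<open>word (j # J) u\<close> by (rule word_ConsE)
    have "(\<lambda>z. xm i z u) = (\<lambda>z. xm j r (xm i z u'))"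
      unfolding u(1) using x_commute[OF assms(1) u(3) assms(2)] by blast
    then show ?thesis
      using p(2)[OF u(2)] u(3) by (simp add: act_linear[OF lin_x] act_xm_0)
  qed
  then show ?thesis using p(1) unfolding bounded_support_def by blast
qed

text \<open>Along an edge the cyclic distance grows by at most one, and so does the least exponent
  in \<open>\<Gamma>\<close>; the factor q compensates for it.\<close>

lemma \<Gamma>_step:
  assumes "i \<le> n" "j \<le> n" "cartan_matrix n i j = - 1" "g \<in> \<Gamma> j"
  shows "q * g \<in> \<Gamma> i"
proof -
  obtain m where m: "g = a * q powi m" "m \<ge> cyc_dist n l j + 1" using assms(4) unfolding \<Gamma>_def by blast
  have "q * g = a * q powi (m + 1)" unfolding m(1) by (simp add: power_int_add)
  moreover have "m + 1 \<ge> cyc_dist n l i + 1"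
    using m(2) cyc_dist_step[OF n_ge_2 assms(1,2) l_le assms(3)] by linarith
  ultimately show ?thesis unfolding \<Gamma>_def by blast
qed

text \<open>Once p has killed the contribution of x_i^-(z) acting on the shorter word, the quadratic
  relation leaves T_z = q T_w. The support of x_j^-(w) in \<open>\<Gamma> j\<close> is moved into q
  times that set.\<close>

lemma support_adjacent:
  assumes i: "i \<le> n" and j: "j \<le> n" and C: "cartan_matrix n i j = - 1"
    and "bounded_support i J" "bounded_support j J"
  shows "bounded_support i (j # J)"
proof -
  obtain p where p: "ann (\<Gamma> i) p" "\<And>u. word J u \<Longrightarrow> act p (\<lambda>r. xm i r u) = (\<lambda>r. 0)"
    using assms(4) unfolding bounded_support_def by blast
  obtain p' where p': "ann (\<Gamma> j) p'" "\<And>u. word J u \<Longrightarrow> act p' (\<lambda>r. xm j r u) = (\<lambda>r. 0)"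
    using assms(5) unfolding bounded_support_def by blast
  let ?P = "pcompose p' [:0, inverse q:]"
  have "act (?P * p) (\<lambda>z. xm i z u) = (\<lambda>z. 0)" if "word (j # J) u" for u
  proof -
    obtain w u' where u: "u = xm j w u'" "word J u'" using \<open>word (j # J) u\<close> by (rule word_ConsE)
    define H where "H z w = act p (\<lambda>z. xm i z (xm j w u')) z" for z w
    have H_step: "H (z + 1) w = q *\<^sub>C H z (w + 1)" for z w
    proof -
      have r: "xm i (z + 1) (xm j w u') = q *\<^sub>C xm i z (xm j (w + 1) u')
          + q *\<^sub>C xm j w (xm i (z + 1) u') - xm j (w + 1) (xm i z u')" for z
        using x_x[OF i j, of Neg "z + 1" "w + 1" u'] C by (simp add: algebra_simps)
      have "act p (\<lambda>z. xm i (z + 1) (xm j w u')) z = q *\<^sub>C H z (w + 1)"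
        unfolding r act_seq_add act_seq_diff act_seq_scale act_linear[OF lin_x[OF j]]
          act_shift[of p "\<lambda>z. xm i z u'"] p(2)[OF u(2)] H_def by (simp add: act_xm_0[OF j])
      then show ?thesis
        using act_shift[of p "\<lambda>z. xm i z (xm j w u')" 1] by (simp add: H_def)
    qed
    have "act p' (\<lambda>w. H z w) = (\<lambda>w. 0)" for z
    proof
      fix w
      have "act p' (\<lambda>w. H z w) w = act p (\<lambda>z. act p' (\<lambda>w. xm i z (xm j w u')) w) z"
        unfolding H_def by (rule act_swap)
      then show "act p' (\<lambda>w. H z w) w = 0"
        by (simp only: act_linear[OF lin_x[OF i]] p'(2)[OF u(2)] act_xm_0[OF i] act_zero_seq)
    qed
    then have "act ?P (\<lambda>z. H z w) = (\<lambda>z. 0)"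
      by (intro transfer_annihilator[where H = H] H_step) simp_all
    then show ?thesis by (simp only: act_mult H_def u(1))
  qed
  moreover have "ann (\<Gamma> i) (?P * p)"
    by (rule ann_mult[OF ann_pcompose[OF p'(1)] p(1)]) (use \<Gamma>_step[OF i j C] in auto)
  ultimately show ?thesis unfolding bounded_support_def by blast
qed

text \<open>The quadratic relation between the two i-currents would bring in q^-2. The Serre
  relation instead expresses x_i(z)x_i(w)x_j(r)u through terms in which x_i(z) acts directly on a
  word starting with j, on a shorter word with one i, or on u.\<close>

lemma support_serre:
  assumes i: "i \<le> n" and j: "j \<le> n" and C: "cartan_matrix n i j = - 1"
    and "bounded_support i (j # J)" "bounded_support i (j # i # J)"
      "bounded_support i (i # J)" "bounded_support i J"
  shows "bounded_support i (i # j # J)"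
proof -
  obtain p1 p2 p3 p4 where
    p1: "ann (\<Gamma> i) p1" "\<And>u. word (j # J) u \<Longrightarrow> act p1 (\<lambda>r. xm i r u) = (\<lambda>r. 0)" and
    p2: "ann (\<Gamma> i) p2" "\<And>u. word (j # i # J) u \<Longrightarrow> act p2 (\<lambda>r. xm i r u) = (\<lambda>r. 0)" and
    p3: "ann (\<Gamma> i) p3" "\<And>u. word (i # J) u \<Longrightarrow> act p3 (\<lambda>r. xm i r u) = (\<lambda>r. 0)" and
    p4: "ann (\<Gamma> i) p4" "\<And>u. word J u \<Longrightarrow> act p4 (\<lambda>r. xm i r u) = (\<lambda>r. 0)"
    using assms(4-7) unfolding bounded_support_def by metis
  define p where "p = p1 * p2 * p3 * p4"
  have p_eq: "p = p2 * p3 * p4 * p1" "p = p1 * p3 * p4 * p2" "p = p1 * p2 * p4 * p3"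
    "p = p1 * p2 * p3 * p4" by (simp_all add: p_def ac_simps)
  have p0: "act p (\<lambda>r. xm i r u) = (\<lambda>r. 0)"
    if "word (j # J) u \<or> word (j # i # J) u \<or> word (i # J) u \<or> word J u" for u
    using that p1(2)[of u] p2(2)[of u] p3(2)[of u] p4(2)[of u]
    by (elim disjE) (simp add: p_eq(1) act_mult, simp add: p_eq(2) act_mult,
        simp add: p_eq(3) act_mult, simp add: p_eq(4) act_mult)
  have "act p (\<lambda>z. xm i z u) = (\<lambda>z. 0)" if "word (i # j # J) u" for u
  proof -
    obtain w r u' where u: "u = xm i w (xm j r u')" "word J u'"
      using \<open>word (i # j # J) u\<close> by (auto elim!: word_ConsE)
    have eq: "(\<lambda>z. xm i z u) = (\<lambda>z. (q + inverse q) *\<^sub>C xm i z (xm j r (xm i w u'))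
        - xm j r (xm i z (xm i w u')) - (xm i w (xm i z (xm j r u'))
        - (q + inverse q) *\<^sub>C xm i w (xm j r (xm i z u')) + xm j r (xm i w (xm i z u'))))"
      using serre[OF i j C, of Neg _ w r u'] unfolding u(1) by (simp add: fun_eq_iff algebra_simps)
    have w: "word (j # J) (xm j r u')" "word (j # i # J) (xm j r (xm i w u'))" "word (i # J) (xm i w u')"
      using u(2) i j by (auto intro: word_Cons)
    show ?thesis
      unfolding eq act_seq_diff act_seq_add act_seq_scale act_linear[OF lin_x[OF i]]
        act_linear[OF lin_x[OF j]] using u(2) w by (simp add: p0 act_xm_0 i j)
  qed
  moreover have "ann (\<Gamma> i) p" unfolding p_def using p1 p2 p3 p4 by (auto intro: ann_mult)
  ultimately show ?thesis unfolding bounded_support_def by blast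
qed

section \<open>Reordering words by the commutation and Serre relations\<close>

definition word_reduces :: "nat list \<Rightarrow> nat list \<Rightarrow> nat list \<Rightarrow> bool" where
  "word_reduces I I1 I2 \<longleftrightarrow> (\<forall>u. word I u \<longrightarrow> u \<in> cvec.span {y. word I1 y \<or> word I2 y})"

lemma word_reduces_Cons:
  assumes "word_reduces I I1 I2" "i \<le> n"
  shows "word_reduces (i # I) (i # I1) (i # I2)"
  unfolding word_reduces_def
proof (intro allI impI)
  fix u assume "word (i # I) u"
  then obtain r u' where u: "u = xm i r u'" "word I u'" by (rule word_ConsE)
  have "u' \<in> cvec.span {y. word I1 y \<or> word I2 y}" using assms(1) u(2) by (auto simp: word_reduces_def)
  then have "xm i r u' \<in> cvec.span {y. word (i # I1) y \<or> word (i # I2) y}"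
  proof (induction rule: cvec.span_induct_alt)
    case base
    then show ?case by (simp add: act_xm_0[OF assms(2)] cvec.span_zero)
  next
    case (step c y z)
    then have "xm i r y \<in> cvec.span {y. word (i # I1) y \<or> word (i # I2) y}"
      using assms(2) by (intro cvec.span_base) (auto intro: word_Cons)
    then show ?case using step
      by (simp add: clinear_simps[OF lin_x[OF assms(2)]] cvec.span_add cvec.span_scale)
  qed
  then show "u \<in> cvec.span {y. word (i # I1) y \<or> word (i # I2) y}" by (simp add: u)
qed

lemma word_reduces_replicate:
  "word_reduces I I1 I2 \<Longrightarrow> i \<le> n \<Longrightarrow>
    word_reduces (replicate m i @ I) (replicate m i @ I1) (replicate m i @ I2)"
  by (induction m) (auto intro: word_reduces_Cons)

lemma support_reduces:
  assumes "word_reduces I I1 I2" "bounded_support i I1" "bounded_support i I2" "i \<le> n"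
  shows "bounded_support i I"
proof -
  obtain p1 p2 where
    p1: "ann (\<Gamma> i) p1" "\<And>u. word I1 u \<Longrightarrow> act p1 (\<lambda>r. xm i r u) = (\<lambda>r. 0)" and
    p2: "ann (\<Gamma> i) p2" "\<And>u. word I2 u \<Longrightarrow> act p2 (\<lambda>r. xm i r u) = (\<lambda>r. 0)"
    using assms unfolding bounded_support_def by metis
  have "act (p1 * p2) (\<lambda>r. xm i r u) = (\<lambda>r. 0)" if "u \<in> cvec.span {y. word I1 y \<or> word I2 y}" for u
    using that
  proof (induction rule: cvec.span_induct_alt)
    case base
    then show ?case by (simp add: act_xm_0[OF assms(4)])
  next
    case (step c y z)
    have "act (p1 * p2) (\<lambda>r. xm i r y) = (\<lambda>r. 0)"
    proof (cases "word I2 y")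
      case True
      then show ?thesis by (simp add: act_mult p2)
    next
      case False
      then have "word I1 y" using step by auto
      then show ?thesis by (simp only: mult.commute[of p1 p2] act_mult p1 act_zero_seq)
    qed
    then show ?case using step
      by (simp add: clinear_simps[OF lin_x[OF assms(4)]] act_seq_add act_seq_scale)
  qed
  then show ?thesis
    unfolding bounded_support_def using assms(1) ann_mult[OF p1(1) p2(1)] by (auto simp: word_reduces_def)
qed

lemma word_reduces_far:
  assumes "i \<le> n" "cartan_matrix n i j = 0"
  shows "word_reduces (i # j # J) (j # i # J) (j # i # J)"
  unfolding word_reduces_def
proof (intro allI impI)
  fix u assume "word (i # j # J) u"
  then obtain w r u' where u: "u = xm i w (xm j r u')" "word J u'" "j \<le> n"
    by (auto elim!: word_ConsE)
  have "u = xm j r (xm i w u')" unfolding u(1) by (rule x_commute[OF assms(1) u(3) assms(2)])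
  then show "u \<in> cvec.span {y. word (j # i # J) y \<or> word (j # i # J) y}"
    using u assms by (intro cvec.span_base) (auto intro: word_Cons)
qed

text \<open>Modulo the two other types of words, the Serre relation makes x_i(w)x_i(w')x_j
  antisymmetric in w and w'. With this the quadratic relation shows that it depends on w + w' only,
  hence is symmetric as well, so it is zero. The division by 1 + q^-2 is possible because q^4 is not
  1.\<close>

lemma word_reduces_serre:
  assumes i: "i \<le> n" and C: "cartan_matrix n i j = - 1"
  shows "word_reduces (i # i # j # J) (i # j # i # J) (j # i # i # J)"
  unfolding word_reduces_def
proof (intro allI impI)
  fix y assume "word (i # i # j # J) y"
  then obtain w w' r u where y: "y = xm i w (xm i w' (xm j r u))" "word J u" and j: "j \<le> n"
    by (auto elim!: word_ConsE)
  define Sp where "Sp = cvec.span {y. word (i # j # i # J) y \<or> word (j # i # i # J) y}"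
  have Sp: "csubspace Sp" by (simp add: Sp_def)
  define F where "F w w' = xm i w (xm i w' (xm j r u))" for w w'
  define c where "c = inverse (q * q)"
  have anti: "F w w' + F w' w \<in> Sp" for w w'
  proof -
    have "xm i w (xm j r (xm i w' u)) \<in> Sp" "xm j r (xm i w (xm i w' u)) \<in> Sp" for w w'
      unfolding Sp_def using y(2) i j by (auto intro!: cvec.span_base intro: word_Cons)
    moreover have "F w w' + F w' w
        = (q + inverse q) *\<^sub>C xm i w (xm j r (xm i w' u)) - xm j r (xm i w (xm i w' u))
        + ((q + inverse q) *\<^sub>C xm i w' (xm j r (xm i w u)) - xm j r (xm i w' (xm i w u)))"
      using serre[OF i j C, of Neg w w' r u] unfolding F_def by (simp add: algebra_simps)
    ultimately show ?thesis
      by (simp only:) (intro cvec.subspace_add cvec.subspace_diff cvec.subspace_scale Sp)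
  qed
  have c: "c \<noteq> 0" "1 + c \<noteq> 0"
  proof -
    have "q powi 4 \<noteq> 1" by (rule q_powi_neq_1) simp
    show "c \<noteq> 0" by (simp add: c_def)
    have "q * q * (q * q) \<noteq> 1" using q_not_root[of 4] by (simp add: numeral_eq_Suc mult.assoc)
    moreover have "q * q * (q * q) = 1" if "1 + c = 0"
    proof -
      have "q * q + 1 = (1 + c) * (q * q)" by (simp add: c_def field_simps)
      then have "q * q = - 1" using that by (simp add: add_eq_0_iff2)
      then show ?thesis by simp
    qed
    ultimately show "1 + c \<noteq> 0" by blast
  qed
  have step: "F (w + 1) w' - F w (w' + 1) \<in> Sp" for w w'
  proof -
    have rel: "F (w + 1) w' = c *\<^sub>C F w (w' + 1) + c *\<^sub>C F w' (w + 1) - F (w' + 1) w"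
      using x_x[OF i i, of Neg "w + 1" "w' + 1" "xm j r u"]
      unfolding cartan_Neg_diag c_def[symmetric] F_def by (simp add: algebra_simps)
    have "(1 + c) *\<^sub>C (F (w + 1) w' - F w (w' + 1))
        = c *\<^sub>C (F w' (w + 1) + F (w + 1) w') - (F (w' + 1) w + F w (w' + 1))"
      using rel by (simp add: scaleC_add_left scaleC_add_right cvec.scale_right_diff_distrib scaleC_one algebra_simps)
    also have "\<dots> \<in> Sp" using anti by (intro cvec.subspace_diff cvec.subspace_scale Sp) auto
    finally have "inverse (1 + c) *\<^sub>C (1 + c) *\<^sub>C (F (w + 1) w' - F w (w' + 1)) \<in> Sp"
      by (rule cvec.subspace_scale[OF Sp])
    moreover have "inverse (1 + c) *\<^sub>C (1 + c) *\<^sub>C (F (w + 1) w' - F w (w' + 1)) = F (w + 1) w' - F w (w' + 1)"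
      using c(2) unfolding scaleC_scaleC by (simp add: scaleC_one)
    ultimately show ?thesis by (simp only:)
  qed
  have step_nat: "F (w + int k) w' - F w (w' + int k) \<in> Sp" for w w' k
  proof (induction k arbitrary: w')
    case 0
    then show ?case by (simp add: cvec.subspace_0[OF Sp])
  next
    case (Suc k)
    have "(F (w + int k + 1) w' - F (w + int k) (w' + 1)) + (F (w + int k) (w' + 1) - F w (w' + 1 + int k)) \<in> Sp"
      by (intro cvec.subspace_add Sp step Suc.IH)
    then show ?case by (simp add: algebra_simps)
  qed
  have sym: "F w w' - F w' w \<in> Sp" for w w'
  proof (cases "w \<ge> w'")
    case True
    then show ?thesis using step_nat[of w' "nat (w - w')" w'] by simp
  next
    case False
    then have "- (F w' w - F w w') \<in> Sp"
      using step_nat[of w "nat (w' - w)" w] by (intro cvec.subspace_neg[OF Sp]) simp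
    then show ?thesis by simp
  qed
  have "(1 / 2) *\<^sub>C ((F w w' - F w' w) + (F w w' + F w' w)) \<in> Sp"
    by (intro cvec.subspace_scale cvec.subspace_add Sp sym anti)
  moreover have "(F w w' - F w' w) + (F w w' + F w' w) = 2 *\<^sub>C F w w'"
    using scaleC_add_left[of 1 1 "F w w'"] by (simp add: scaleC_one)
  ultimately have "F w w' \<in> Sp" by (simp add: scaleC_scaleC scaleC_one)
  then show "y \<in> cvec.span {y. word (i # j # i # J) y \<or> word (j # i # i # J) y}"
    by (simp add: y(1) F_def Sp_def)
qed

text \<open>Write the word as i^m j J with j different from i. If m is at least 2, or j is not
  adjacent to i, the letter j is moved to the left through the block, which lowers m at constant
  length. For m = 1 and adjacent j the Serre relation is applied to the current x_i(z) itself, and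
  for m = 0 the support passes over j directly. All other words involved are shorter.\<close>

lemma all_bounded_support:
  "i \<le> n \<Longrightarrow> set I \<subseteq> {..n} \<Longrightarrow> bounded_support i I"
proof (induction "length I" arbitrary: i I rule: less_induct)
  case less
  have shorter: "bounded_support i' I'" if "length I' < length I" "set I' \<subseteq> {..n}" "i' \<le> n" for i' I'
    using less.hyps that by blast
  have main: "bounded_support i (replicate m i @ j # J)"
    if "j \<noteq> i" "j \<le> n" "set J \<subseteq> {..n}" "length I = m + Suc (length J)" for m j J
    using that
  proof (induction m arbitrary: j J rule: less_induct)
    case (less m)
    have i: "i \<le> n" by fact
    have C: "cartan_matrix n i j = 0 \<or> cartan_matrix n i j = - 1"
      using less.prems by (intro cartan_matrix_off_diag) simp
    have sh: "bounded_support i' J" if "i' \<le> n" for i'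
      using less.prems that by (intro shorter) auto
    show ?case
    proof (cases m)
      case 0
      then show ?thesis
        using C support_far[OF i _ sh[OF i]] support_adjacent[OF i less.prems(2) _ sh[OF i] sh[OF less.prems(2)]]
        by auto
    next
      case (Suc m')
      note m = Suc
      show ?thesis
      proof (cases "cartan_matrix n i j = 0")
        case True
        have "bounded_support i (replicate m' i @ j # i # J)"
          using less.prems m i by (intro less.IH) auto
        moreover have "word_reduces (replicate m' i @ i # j # J) (replicate m' i @ j # i # J)
            (replicate m' i @ j # i # J)"
          by (intro word_reduces_replicate word_reduces_far True i)
        ultimately have "bounded_support i (replicate m' i @ i # j # J)"
          using support_reduces i by blast
        then show ?thesis by (simp add: m replicate_append_same[symmetric] flip: replicate_app_Cons_same)
      next
        case False
        then have C: "cartan_matrix n i j = - 1" using C by simp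
        show ?thesis
        proof (cases m')
          case 0
          have "bounded_support i (i # j # J)"
          proof (rule support_serre[OF i less.prems(2) C])
            show "bounded_support i (j # J)" "bounded_support i (i # J)" "bounded_support i J"
              using less.prems m 0 i by (auto intro!: shorter)
            show "bounded_support i (j # i # J)"
              using less.prems m 0 i by (intro support_adjacent[OF i _ C] shorter) auto
          qed
          then show ?thesis by (simp add: m 0)
        next
          case (Suc m'')
          have "bounded_support i (replicate (Suc m'') i @ j # i # J)"
            using less.prems m Suc i by (intro less.IH) auto
          then have 1: "bounded_support i (replicate m'' i @ i # j # i # J)"
            by (simp add: replicate_app_Cons_same)
          have 2: "bounded_support i (replicate m'' i @ j # i # i # J)"
            using less.prems m Suc i by (intro less.IH) auto
          have "word_reduces (replicate m'' i @ i # i # j # J) (replicate m'' i @ i # j # i # J)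
              (replicate m'' i @ j # i # i # J)"
            by (intro word_reduces_replicate word_reduces_serre C i)
          then have "bounded_support i (replicate m'' i @ i # i # j # J)"
            using 1 2 i support_reduces by blast
          then show ?thesis by (simp add: m Suc replicate_app_Cons_same)
        qed
      qed
    qed
  qed
  define m where "m = length (takeWhile (\<lambda>k. k = i) I)"
  have I: "I = replicate m i @ dropWhile (\<lambda>k. k = i) I"
    unfolding m_def by (metis (mono_tags, lifting) replicate_length_same set_takeWhileD takeWhile_dropWhile_id)
  show ?case
  proof (cases "dropWhile (\<lambda>k. k = i) I")
    case Nil
    have "I = replicate m i" using I unfolding Nil by simp
    then show ?thesis
      unfolding bounded_support_def using replicate_support[OF less.prems(1)] ann_pol by blast
  next
    case (Cons j J)
    then have "j \<noteq> i" by (metis (mono_tags) dropWhile_eq_Cons_conv)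
    moreover have "I = replicate m i @ j # J" using I Cons by simp
    ultimately show ?thesis using main[of j J m] less.prems by auto
  qed
qed

end

section \<open>Supports on arbitrary vectors of the highest weight module\<close>

context highest_weight
begin

definition v0_line :: "'a set" where "v0_line = range (\<lambda>c. c *\<^sub>C v0)"

lemma gen_v0_line: "gen v0_line = UNIV"
proof (rule generates)
  show "toroidal_submodule n \<rho> (gen v0_line)"
  proof (rule gen_submodule)
    fix \<epsilon> i m u assume i: "i \<le> n" and "u \<in> v0_line"
    then obtain c where u: "u = c *\<^sub>C v0" by (auto simp: v0_line_def)
    obtain d where "\<phi> \<epsilon> i m v0 = d *\<^sub>C v0" using phi_v0_eigen[OF i] by blast
    then show "\<phi> \<epsilon> i m u \<in> v0_line"
      unfolding u v0_line_def by (auto simp: clinear_scale[OF lin_phi[OF i]] scaleC_scaleC)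
  next
    fix h u assume h: "h \<in> cartan_space n" and "u \<in> v0_line"
    then obtain c where u: "u = c *\<^sub>C v0" by (auto simp: v0_line_def)
    show "k h u \<in> v0_line"
      unfolding u v0_line_def by (simp add: clinear_scale[OF lin_k[OF h]] k_v0[OF h] scaleC_scaleC image_iff)
  next
    show "x Pos i r u = 0" if "i \<le> n" "u \<in> v0_line" for i r u
      using that by (auto simp: v0_line_def clinear_scale[OF lin_x] x_v0)
  qed
  have "v0 = 1 *\<^sub>C v0" by (simp add: scaleC_one)
  then show "v0 \<in> gen v0_line" unfolding v0_line_def by (blast intro: gen_base)
qed

definition words :: "'a set" where "words = {y. \<exists>I. set I \<subseteq> {..n} \<and> word I y}"

lemma span_words: "u \<in> cvec.span words"
proof -
  have "u \<in> gen v0_line" by (simp add: gen_v0_line)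
  then show ?thesis
  proof induction
    case (gen_base u)
    then obtain c where u: "u = c *\<^sub>C v0" by (auto simp: v0_line_def)
    have "v0 \<in> words" by (auto simp: words_def intro!: exI[of _ "[]"] word_Nil)
    then show ?case unfolding u by (intro cvec.span_scale cvec.span_base)
  next
    case (gen_x u i r)
    from gen_x.IH show ?case
    proof (induction rule: cvec.span_induct_alt)
      case base
      then show ?case by (simp add: act_xm_0[OF gen_x.hyps(2)] cvec.span_zero)
    next
      case (step c y z)
      then obtain I where "set I \<subseteq> {..n}" "word I y" by (auto simp: words_def)
      then have "xm i r y \<in> words"
        using gen_x.hyps(2) by (auto simp: words_def intro!: exI[of _ "i # I"] word_Cons)
      then show ?case using step
        by (simp add: clinear_simps[OF lin_x[OF gen_x.hyps(2)]] cvec.span_add cvec.span_scale cvec.span_base)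
    qed
  qed (auto intro: cvec.span_zero cvec.span_add cvec.span_scale)
qed

lemma supported_x_neg:
  assumes i: "i \<le> n"
  shows "supported (\<Gamma> i) (\<lambda>r. x Neg i r u)"
  using span_words[of u]
proof (induction rule: cvec.span_induct_alt)
  case base
  then show ?case by (simp add: act_xm_0[OF i])
next
  case (step c y z)
  then obtain I where I: "set I \<subseteq> {..n}" "word I y" by (auto simp: words_def)
  then have "supported (\<Gamma> i) (\<lambda>r. xm i r y)"
    using all_bounded_support[OF i I(1)] unfolding bounded_support_def supported_def by blast
  then show ?case using step
    by (simp add: clinear_simps[OF lin_x[OF i]] supported_add supported_scale)
qed

text \<open>Up to a scalar the difference is the commutator of x_(i,0)^+ with the current x_i^-(z),
  so it inherits the support of the latter.\<close>

lemma supported_phi: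
  assumes i: "i \<le> n"
  shows "supported (\<Gamma> i) (\<lambda>m. \<phi> Pos i m u - \<phi> Neg i m u)"
proof -
  have "\<phi> Pos i m u - \<phi> Neg i m u
      = (q - inverse q) *\<^sub>C (x Pos i 0 (x Neg i m u) - x Neg i m (x Pos i 0 u))" for m
    unfolding x_pos_neg[OF i i] using q_diff_nz by (simp add: scaleC_scaleC scaleC_one)
  moreover have "supported (\<Gamma> i) (\<lambda>m. (q - inverse q) *\<^sub>C (x Pos i 0 (x Neg i m u) - x Neg i m (x Pos i 0 u)))"
    by (intro supported_scale supported_diff supported_linear[OF supported_x_neg[OF i] lin_x[OF i]]
        supported_x_neg[OF i])
  ultimately show ?thesis by simp
qed

text \<open>Starting from x^+(z)v0 = 0, each further lowering operator adds at most a shifted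
  multiple of \<phi>_i^+ - \<phi>_i^-, whose support is already known.\<close>

lemma supported_x_pos: "i \<le> n \<Longrightarrow> supported (\<Gamma> i) (\<lambda>r. x Pos i r u)"
proof -
  assume i: "i \<le> n"
  have "u \<in> gen v0_line" by (simp add: gen_v0_line)
  then show ?thesis
  proof induction
    case (gen_base u)
    then show ?case using i by (auto simp: v0_line_def clinear_scale[OF lin_x] x_v0)
  next
    case (gen_x u j r)
    have eq: "x Pos i m (x Neg j r u) = x Neg j r (x Pos i m u) + (if i = j then
        (1 / (q - inverse q)) *\<^sub>C (\<phi> Pos i (m + r) u - \<phi> Neg i (m + r) u) else 0)" for m
      using x_pos_neg[OF i gen_x.hyps(2), of m r u] by (simp add: algebra_simps)
    have "supported (\<Gamma> i) (\<lambda>m. x Neg j r (x Pos i m u))"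
      by (rule supported_linear[OF gen_x.IH lin_x[OF gen_x.hyps(2)]])
    moreover have "supported (\<Gamma> i) (\<lambda>m. if i = j then
        (1 / (q - inverse q)) *\<^sub>C (\<phi> Pos i (m + r) u - \<phi> Neg i (m + r) u) else 0)"
      using supported_scale[OF supported_shift[OF supported_phi[OF i, of u], of r]] by (cases "i = j") simp_all
    ultimately show ?case unfolding eq by (rule supported_add)
  qed (use i in \<open>simp_all add: clinear_simps[OF lin_x] supported_add supported_scale\<close>)
qed

end

section \<open>The involution exchanging highest and lowest weight modules\<close>

fun opp :: "pm \<Rightarrow> pm" where
  "opp Pos = Neg"
| "opp Neg = Pos"

lemma opp_opp [simp]: "opp (opp \<epsilon>) = \<epsilon>" by (cases \<epsilon>) simp_all
lemma pmi_opp [simp]: "pmi (opp \<epsilon>) = - pmi \<epsilon>" by (cases \<epsilon>) simp_all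

text \<open>The automorphism with x^+(z) and x^-(z^-1) exchanged and k_h sent to k_(-h). The sign on
  h_(i,-m) is what sends \<phi>^+(z) to \<phi>^-(z^-1), with q unchanged.\<close>

definition flip :: "'v::complex_vector toroidal_ops \<Rightarrow> 'v toroidal_ops" where
  "flip \<rho> = \<lparr> xop = (\<lambda>\<epsilon> i r. xop \<rho> (opp \<epsilon>) i (- r)), kop = (\<lambda>h. kop \<rho> (- h)),
              hop = (\<lambda>i m u. - hop \<rho> i (- m) u) \<rparr>"

lemma flip_simps [simp]:
  "xop (flip \<rho>) \<epsilon> i r = xop \<rho> (opp \<epsilon>) i (- r)"
  "kop (flip \<rho>) h = kop \<rho> (- h)"
  "hop (flip \<rho>) i m = (\<lambda>u. - hop \<rho> i (- m) u)"
  by (simp_all add: flip_def)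

lemma phi_flip [simp]: "phi t (flip \<rho>) \<epsilon> i m = phi t \<rho> (opp \<epsilon>) i (- m)"
proof -
  have "(\<lambda>p u. if p = 0 then 0 else (of_int (pmi \<epsilon>) * (qq t - inverse (qq t)))
        *\<^sub>C hop (flip \<rho>) i (pmi \<epsilon> * int p) u)
      = (\<lambda>p u. if p = 0 then 0 else (of_int (pmi (opp \<epsilon>)) * (qq t - inverse (qq t)))
        *\<^sub>C hop \<rho> i (pmi (opp \<epsilon>) * int p) u)"
    by (intro ext) (simp add: algebra_simps)
  then show ?thesis
    unfolding phi_def by (cases \<epsilon>) (simp_all add: fun_eq_iff)
qed

lemma simple_root_uminus: "simple_root n i (- h) = - simple_root n i h"
  by (simp add: simple_root_def sum_negf)

lemma toroidal_module_flip:
  assumes "toroidal_module n t \<rho>" "\<And>m::nat. 0 < m \<Longrightarrow> exp t ^ m \<noteq> 1"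
  shows "toroidal_module n t (flip \<rho>)"
proof -
  interpret toroidal n t \<rho> using assms by unfold_locales
  have lin_h': "clinear (\<lambda>u. - hop \<rho> i (- m) u)" if "i \<le> n" "m \<noteq> 0" for i m
  proof -
    have h: "clinear (hop \<rho> i (- m))" using that by (intro lin_h) auto
    show ?thesis by (rule clinearI) (simp_all add: clinear_simps[OF h])
  qed
  have k': "k (- h) (x \<epsilon> j r (k h u)) = qpow t (- (of_int (pmi \<epsilon>) * simple_root n j h)) *\<^sub>C x \<epsilon> j r u"
    if "h \<in> cartan_space n" "j \<le> n" for h \<epsilon> j r u
    using k_x_k[OF uminus_space[OF that(1)] that(2), of \<epsilon> r u] by (simp add: simple_root_uminus)
  have inv: "q powi - z = inverse (q powi z)" for z by (rule power_int_minus)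
  \<comment> \<open>Negating the mode indices exchanges the two shifted terms on each side while the
    exponent of q changes its sign; multiplication by q^z restores the original form of the
    relation.\<close>
  have quad: "B - q powi z *\<^sub>C A = q powi z *\<^sub>C D - C"
    if "A - q powi (- z) *\<^sub>C B = q powi (- z) *\<^sub>C C - D" for z and A B C D :: 'a
  proof -
    have "q powi z *\<^sub>C (A - q powi (- z) *\<^sub>C B) = q powi z *\<^sub>C (q powi (- z) *\<^sub>C C - D)"
      using that by simp
    then have "q powi z *\<^sub>C A - B = C - q powi z *\<^sub>C D"
      by (simp add: cvec.scale_right_diff_distrib scaleC_scaleC scaleC_one inv)
    then show ?thesis by (metis minus_diff_eq)
  qed
  show ?thesis
  proof (unfold toroidal_module_def flip_simps phi_flip, intro conjI allI ballI impI, goal_cases)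
    case (4 h h' v)
    then show ?case by (simp add: k_mult uminus_space)
  next
    case (8 h \<epsilon> j r v)
    then show ?case using k'[of h j "opp \<epsilon>" "- r" v] by simp
  next
    case (9 \<eta> \<epsilon> i j m r v)
    then show ?case
      using quad[OF phi_x[of i j "opp \<eta>" "1 - m" "opp \<epsilon>" "1 - r" v, simplified]] by simp
  next
    case (10 i j m r v)
    then show ?case
      using x_pos_neg[of j i "- r" "- m" v] by (auto simp: algebra_simps cvec.scale_right_diff_distrib)
  next
    case (11 \<epsilon> i j m r v)
    then show ?case
      using quad[OF x_x[of i j "opp \<epsilon>" "1 - m" "1 - r" v, simplified]] by simp
  next
    case (12 \<epsilon> i j m1 m2 r v)
    then show ?case
      using serre[of i j "opp \<epsilon>" "- m1" "- m2" "- r" v] by (simp add: Let_def)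
  next
    case (13 \<epsilon> i j m r v)
    then show ?case using x_commute by blast
  qed (simp_all add: lin_x lin_k lin_h' k_phi phi_phi uminus_space)
qed

lemma toroidal_submodule_flip:
  assumes "toroidal_submodule n (flip \<rho>) S"
  shows "toroidal_submodule n \<rho> S"
proof -
  have sub: "csubspace S"
    and x: "\<And>\<epsilon> i r v. i \<le> n \<Longrightarrow> v \<in> S \<Longrightarrow> xop \<rho> (opp \<epsilon>) i (- r) v \<in> S"
    and k: "\<And>h v. h \<in> cartan_space n \<Longrightarrow> v \<in> S \<Longrightarrow> kop \<rho> (- h) v \<in> S"
    and h: "\<And>i m v. i \<le> n \<Longrightarrow> m \<noteq> 0 \<Longrightarrow> v \<in> S \<Longrightarrow> - hop \<rho> i (- m) v \<in> S"
    using assms unfolding toroidal_submodule_def by auto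
  have "xop \<rho> \<epsilon> i r v \<in> S" if "i \<le> n" "v \<in> S" for \<epsilon> i r v
    using x[of i v "opp \<epsilon>" "- r"] that by simp
  moreover have "kop \<rho> h v \<in> S" if "h \<in> cartan_space n" "v \<in> S" for h v
  proof -
    have "- h \<in> cartan_space n"
      using that unfolding cartan_space_def using in_keys_iff by fastforce
    then show ?thesis using k[of "- h" v] that by simp
  qed
  moreover have "hop \<rho> i m v \<in> S" if "i \<le> n" "m \<noteq> 0" "v \<in> S" for i m v
    using cvec.subspace_neg[OF sub h[of i "- m" v]] that by simp
  ultimately show ?thesis using sub unfolding toroidal_submodule_def by blast
qed

lemma simple_toroidal_module_flip:
  assumes "simple_toroidal_module n t \<rho>" "\<And>m::nat. 0 < m \<Longrightarrow> exp t ^ m \<noteq> 1"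
  shows "simple_toroidal_module n t (flip \<rho>)"
  using assms toroidal_module_flip[OF _ assms(2)] toroidal_submodule_flip
  unfolding simple_toroidal_module_def by blast

text \<open>Reversal of the index turns T into T^-1, and the reflected polynomial, which is T^d
  p(T^-1) for d the degree of p, has the inverse roots.\<close>

lemma supported_reverse:
  assumes "supported G (\<lambda>r. S (- r))" "0 \<notin> G"
  shows "supported (inverse ` G) S"
proof -
  obtain p where p: "ann G p" "act p (\<lambda>r. S (- r)) = (\<lambda>r. 0)"
    using assms(1) unfolding supported_def by blast
  have "act (reflect_poly p) S r = act p (\<lambda>r. S (- r)) (- (r + int (degree p)))" for r
  proof -
    have "act (reflect_poly p) S r = (\<Sum>k\<le>degree p. coeff (reflect_poly p) k *\<^sub>C S (r + int k))"
      by (rule act_bound) (rule degree_reflect_poly_le)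
    also have "\<dots> = (\<Sum>k\<le>degree p. coeff (reflect_poly p) (degree p - k) *\<^sub>C S (r + int (degree p - k)))"
      by (rule sum.nat_diff_reindex[symmetric, of _ "Suc (degree p)", simplified lessThan_Suc_atMost, simplified])
    also have "\<dots> = act p (\<lambda>r. S (- r)) (- (r + int (degree p)))"
      unfolding act_def by (intro sum.cong) (auto simp: coeff_reflect_poly of_nat_diff algebra_simps)
    finally show ?thesis .
  qed
  moreover have "ann (inverse ` G) (reflect_poly p)"
  proof -
    have "p \<noteq> 0" using p(1) by (simp add: ann_def)
    have "z \<in> inverse ` G" if "poly (reflect_poly p) z = 0" for z
    proof -
      have "z \<noteq> 0" using that \<open>p \<noteq> 0\<close> by (auto simp: poly_0_coeff_0)
      then have "poly p (inverse z) = 0" using that by (simp add: poly_reflect_poly_nz)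
      then have "inverse z \<in> G" using p(1) by (simp add: ann_def)
      then show ?thesis by (metis image_eqI inverse_inverse_eq)
    qed
    then show ?thesis using \<open>p \<noteq> 0\<close> by (simp add: ann_def)
  qed
  ultimately show ?thesis using p(2) unfolding supported_def by (auto simp: fun_eq_iff)
qed

section \<open>The l-weight of the highest weight vector\<close>

text \<open>Translates powers of T - \<gamma> into multiplication of Laurent series. The reading
  \<open>c\<close> is the coefficient of index m with M = X^-1 - \<gamma> for expansions at 0, and
  that of index -m with M = X - \<gamma> for expansions at infinity.\<close>

lemma act_power_fls:
  fixes v :: "'v::complex_vector" and M F :: "complex fls"
  assumes "\<And>F m. c F (m + 1) - \<gamma> * c F m = c (M * F) m"
  shows "act ([:- \<gamma>, 1:] ^ e) (\<lambda>m. c F m *\<^sub>C v) = (\<lambda>m. c (M ^ e * F) m *\<^sub>C v)"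
proof (induction e arbitrary: F)
  case (Suc e)
  have "act [:- \<gamma>, 1:] (\<lambda>m. c F m *\<^sub>C v) = (\<lambda>m. c (M * F) m *\<^sub>C v)"
    by (simp add: fun_eq_iff act_linear_factor assms[symmetric] cvec.scale_left_diff_distrib scaleC_scaleC)
  then show ?case
    unfolding power_Suc mult.commute[of "[:- \<gamma>, 1:]"] act_mult
    by (simp only: Suc.IH) (simp add: ac_simps)
qed simp

lemma fls_X_times_nth: "fls_nth (fls_X * F) m = fls_nth F (m - 1)" for F :: "complex fls"
  by (simp add: fls_X_times_conv_shift)

lemma fls_X_inv_times_nth: "fls_nth (fls_X_inv * F) m = fls_nth F (m + 1)" for F :: "complex fls"
  by (simp add: fls_X_inv_times_conv_shift)

lemma coeff_linear_power:
  fixes u w :: complex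
  shows "fls_nth ((fls_const u + fls_const w * fls_X) ^ e) m
      = (if 0 \<le> m then coeff ([:u, w:] ^ e) (nat m) else 0)"
    and "fls_nth ((fls_const u + fls_const w * fls_X_inv) ^ e) m
      = (if m \<le> 0 then coeff ([:u, w:] ^ e) (nat (- m)) else 0)"
proof (induction e arbitrary: m)
  case 0
  { case 1 show ?case by (auto simp: coeff_1 nat_eq_iff) }
  { case 2 show ?case by (auto simp: coeff_1 nat_eq_iff) }
next
  case (Suc e)
  have p: "coeff ([:u, w:] ^ Suc e) k = u * coeff ([:u, w:] ^ e) k
      + (if k = 0 then 0 else w * coeff ([:u, w:] ^ e) (k - 1))" for k
    by (cases k) simp_all
  have n: "nat m - Suc 0 = nat (m - 1)" "nat (- m) - Suc 0 = nat (- m - 1)" for m :: int by linarith+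
  { case 1 show ?case
      unfolding p by (auto simp: Suc distrib_right mult.assoc fls_X_times_nth n not_le) }
  { case 2 show ?case
      unfolding p by (auto simp: Suc distrib_right mult.assoc fls_X_inv_times_nth n not_le) }
qed

text \<open>\<open>\<psi>(aqz)\<close> expanded at \<open>0\<close> and at \<open>\<infinity>\<close>, \<open>Z\<close> being the variable \<open>z\<close>.\<close>

definition psi_series :: "complex \<Rightarrow> complex \<Rightarrow> complex fls \<Rightarrow> complex fls" where
  "psi_series q a Z = (fls_const q - fls_const a * Z) / (1 - fls_const (a * q) * Z)"

lemma fls_X_cancel: "fls_X * fls_X_inv = (1 :: complex fls)" "fls_X_inv * fls_X = (1 :: complex fls)"
  by (simp_all add: fls_X_times_conv_shift fls_X_inv_times_conv_shift)

lemma fls_const_neg: "fls_const (- c) = - fls_const (c :: complex)"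
  by (intro fls_eqI) simp

lemma nonzero_by_nth: "fls_nth F m \<noteq> 0 \<Longrightarrow> F \<noteq> (0 :: complex fls)" by auto

lemma psi_series_Pos:
  fixes q a :: complex
  assumes "q \<noteq> 0"
  shows "(fls_X_inv - fls_const (a * q)) * psi_series q a fls_X = fls_const (- a) + fls_const q * fls_X_inv"
    and "fls_subdegree (psi_series q a fls_X) = 0" and "psi_series q a fls_X \<noteq> 0"
proof -
  let ?N = "fls_const q - fls_const a * fls_X" and ?D = "1 - fls_const (a * q) * fls_X"
  have nz: "?N \<noteq> 0" "?D \<noteq> 0"
    using assms by (intro nonzero_by_nth[of _ 0], simp)+
  have "fls_X_inv - fls_const (a * q) = fls_X_inv * ?D"
    by (simp add: algebra_simps fls_X_cancel flip: mult.assoc)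
  then have "(fls_X_inv - fls_const (a * q)) * psi_series q a fls_X = fls_X_inv * ?N"
    using nz by (simp add: psi_series_def)
  also have "\<dots> = fls_const (- a) + fls_const q * fls_X_inv"
    by (simp add: algebra_simps fls_X_cancel fls_const_neg flip: mult.assoc)
  finally show "(fls_X_inv - fls_const (a * q)) * psi_series q a fls_X = fls_const (- a) + fls_const q * fls_X_inv" .
  have "fls_subdegree ?N = 0" "fls_subdegree ?D = 0"
    using assms by (intro fls_subdegree_eqI; simp)+
  then show "fls_subdegree (psi_series q a fls_X) = 0"
    using nz unfolding psi_series_def by (simp add: fls_divide_subdegree)
  show "psi_series q a fls_X \<noteq> 0" using nz by (simp add: psi_series_def)
qed

lemma psi_series_Neg:
  fixes q a :: complex
  assumes "q \<noteq> 0" "a \<noteq> 0"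
  shows "(fls_X - fls_const (a * q)) * psi_series q a fls_X_inv = fls_const (- a) + fls_const q * fls_X"
    and "fls_subdegree (psi_series q a fls_X_inv) = 0" and "psi_series q a fls_X_inv \<noteq> 0"
proof -
  let ?N = "fls_const q - fls_const a * fls_X_inv" and ?D = "1 - fls_const (a * q) * fls_X_inv"
  have nz: "?N \<noteq> 0" "?D \<noteq> 0"
    using assms by (intro nonzero_by_nth[of _ 0], simp)+
  have "fls_X - fls_const (a * q) = fls_X * ?D"
    by (simp add: algebra_simps fls_X_cancel flip: mult.assoc)
  then have "(fls_X - fls_const (a * q)) * psi_series q a fls_X_inv = fls_X * ?N"
    using nz by (simp add: psi_series_def)
  also have "\<dots> = fls_const (- a) + fls_const q * fls_X"
    by (simp add: algebra_simps fls_X_cancel fls_const_neg flip: mult.assoc)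
  finally show "(fls_X - fls_const (a * q)) * psi_series q a fls_X_inv = fls_const (- a) + fls_const q * fls_X" .
  have "fls_subdegree ?N = -1" "fls_subdegree ?D = -1"
    using assms by (intro fls_subdegree_eqI; simp)+
  then show "fls_subdegree (psi_series q a fls_X_inv) = 0"
    using nz unfolding psi_series_def by (simp add: fls_divide_subdegree)
  show "psi_series q a fls_X_inv \<noteq> 0" using nz by (simp add: psi_series_def)
qed

lemma phi_sign_cases:
  "phi t \<rho> Pos i m v = (if 0 \<le> m then phi t \<rho> Pos i (pmi Pos * int (nat m)) v else 0)"
  "phi t \<rho> Neg i m v = (if m \<le> 0 then phi t \<rho> Neg i (pmi Neg * int (nat (- m))) v else 0)"
  by (simp_all add: phi_def)

lemma highest_weightI:
  fixes \<rho> :: "'v::complex_vector toroidal_ops"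
  assumes n: "2 \<le> n" and q: "\<And>m::nat. 0 < m \<Longrightarrow> exp t ^ m \<noteq> 1" and l: "l \<le> n" and a: "a \<noteq> 0"
    and simple: "simple_toroidal_module n t \<rho>"
    and "\<And>S. toroidal_submodule n \<rho> S \<Longrightarrow> v \<in> S \<Longrightarrow> S = UNIV"
    and "\<And>i r. i \<le> n \<Longrightarrow> xop \<rho> Pos i r v = 0"
    and "\<And>h. h \<in> cartan_space n \<Longrightarrow> kop \<rho> h v = qpow t (of_nat s * fund_weight l h) *\<^sub>C v"
    and phi: "\<And>\<eta> i m. i \<le> n \<Longrightarrow> phi t \<rho> \<eta> i (pmi \<eta> * int m) v
      = fls_nth (psi_series (exp t) a (if \<eta> = Pos then fls_X else fls_X_inv) ^ (if i = l then s else 0)) (int m) *\<^sub>C v"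
  shows "highest_weight n t \<rho> l s a v"
proof -
  interpret toroidal n t \<rho>
    using simple q by unfold_locales (simp_all add: simple_toroidal_module_def)
  let ?e = "\<lambda>i. if i = l then s else 0"
  \<comment> \<open>The hypothesis covers only the indices of the sign \<eta>. For the others \<phi>
    is zero by definition, and the series must be seen to have no such coefficients either.\<close>
  have below: "fls_nth (psi_series (exp t) a Z ^ e) m = 0" if "m < 0" "Z = fls_X \<or> Z = fls_X_inv" for Z m e
  proof -
    have "fls_subdegree (psi_series (exp t) a Z ^ e) = 0"
      using that(2) psi_series_Pos[of "exp t" a] psi_series_Neg[of "exp t" a] a
      by (auto simp: fls_subdegree_pow)
    then show ?thesis using that(1) by (intro fls_eq0_below_subdegree) simp
  qed
  have at_zero: "phi t \<rho> Pos i m v = fls_nth (psi_series (exp t) a fls_X ^ ?e i) m *\<^sub>C v" if "i \<le> n" for i m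
    unfolding phi_sign_cases(1)[of t \<rho> i m] using phi[OF that, of Pos "nat m"] below[of m fls_X "?e i"] by auto
  have at_infinity: "phi t \<rho> Neg i m v = fls_nth (psi_series (exp t) a fls_X_inv ^ ?e i) (- m) *\<^sub>C v" if "i \<le> n" for i m
    unfolding phi_sign_cases(2)[of t \<rho> i m] using phi[OF that, of Neg "nat (- m)"] below[of "- m" fls_X_inv "?e i"] by auto
  show ?thesis
  proof unfold_locales
    show "act ([:- (a * exp t), 1:] ^ ?e i) (\<lambda>m. phi t \<rho> \<eta> i m v) r
      = (if r \<le> 0 then coeff ([:- a, exp t:] ^ ?e i) (nat (- r)) else 0) *\<^sub>C v" if i: "i \<le> n" for \<eta> i r
    proof (cases \<eta>)
      case Pos
      have "act ([:- (a * exp t), 1:] ^ ?e i) (\<lambda>m. fls_nth (psi_series (exp t) a fls_X ^ ?e i) m *\<^sub>C v)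
        = (\<lambda>m. fls_nth ((fls_X_inv - fls_const (a * exp t)) ^ ?e i * psi_series (exp t) a fls_X ^ ?e i) m *\<^sub>C v)"
        by (rule act_power_fls) (simp add: left_diff_distrib fls_X_inv_times_nth)
      also have "\<dots> = (\<lambda>m. fls_nth ((fls_const (- a) + fls_const (exp t) * fls_X_inv) ^ ?e i) m *\<^sub>C v)"
        by (simp only: power_mult_distrib[symmetric] psi_series_Pos(1)[OF exp_not_eq_zero])
      finally show ?thesis by (simp only: \<open>\<eta> = Pos\<close> at_zero[OF i] coeff_linear_power)
    next
      case Neg
      have "act ([:- (a * exp t), 1:] ^ ?e i) (\<lambda>m. fls_nth (psi_series (exp t) a fls_X_inv ^ ?e i) (- m) *\<^sub>C v)
        = (\<lambda>m. fls_nth ((fls_X - fls_const (a * exp t)) ^ ?e i * psi_series (exp t) a fls_X_inv ^ ?e i) (- m) *\<^sub>C v)"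
        by (rule act_power_fls) (simp add: left_diff_distrib fls_X_times_nth)
      also have "\<dots> = (\<lambda>m. fls_nth ((fls_const (- a) + fls_const (exp t) * fls_X) ^ ?e i) (- m) *\<^sub>C v)"
        by (simp only: power_mult_distrib[symmetric] psi_series_Neg(1)[OF exp_not_eq_zero a])
      finally show ?thesis by (simp only: \<open>\<eta> = Neg\<close> at_infinity[OF i] coeff_linear_power) simp
    qed
    show "\<exists>c. phi t \<rho> \<eta> i m v = c *\<^sub>C v" if "i \<le> n" for \<eta> i m
      using at_zero[OF that] at_infinity[OF that] by (cases \<eta>) blast+
  qed (use assms in auto)
qed

lemma is_V_highest_locale:
  assumes "2 \<le> n" "\<And>m::nat. 0 < m \<Longrightarrow> exp t ^ m \<noteq> 1" "l \<le> n" "a \<noteq> 0" "is_V_highest n t l s a \<rho>"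
  shows "\<exists>v. highest_weight n t \<rho> l s a v"
proof -
  obtain v where simple: "simple_toroidal_module n t \<rho>"
    and gen: "\<forall>S. toroidal_submodule n \<rho> S \<and> v \<in> S \<longrightarrow> S = UNIV"
    and x: "\<forall>i\<le>n. \<forall>r. xop \<rho> Pos i r v = 0"
    and k: "\<forall>h\<in>cartan_space n. kop \<rho> h v = qpow t (of_nat s * fund_weight l h) *\<^sub>C v"
    and phi: "\<forall>\<eta>. \<forall>i\<le>n. \<forall>m::nat. phi t \<rho> \<eta> i (pmi \<eta> * int m) v = fls_nth (expansion \<eta>
        (\<lambda>z. psi (exp t) (fls_const (a * exp t) * z) powi (if i = l then int s else 0))) (int m) *\<^sub>C v"
    using assms(5) unfolding is_V_highest_def simple_l_extremal_module_def
    by (elim conjE exE) (rule that; assumption)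
  have psi: "psi (exp t) (fls_const (a * exp t) * Z) = psi_series (exp t) a Z" for Z
  proof -
    have "fls_const (inverse (exp t)) * (fls_const (a * exp t) * Z) = fls_const a * Z"
      unfolding mult.assoc[symmetric] fls_const_mult_const by (simp add: field_simps)
    then show ?thesis by (simp add: psi_def psi_series_def)
  qed
  have "expansion \<eta> (\<lambda>z. psi (exp t) (fls_const (a * exp t) * z) powi (if i = l then int s else 0))
      = psi_series (exp t) a (if \<eta> = Pos then fls_X else fls_X_inv) ^ (if i = l then s else 0)" for \<eta> i
    by (simp add: expansion_def psi)
  then have "highest_weight n t \<rho> l s a v"
    using assms gen x k phi simple by (intro highest_weightI) simp_all
  then show ?thesis by blast
qed

text \<open>Expanding the fraction by -b^-1 z^-1 gives 1/\<psi>(bqz) = \<psi>(b^-1 q z^-1). After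
  the substitution of z^-1 for z the l-lowest weight with exponent -s is the l-highest weight with
  exponent s and parameter b^-1.\<close>

lemma is_V_lowest_locale:
  assumes "2 \<le> n" "\<And>m::nat. 0 < m \<Longrightarrow> exp t ^ m \<noteq> 1" "b \<noteq> 0" "is_V_lowest n t s b \<rho>"
  shows "\<exists>v. highest_weight n t (flip \<rho>) 0 s (inverse b) v"
proof -
  obtain v where simple: "simple_toroidal_module n t \<rho>"
    and gen: "\<forall>S. toroidal_submodule n \<rho> S \<and> v \<in> S \<longrightarrow> S = UNIV"
    and x: "\<forall>i\<le>n. \<forall>r. xop \<rho> Neg i r v = 0"
    and k: "\<forall>h\<in>cartan_space n. kop \<rho> h v = qpow t (- of_nat s * fund_weight 0 h) *\<^sub>C v"
    and phi: "\<forall>\<eta>. \<forall>i\<le>n. \<forall>m::nat. phi t \<rho> \<eta> i (pmi \<eta> * int m) v = fls_nth (expansion \<eta>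
        (\<lambda>z. psi (exp t) (fls_const (b * exp t) * z) powi (if i = 0 then - int s else 0))) (int m) *\<^sub>C v"
    using assms(4) unfolding is_V_lowest_def simple_l_extremal_module_def
    by (elim conjE exE) (rule that; assumption)
  let ?q = "exp t"
  have inv: "inverse (psi ?q (fls_const (b * ?q) * Z)) = psi_series ?q (inverse b) Z'"
    if "Z * Z' = 1" for Z Z' :: "complex fls"
  proof -
    have nz: "Z \<noteq> 0" "Z' \<noteq> 0" using that by auto
    have c: "fls_const (- inverse b) * fls_const b = -1" "fls_const (- inverse b) * fls_const (b * ?q) = - fls_const ?q"
      "fls_const (- inverse b) * fls_const ?q = - fls_const (inverse b * ?q)"
    proof -
      have e: "- inverse b * b = -1" "- inverse b * (b * ?q) = - ?q" "- inverse b * ?q = - (inverse b * ?q)"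
        using \<open>b \<noteq> 0\<close> by simp_all
      show "fls_const (- inverse b) * fls_const b = -1"
        "fls_const (- inverse b) * fls_const (b * ?q) = - fls_const ?q"
        "fls_const (- inverse b) * fls_const ?q = - fls_const (inverse b * ?q)"
        unfolding fls_const_mult_const e by (simp_all only: fls_const_neg fls_const_1)
    qed
    have "fls_const (inverse ?q) * (fls_const (b * ?q) * Z) = fls_const b * Z"
      unfolding mult.assoc[symmetric] fls_const_mult_const by (simp add: field_simps)
    then have "inverse (psi ?q (fls_const (b * ?q) * Z))
        = (1 - fls_const (b * ?q) * Z) / (fls_const ?q - fls_const b * Z)"
      by (simp add: psi_def)
    also have "\<dots> = (fls_const (- inverse b) * Z' * (1 - fls_const (b * ?q) * Z))
        / (fls_const (- inverse b) * Z' * (fls_const ?q - fls_const b * Z))"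
      using nz \<open>b \<noteq> 0\<close> by (subst mult_divide_mult_cancel_left) (auto simp: fls_const_nonzero)
    also have "fls_const (- inverse b) * Z' * (1 - fls_const (b * ?q) * Z)
        = fls_const (- inverse b) * Z' - (fls_const (- inverse b) * fls_const (b * ?q)) * (Z * Z')"
      by (simp add: algebra_simps)
    also have "\<dots> = fls_const ?q - fls_const (inverse b) * Z'"
      unfolding that c by (simp add: fls_const_neg)
    also have "fls_const (- inverse b) * Z' * (fls_const ?q - fls_const b * Z)
        = (fls_const (- inverse b) * fls_const ?q) * Z' - (fls_const (- inverse b) * fls_const b) * (Z * Z')"
      by (simp add: algebra_simps)
    also have "\<dots> = 1 - fls_const (inverse b * ?q) * Z'"
      unfolding that c by simp
    finally show ?thesis by (simp add: psi_series_def)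
  qed
  have ex: "expansion (opp \<eta>) (\<lambda>z. psi ?q (fls_const (b * ?q) * z) powi (if i = 0 then - int s else 0))
      = psi_series ?q (inverse b) (if \<eta> = Pos then fls_X else fls_X_inv) ^ (if i = 0 then s else 0)" for \<eta> i
    by (cases \<eta>) (auto simp: expansion_def power_int_minus inv[OF fls_X_cancel(1)]
        inv[OF fls_X_cancel(2)] simp flip: power_inverse)
  have "highest_weight n t (flip \<rho>) 0 s (inverse b) v"
  proof (rule highest_weightI)
    show "simple_toroidal_module n t (flip \<rho>)" by (rule simple_toroidal_module_flip[OF simple assms(2)])
    show "S = UNIV" if "toroidal_submodule n (flip \<rho>) S" "v \<in> S" for S
      using gen toroidal_submodule_flip that by blast
    show "kop (flip \<rho>) h v = qpow t (of_nat s * fund_weight 0 h) *\<^sub>C v" if "h \<in> cartan_space n" for h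
    proof -
      have "- h \<in> cartan_space n"
        using that unfolding cartan_space_def using in_keys_iff by fastforce
      then show ?thesis using k by (simp add: fund_weight_def)
    qed
    show "phi t (flip \<rho>) \<eta> i (pmi \<eta> * int m) v = fls_nth (psi_series ?q (inverse b)
        (if \<eta> = Pos then fls_X else fls_X_inv) ^ (if i = 0 then s else 0)) (int m) *\<^sub>C v" if "i \<le> n" for \<eta> i m
      using phi[rule_format, OF that, of "opp \<eta>" m] unfolding ex by simp
  qed (use assms x in auto)
  then show ?thesis by blast
qed

text \<open>All that the tensor product needs to know about a module: the currents and the poles of the
  \<open>\<phi>\<^sub>i(z)\<close> are supported in \<open>G i\<close>.\<close>

locale supported_module = toroidal +
  fixes G :: "nat \<Rightarrow> complex set"
  assumes supported_x: "\<And>\<epsilon> i u. i \<le> n \<Longrightarrow> supported (G i) (\<lambda>r. x \<epsilon> i r u)"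
    and supported_phi_diff: "\<And>i u. i \<le> n \<Longrightarrow> supported (G i) (\<lambda>m. \<phi> Pos i m u - \<phi> Neg i m u)"

lemma (in highest_weight) supported_module: "supported_module n t \<rho> \<Gamma>"
proof unfold_locales
  show "supported (\<Gamma> i) (\<lambda>r. x \<epsilon> i r u)" if "i \<le> n" for \<epsilon> i u
    using supported_x_neg[OF that] supported_x_pos[OF that] by (cases \<epsilon>) auto
qed (rule supported_phi)

lemma supported_module_flip:
  assumes "supported_module n t (flip \<rho>) G" "toroidal_module n t \<rho>" "\<And>i. 0 \<notin> G i"
  shows "supported_module n t \<rho> (\<lambda>i. inverse ` G i)"
proof -
  interpret F: supported_module n t "flip \<rho>" G by fact
  show ?thesis
  proof unfold_locales
    show "supported (inverse ` G i) (\<lambda>r. xop \<rho> \<epsilon> i r u)" if "i \<le> n" for \<epsilon> i u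
      using F.supported_x[OF that, of "opp \<epsilon>" u] assms(3) by (intro supported_reverse) simp_all
    show "supported (inverse ` G i) (\<lambda>m. phi t \<rho> Pos i m u - phi t \<rho> Neg i m u)" if "i \<le> n" for i u
      using supported_scale[OF F.supported_phi_diff[OF that, of u], of "-1"] assms(3)
      by (intro supported_reverse) (simp_all add: scaleC_one)
  qed (use assms F.q_not_root in auto)
qed

section \<open>Linear endomorphisms\<close>

text \<open>A type is needed so that Laurent series over the noncommutative ring of operators are
  available. Over the zero space 1 = 0 holds, which is why the instance combines \<open>ring\<close>
  with \<open>monoid_mult\<close>.\<close>

typedef (overloaded) 'v endo = "{f :: 'v::complex_vector \<Rightarrow> 'v. clinear f}"
  morphisms app Endo
  by (rule exI[of _ "\<lambda>_. 0"]) (simp add: clinearI)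

setup_lifting type_definition_endo

lemma app_linear: "clinear (app f)"
  using app[of f] by simp

lemmas app_simps = clinear_simps[OF app_linear]

lemma app_Endo: "clinear f \<Longrightarrow> app (Endo f) = f"
  by (simp add: Endo_inverse)

lemma endo_eqI: "(\<And>v. app f v = app g v) \<Longrightarrow> f = g"
  by (metis app_inject ext)

instantiation endo :: (complex_vector) "{ring, monoid_mult, complex_vector}"
begin

lift_definition zero_endo :: "'a endo" is "\<lambda>_. 0" by (simp add: clinearI)
lift_definition one_endo :: "'a endo" is "\<lambda>v. v" by (simp add: clinearI)
lift_definition plus_endo :: "'a endo \<Rightarrow> 'a endo \<Rightarrow> 'a endo" is "\<lambda>f g v. f v + g v"
  by (rule clinearI) (simp_all add: clinear_simps scaleC_add_right)
lift_definition minus_endo :: "'a endo \<Rightarrow> 'a endo \<Rightarrow> 'a endo" is "\<lambda>f g v. f v - g v"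
  by (rule clinearI) (simp_all add: clinear_simps cvec.scale_right_diff_distrib)
lift_definition uminus_endo :: "'a endo \<Rightarrow> 'a endo" is "\<lambda>f v. - f v"
  by (rule clinearI) (simp_all add: clinear_simps)
lift_definition times_endo :: "'a endo \<Rightarrow> 'a endo \<Rightarrow> 'a endo" is "\<lambda>f g v. f (g v)"
  by (rule clinearI) (simp_all add: clinear_simps)
lift_definition scaleC_endo :: "complex \<Rightarrow> 'a endo \<Rightarrow> 'a endo" is "\<lambda>c f v. c *\<^sub>C f v"
  by (rule clinearI) (simp_all add: clinear_simps scaleC_add_right scaleC_scaleC mult.commute)

instance
proof
  fix f g h :: "'a endo" and c d :: complex
  show "f * (g + h) = f * g + f * h" by transfer (simp add: clinear_simps)
  show "c *\<^sub>C (f + g) = c *\<^sub>C f + c *\<^sub>C g" by transfer (simp add: scaleC_add_right)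
  show "(c + d) *\<^sub>C f = c *\<^sub>C f + d *\<^sub>C f" by transfer (simp add: scaleC_add_left)
qed (transfer; simp add: algebra_simps scaleC_scaleC scaleC_one)+

end

lemma app_0 [simp]: "app 0 v = 0" by transfer simp
lemma app_1 [simp]: "app 1 v = v" by transfer simp
lemma app_add [simp]: "app (f + g) v = app f v + app g v" by transfer simp
lemma app_diff [simp]: "app (f - g) v = app f v - app g v" by transfer simp
lemma app_times [simp]: "app (f * g) v = app f (app g v)" by transfer simp
lemma app_scaleC [simp]: "app (c *\<^sub>C f) v = c *\<^sub>C app f v" by transfer simp
lemma app_sum: "app (sum f A) v = (\<Sum>a\<in>A. app (f a) v)"
  by (induction A rule: infinite_finite_induct) simp_all

lemma endo_scale_times [simp]: "(c *\<^sub>C f) * g = c *\<^sub>C (f * g)" "f * (c *\<^sub>C g) = c *\<^sub>C (f * (g :: 'v::complex_vector endo))"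
  by (rule endo_eqI; simp add: app_simps)+

section \<open>Maps between tensor products\<close>

definition free_lift :: "('a \<Rightarrow> 'x::complex_vector) \<Rightarrow> ('a \<Rightarrow>\<^sub>0 complex) \<Rightarrow> 'x" where
  "free_lift \<beta> p = (\<Sum>a\<in>Poly_Mapping.keys p. Poly_Mapping.lookup p a *\<^sub>C \<beta> a)"

lemma free_lift_superset:
  "finite A \<Longrightarrow> Poly_Mapping.keys p \<subseteq> A \<Longrightarrow> free_lift \<beta> p = (\<Sum>a\<in>A. Poly_Mapping.lookup p a *\<^sub>C \<beta> a)"
  unfolding free_lift_def by (rule sum.mono_neutral_left) (auto simp: in_keys_iff)

lemma free_lift_add: "free_lift \<beta> (p + p') = free_lift \<beta> p + free_lift \<beta> p'"
proof -
  let ?A = "Poly_Mapping.keys p \<union> Poly_Mapping.keys p'"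
  have "free_lift \<beta> (p + p') = (\<Sum>a\<in>?A. Poly_Mapping.lookup (p + p') a *\<^sub>C \<beta> a)"
    by (rule free_lift_superset) (auto simp: Poly_Mapping.keys_add)
  moreover have "free_lift \<beta> p = (\<Sum>a\<in>?A. Poly_Mapping.lookup p a *\<^sub>C \<beta> a)"
    "free_lift \<beta> p' = (\<Sum>a\<in>?A. Poly_Mapping.lookup p' a *\<^sub>C \<beta> a)"
    by (rule free_lift_superset; auto)+
  ultimately show ?thesis by (simp add: lookup_add scaleC_add_left sum.distrib)
qed

lemma free_lift_scale: "free_lift \<beta> (free_scale c p) = c *\<^sub>C free_lift \<beta> p"
proof -
  have "free_lift \<beta> (free_scale c p)
      = (\<Sum>a\<in>Poly_Mapping.keys p. Poly_Mapping.lookup (free_scale c p) a *\<^sub>C \<beta> a)"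
    by (rule free_lift_superset) (auto simp: in_keys_iff lookup_free_scale)
  then show ?thesis by (simp add: free_lift_def lookup_free_scale cvec.scale_sum_right scaleC_scaleC)
qed

lemma free_lift_single [simp]: "free_lift \<beta> (Poly_Mapping.single a c) = c *\<^sub>C \<beta> a"
  by (simp add: free_lift_def)

lemma free_lift_0 [simp]: "free_lift \<beta> 0 = 0"
  by (simp add: free_lift_def)

lemma free_lift_diff: "free_lift \<beta> (p - p') = free_lift \<beta> p - free_lift \<beta> p'"
  using free_lift_add[of \<beta> "p - p'" p'] by simp

definition bilinear_map :: "('v::complex_vector \<Rightarrow> 'w::complex_vector \<Rightarrow> 'x::complex_vector) \<Rightarrow> bool" where
  "bilinear_map \<beta> \<longleftrightarrow> (\<forall>w. clinear (\<lambda>v. \<beta> v w)) \<and> (\<forall>v. clinear (\<beta> v))"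

lemma free_lift_tensor_eq:
  assumes "bilinear_map \<beta>" "tensor_eq p p'"
  shows "free_lift (case_prod \<beta>) p = free_lift (case_prod \<beta>) p'"
proof -
  have lin: "clinear (\<lambda>v. \<beta> v w)" "clinear (\<beta> v)" for v w
    using assms(1) by (simp_all add: bilinear_map_def)
  have "free_lift (case_prod \<beta>) r = 0" if "r \<in> free_space.span tensor_relators" for r
    using that
  proof (induction rule: free_space.span_induct_alt)
    case (step c r s)
    have "free_lift (case_prod \<beta>) r = 0"
      using step(1) clinear_simps[OF lin(1)] clinear_simps[OF lin(2)] unfolding tensor_relators_def
      by (auto simp: free_lift_diff free_lift_scale scaleC_one)
    then show ?case using step by (simp add: free_lift_add free_lift_scale)
  qed simp
  then have "free_lift (case_prod \<beta>) (p - p') = 0"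
    using assms(2) by (simp add: tensor_eq_def)
  then show ?thesis by (simp add: free_lift_diff)
qed

lemma abs_tensor_surj: obtains p where "T = abs_tensor p"
  by (metis Quotient_abs_rep Quotient_tensor)

text \<open>Every tensor is a finite sum of pure ones; there is no case for scalar multiples because
  a scalar can be absorbed into the left factor.\<close>

lemma tensor_induct [case_names tens add]:
  assumes "\<And>v w. P (v \<otimes>\<^sub>V w)" "\<And>S T. P S \<Longrightarrow> P T \<Longrightarrow> P (S + T)"
  shows "P T"
proof -
  obtain p where p: "T = abs_tensor p" by (rule abs_tensor_surj)
  have single: "P (abs_tensor (Poly_Mapping.single k c))" for k c
  proof -
    obtain v w where k: "k = (v, w)" by (cases k)
    have "abs_tensor (Poly_Mapping.single k c) = c *\<^sub>C (v \<otimes>\<^sub>V w)"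
      unfolding tens.abs_eq scaleC_tensor.abs_eq k
      by (rule arg_cong[of _ _ abs_tensor], rule poly_mapping_eqI)
        (simp add: lookup_free_scale lookup_single when_def)
    then show ?thesis using assms(1)[of "c *\<^sub>C v" w] by (simp add: tens_scaleC_left)
  qed
  have "P (abs_tensor p)"
  proof (induction p rule: update_induct)
    case const
    show ?case using single[of undefined 0] by simp
  next
    case (update p k c)
    have "Poly_Mapping.update k c p = p + Poly_Mapping.single k c"
      using update(1) by (intro poly_mapping_eqI)
        (auto simp: lookup_update lookup_add lookup_single when_def in_keys_iff)
    then show ?case using assms(2)[OF update(3) single[of k c]] by (simp add: plus_tensor.abs_eq)
  qed
  then show ?thesis by (simp add: p)
qed

definition tensor_lift :: "('v::complex_vector \<Rightarrow> 'w::complex_vector \<Rightarrow> 'x::complex_vector) \<Rightarrow> ('v, 'w) tensor \<Rightarrow> 'x" where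
  "tensor_lift \<beta> T = free_lift (case_prod \<beta>) (rep_tensor T)"

lemma tensor_lift_abs:
  assumes "bilinear_map \<beta>"
  shows "tensor_lift \<beta> (abs_tensor p) = free_lift (case_prod \<beta>) p"
  unfolding tensor_lift_def
  by (rule free_lift_tensor_eq[OF assms])
    (meson Quotient_rep_abs Quotient_tensor tensor_eq_refl)

lemma tensor_lift_tens: "bilinear_map \<beta> \<Longrightarrow> tensor_lift \<beta> (v \<otimes>\<^sub>V w) = \<beta> v w"
  by (simp add: tens.abs_eq tensor_lift_abs scaleC_one)

lemma tensor_lift_linear:
  assumes "bilinear_map \<beta>"
  shows "clinear (tensor_lift \<beta>)"
proof (rule clinearI)
  fix S T :: "('a, 'b) tensor" and c
  obtain p p' where p: "S = abs_tensor p" "T = abs_tensor p'" by (metis abs_tensor_surj)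
  show "tensor_lift \<beta> (S + T) = tensor_lift \<beta> S + tensor_lift \<beta> T"
    unfolding p by (simp add: plus_tensor.abs_eq tensor_lift_abs[OF assms] free_lift_add)
  show "tensor_lift \<beta> (c *\<^sub>C S) = c *\<^sub>C tensor_lift \<beta> S"
    unfolding p by (simp add: scaleC_tensor.abs_eq tensor_lift_abs[OF assms] free_lift_scale)
qed

lemma clinear_tensor_ext:
  assumes "clinear f" "clinear g" "\<And>v w. f (v \<otimes>\<^sub>V w) = g (v \<otimes>\<^sub>V w)"
  shows "f T = g T"
  by (induction T rule: tensor_induct) (simp_all add: assms clinear_add[OF assms(1)] clinear_add[OF assms(2)])

lemma endo_tensor_eqI: "(\<And>v w. app f (v \<otimes>\<^sub>V w) = app g (v \<otimes>\<^sub>V w)) \<Longrightarrow> f = g"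
  by (rule endo_eqI) (rule clinear_tensor_ext[OF app_linear app_linear])

definition tmap :: "'v::complex_vector endo \<Rightarrow> 'w::complex_vector endo \<Rightarrow> ('v, 'w) tensor endo" where
  "tmap f g = Endo (tensor_lift (\<lambda>v w. app f v \<otimes>\<^sub>V app g w))"

lemma app_tmap [simp]: "app (tmap f g) (v \<otimes>\<^sub>V w) = app f v \<otimes>\<^sub>V app g w"
proof -
  have b: "bilinear_map (\<lambda>v w. app f v \<otimes>\<^sub>V app g w)"
    unfolding bilinear_map_def
    by (auto intro!: clinearI simp: app_simps tens_add_left tens_add_right tens_scaleC_left tens_scaleC_right)
  show ?thesis
    by (simp add: tmap_def app_Endo[OF tensor_lift_linear[OF b]] tensor_lift_tens[OF b])
qed

lemma tens_0 [simp]: "0 \<otimes>\<^sub>V w = 0" "v \<otimes>\<^sub>V 0 = 0"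
  using tens_scaleC_left[of 0 0 w] tens_scaleC_right[of v 0 0] by simp_all

lemma tens_diff: "(v - v') \<otimes>\<^sub>V w = v \<otimes>\<^sub>V w - v' \<otimes>\<^sub>V w" "v \<otimes>\<^sub>V (w - w') = v \<otimes>\<^sub>V w - v \<otimes>\<^sub>V w'"
proof -
  show "(v - v') \<otimes>\<^sub>V w = v \<otimes>\<^sub>V w - v' \<otimes>\<^sub>V w"
    using tens_add_left[of "v - v'" v' w] by simp
  show "v \<otimes>\<^sub>V (w - w') = v \<otimes>\<^sub>V w - v \<otimes>\<^sub>V w'"
    using tens_add_right[of v "w - w'" w'] by simp
qed

lemma tmap_mult [simp]: "tmap f g * tmap f' g' = tmap (f * f') (g * g')"
  by (rule endo_tensor_eqI) simp

lemma tmap_1 [simp]: "tmap 1 1 = 1"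
  by (rule endo_tensor_eqI) simp

lemma tmap_0 [simp]: "tmap 0 g = 0" "tmap f 0 = 0"
  by (rule endo_tensor_eqI; simp)+

lemma tmap_add: "tmap (f + f') g = tmap f g + tmap f' g" "tmap f (g + g') = tmap f g + tmap f g'"
  by (rule endo_tensor_eqI; simp add: tens_add_left tens_add_right)+

lemma tmap_diff: "tmap (f - f') g = tmap f g - tmap f' g" "tmap f (g - g') = tmap f g - tmap f g'"
  by (rule endo_tensor_eqI; simp add: tens_diff)+

lemma tmap_scale: "tmap (c *\<^sub>C f) g = c *\<^sub>C tmap f g" "tmap f (c *\<^sub>C g) = c *\<^sub>C tmap f g"
  by (rule endo_tensor_eqI; simp add: tens_scaleC_left tens_scaleC_right)+

section \<open>Laurent series of endomorphisms\<close>

instantiation fls :: (complex_vector) complex_vector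
begin

lift_definition scaleC_fls :: "complex \<Rightarrow> 'a fls \<Rightarrow> 'a fls" is "\<lambda>c f n. c *\<^sub>C f n"
  by (auto elim: eventually_mono)

instance
  by standard (transfer; simp add: fun_eq_iff scaleC_add_right scaleC_add_left scaleC_scaleC scaleC_one)+

end

lemma fls_scaleC_nth [simp]: "fls_nth (c *\<^sub>C F) n = c *\<^sub>C fls_nth F n"
  by transfer simp

lemma fls_lower_bound: obtains M where "\<And>k. k < M \<Longrightarrow> fls_nth F k = 0"
  using fls_eq0_below_subdegree[of _ F] by blast

text \<open>With a common lower bound M for the orders of all factors, every product coefficient is
  a sum over the same finite index set, whatever the order of the factors. Relations can then be
  compared term by term.\<close>

definition pairs :: "int \<Rightarrow> int \<Rightarrow> (int \<times> int) set" where
  "pairs M N = {(k, l). M \<le> k \<and> M \<le> l \<and> k + l = N}"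

definition triples :: "int \<Rightarrow> int \<Rightarrow> (int \<times> int \<times> int) set" where
  "triples M N = {(k, l, j). M \<le> k \<and> M \<le> l \<and> M \<le> j \<and> k + l + j = N}"

lemma finite_pairs: "finite (pairs M N)"
  by (rule finite_subset[of _ "{M..N - M} \<times> {M..N - M}"]) (auto simp: pairs_def)

lemma fls_times_nth_pairs:
  fixes F G :: "'a::ring fls"
  assumes "\<And>k. k < M \<Longrightarrow> fls_nth F k = 0" "\<And>k. k < M \<Longrightarrow> fls_nth G k = 0"
  shows "fls_nth (F * G) N = (\<Sum>(k, l)\<in>pairs M N. fls_nth F k * fls_nth G l)"
proof -
  let ?T = "\<lambda>k. fls_nth F k * fls_nth G (N - k)"
  let ?lo = "min M (fls_subdegree F)" and ?hi = "max (N - M) (N - fls_subdegree G)"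
  have "fls_nth (F * G) N = (\<Sum>k=fls_subdegree F..N - fls_subdegree G. ?T k)"
    by (rule fls_times_nth(2))
  also have "\<dots> = (\<Sum>k=?lo..?hi. ?T k)"
    by (rule sum.mono_neutral_left) (auto simp: fls_eq0_below_subdegree)
  also have "\<dots> = (\<Sum>k=M..N - M. ?T k)"
    by (rule sum.mono_neutral_right) (auto simp: assms)
  also have "\<dots> = (\<Sum>(k, l)\<in>pairs M N. fls_nth F k * fls_nth G l)"
    by (rule sum.reindex_bij_witness[of _ fst "\<lambda>k. (k, N - k)"]) (auto simp: pairs_def)
  finally show ?thesis .
qed

lemma fls_times_nth_pairs_swap:
  fixes F G :: "'a::ring fls"
  assumes "\<And>k. k < M \<Longrightarrow> fls_nth F k = 0" "\<And>k. k < M \<Longrightarrow> fls_nth G k = 0"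
  shows "fls_nth (G * F) N = (\<Sum>(k, l)\<in>pairs M N. fls_nth G l * fls_nth F k)"
proof -
  have "fls_nth (G * F) N = (\<Sum>(k, l)\<in>pairs M N. fls_nth G k * fls_nth F l)"
    by (rule fls_times_nth_pairs) (use assms in auto)
  also have "\<dots> = (\<Sum>(k, l)\<in>pairs M N. fls_nth G l * fls_nth F k)"
    by (rule sum.reindex_bij_witness[of _ prod.swap prod.swap]) (auto simp: pairs_def)
  finally show ?thesis .
qed

lemma fls_times_below:
  fixes F G :: "'a::ring fls"
  assumes "\<And>k. k < M \<Longrightarrow> fls_nth F k = 0" "\<And>k. k < M' \<Longrightarrow> fls_nth G k = 0" "N < M + M'"
  shows "fls_nth (F * G) N = 0"
proof -
  have "fls_nth (F * G) N = (\<Sum>(k, l)\<in>pairs (min M M') N. fls_nth F k * fls_nth G l)"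
    by (rule fls_times_nth_pairs) (use assms in auto)
  also have "\<dots> = 0"
  proof (rule sum.neutral, clarify)
    fix k l assume "(k, l) \<in> pairs (min M M') N"
    then have "k < M \<or> l < M'" using assms(3) by (auto simp: pairs_def)
    then show "fls_nth F k * fls_nth G l = 0" using assms(1,2) by auto
  qed
  finally show ?thesis .
qed

lemma fls_times_nth_triples:
  fixes F G H :: "'a::ring fls"
  assumes F: "\<And>k. k < M \<Longrightarrow> fls_nth F k = 0" and G: "\<And>k. k < M \<Longrightarrow> fls_nth G k = 0"
    and H: "\<And>k. k < M \<Longrightarrow> fls_nth H k = 0"
  shows "fls_nth (F * G * H) N = (\<Sum>(k, l, j)\<in>triples M N. fls_nth F k * fls_nth G l * fls_nth H j)"
proof -
  \<comment> \<open>The product of F and G vanishes only below 2M, which is smaller than M when M is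
    negative.\<close>
  let ?M = "min M (2 * M)"
  have H': "M \<le> j" if "fls_nth H j \<noteq> 0" for j using H[of j] that by linarith
  have "fls_nth (F * G * H) N = (\<Sum>(m, j)\<in>pairs ?M N. fls_nth (F * G) m * fls_nth H j)"
    by (rule fls_times_nth_pairs) (use fls_times_below[OF F G] H in auto)
  also have "\<dots> = (\<Sum>(m, j)\<in>pairs ?M N. \<Sum>(k, l)\<in>pairs M m. fls_nth F k * fls_nth G l * fls_nth H j)"
    by (intro sum.cong) (auto simp: fls_times_nth_pairs[OF F G] sum_distrib_right intro!: sum.cong)
  also have "\<dots> = (\<Sum>(x, y)\<in>Sigma (pairs ?M N) (\<lambda>x. pairs M (fst x)). fls_nth F (fst y) * fls_nth G (snd y) * fls_nth H (snd x))"
    by (subst sum.Sigma[symmetric]) (auto simp: finite_pairs intro!: sum.cong)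
  also have "\<dots> = (\<Sum>(x, y)\<in>Sigma {x \<in> pairs ?M N. M \<le> snd x} (\<lambda>x. pairs M (fst x)). fls_nth F (fst y) * fls_nth G (snd y) * fls_nth H (snd x))"
    by (rule sum.mono_neutral_right) (auto simp: finite_pairs intro!: finite_SigmaI H')
  also have "\<dots> = (\<Sum>(k, l, j)\<in>triples M N. fls_nth F k * fls_nth G l * fls_nth H j)"
    by (rule sum.reindex_bij_witness[of _ "\<lambda>(k, l, j). ((k + l, j), (k, l))" "\<lambda>((m, j), (k, l)). (k, l, j)"])
      (auto simp: pairs_def triples_def)
  finally show ?thesis .
qed

section \<open>Scalar identities behind the Serre relations of a coproduct\<close>

text \<open>The recursion moves along antidiagonals and determines smaller m from larger m, so
  vanishing for large m spreads to all m. This is the injectivity of a factor z - k w on series that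
  are bounded on one side.\<close>

lemma one_sided_zero:
  fixes F :: "int \<Rightarrow> int \<Rightarrow> complex"
  assumes "\<And>m r. F (m - 1) r = k * F m (r - 1)" and "\<exists>M. \<forall>m>M. \<forall>r. F m r = 0"
  shows "F m r = 0"
proof -
  obtain M where M: "\<And>m r. m > M \<Longrightarrow> F m r = 0" using assms(2) by blast
  have "F (M + 1 - int b) r = 0" for b r
  proof (induction b arbitrary: r)
    case (Suc b)
    show ?case using assms(1)[of "M + 1 - int b" r] Suc.IH[of "r - 1"] by (simp add: algebra_simps)
  qed (simp add: M)
  from this[of "nat (M + 1 - m)" r] M[of m r] show ?thesis by (cases "m > M") simp_all
qed

text \<open>In the following four lemmas the functions are matrix coefficients of words in currents
  \<open>x(z\<^sub>1)\<close>, \<open>x(z\<^sub>2)\<close>, \<open>y(w)\<close> each taken from one of the two summands \<open>A\<close>, \<open>B\<close> of a coproduct. The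
  crossing relations move \<open>B\<close> to the right of \<open>A\<close>; their denominators act injectively because
  the words vanish for large indices of \<open>B\<close>.\<close>

lemma serre_AAB:
  fixes t1 t2 t3 :: "int \<Rightarrow> int \<Rightarrow> int \<Rightarrow> complex" and c d k :: complex
  assumes c: "c \<noteq> 0" and d: "d * c = c * c + 1" and k: "k * c * c = 1"
    and h1: "\<And>m1 m2 r. t2 m1 (m2 - 1) r - c * t2 m1 m2 (r - 1) = c * t1 m1 (m2 - 1) r - t1 m1 m2 (r - 1)"
    and h2: "\<And>m1 m2 r. t3 (m1 - 1) m2 r - c * t3 m1 m2 (r - 1) = c * t2 (m1 - 1) m2 r - t2 m1 m2 (r - 1)"
    and h3: "\<And>m1 m2 r. t1 m1 (m2 - 1) r - k * t1 (m1 - 1) m2 r = k * t1 (m2 - 1) m1 r - t1 m2 (m1 - 1) r"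
    and van: "\<exists>R. \<forall>r>R. \<forall>m1 m2. t1 m1 m2 r = 0 \<and> t2 m1 m2 r = 0 \<and> t3 m1 m2 r = 0"
  shows "t1 m1 m2 r - d * t2 m1 m2 r + t3 m1 m2 r + (t1 m2 m1 r - d * t2 m2 m1 r + t3 m2 m1 r) = 0"
proof -
  define E where "E m1 m2 r = t1 m1 m2 r - d * t2 m1 m2 r + t3 m1 m2 r + (t1 m2 m1 r - d * t2 m2 m1 r + t3 m2 m1 r)"
    for m1 m2 r
  \<comment> \<open>In generating series \<open>D t\<close> is (z1 - c w)(z2 - c w) t, the product
    of the denominators met when y(w), taken from B, passes the two factors A.\<close>
  define D where "D t m1 m2 r = t (m1 - 1) (m2 - 1) r - c * t (m1 - 1) m2 (r - 1) - c * t m1 (m2 - 1) (r - 1)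
    + c * c * t m1 m2 (r - 2)" for t :: "int \<Rightarrow> int \<Rightarrow> int \<Rightarrow> complex" and m1 m2 r
  have D2: "D t2 m1 m2 r = c * t1 (m1 - 1) (m2 - 1) r - t1 (m1 - 1) m2 (r - 1)
      - c * (c * t1 m1 (m2 - 1) (r - 1) - t1 m1 m2 (r - 2))" for m1 m2 r
    using h1[of "m1 - 1" m2 r] h1[of m1 m2 "r - 1"] unfolding D_def by (simp, algebra)
  have D3: "D t3 m1 m2 r = c * (c * t1 (m1 - 1) (m2 - 1) r - t1 (m1 - 1) m2 (r - 1))
      - (c * t1 m1 (m2 - 1) (r - 1) - t1 m1 m2 (r - 2))" for m1 m2 r
    using h2[of m1 "m2 - 1" r] h2[of m1 m2 "r - 1"] h1[of "m1 - 1" m2 r] h1[of m1 m2 "r - 1"]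
    unfolding D_def by (simp, algebra)
  \<comment> \<open>By d c = c^2 + 1 the numerators combine to (1 - c^2) w (z1 - c^2 z2) t1. The
    quadratic relation, with k = c^-2, makes (z1 - c^2 z2) t1 antisymmetric under the exchange of z1
    and z2, so the symmetrised sum vanishes.\<close>
  have half: "c * (D t1 m1 m2 r - d * D t2 m1 m2 r + D t3 m1 m2 r)
      = (1 - c * c) * (t1 (m1 - 1) m2 (r - 1) - c * c * t1 m1 (m2 - 1) (r - 1))" for m1 m2 r
    unfolding D2 D3 unfolding D_def using d by algebra
  have "c * (D t1 m1 m2 r - d * D t2 m1 m2 r + D t3 m1 m2 r)
      + c * (D t1 m2 m1 r - d * D t2 m2 m1 r + D t3 m2 m1 r) = 0" for m1 m2 r
    unfolding half using h3[of m1 m2 "r - 1"] k by algebra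
  moreover have "c * D E m1 m2 r = c * (D t1 m1 m2 r - d * D t2 m1 m2 r + D t3 m1 m2 r)
      + c * (D t1 m2 m1 r - d * D t2 m2 m1 r + D t3 m2 m1 r)" for m1 m2 r
    unfolding D_def E_def by (simp add: algebra_simps)
  ultimately have DE: "D E m1 m2 r = 0" for m1 m2 r using c by simp
  obtain R where R: "\<And>r m1 m2. r > R \<Longrightarrow> E m1 m2 r = 0" using van unfolding E_def by (metis add.right_neutral diff_zero mult_zero_right)
  \<comment> \<open>The two denominators are cancelled separately: \<open>F\<close> is (z2 - c w)E,
    and (z1 - c w)F = 0.\<close>
  define F where "F m1 r m2 = E m1 (m2 - 1) r - c * E m1 m2 (r - 1)" for m1 r m2
  have "F m1 r m2 = 0" for m1 r m2
  proof -
    have "F m1 (r - 1) m2 = inverse c * F (m1 - 1) r m2" for r m1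
      using DE[of m1 m2 r] c unfolding F_def D_def by (simp add: field_simps)
    then show ?thesis
      using R by (intro one_sided_zero[where F = "\<lambda>r m1. F m1 r m2" and k = "inverse c"] exI[of _ "R + 1"])
        (auto simp: F_def)
  qed
  then have "E m1 m2 (r - 1) = inverse c * E m1 (m2 - 1) r" for m2 r
    unfolding F_def using c by (simp add: field_simps)
  then have "E m1 m2 r = 0"
    using R by (intro one_sided_zero[where F = "\<lambda>r m2. E m1 m2 r" and k = "inverse c"] exI[of _ R]) auto
  then show ?thesis by (simp add: E_def)
qed

lemma serre_BBA:
  fixes t1 t2 t3 :: "int \<Rightarrow> int \<Rightarrow> int \<Rightarrow> complex" and c d k :: complex
  assumes c: "c \<noteq> 0" and d: "d * c = c * c + 1" and k: "k * c * c = 1"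
    and h1: "\<And>m1 m2 r. t2 m1 m2 (r - 1) - c * t2 (m1 - 1) m2 r = c * t1 m1 m2 (r - 1) - t1 (m1 - 1) m2 r"
    and h2: "\<And>m1 m2 r. t3 m1 m2 (r - 1) - c * t3 m1 (m2 - 1) r = c * t2 m1 m2 (r - 1) - t2 m1 (m2 - 1) r"
    and h3: "\<And>m1 m2 r. t1 m1 (m2 - 1) r - k * t1 (m1 - 1) m2 r = k * t1 (m2 - 1) m1 r - t1 m2 (m1 - 1) r"
    and van: "\<And>m2. \<exists>M. \<forall>m1>M. \<forall>r. t1 m1 m2 r = 0 \<and> t2 m1 m2 r = 0 \<and> t3 m1 m2 r = 0
      \<and> t1 m2 m1 r = 0 \<and> t2 m2 m1 r = 0 \<and> t3 m2 m1 r = 0"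
  shows "t3 m1 m2 r - d * t2 m1 m2 r + t1 m1 m2 r + (t3 m2 m1 r - d * t2 m2 m1 r + t1 m2 m1 r) = 0"
proof -
  define E where "E m1 m2 r = t3 m1 m2 r - d * t2 m1 m2 r + t1 m1 m2 r + (t3 m2 m1 r - d * t2 m2 m1 r + t1 m2 m1 r)"
    for m1 m2 r
  \<comment> \<open>Here y(w) belongs to A and passes two factors B, so the denominators are w - c
    z1 and w - c z2.\<close>
  define D where "D t m1 m2 r = t m1 m2 (r - 2) - c * t (m1 - 1) m2 (r - 1) - c * t m1 (m2 - 1) (r - 1)
    + c * c * t (m1 - 1) (m2 - 1) r" for t :: "int \<Rightarrow> int \<Rightarrow> int \<Rightarrow> complex" and m1 m2 r
  have D2: "D t2 m1 m2 r = c * t1 m1 m2 (r - 2) - t1 (m1 - 1) m2 (r - 1)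
      - c * (c * t1 m1 (m2 - 1) (r - 1) - t1 (m1 - 1) (m2 - 1) r)" for m1 m2 r
    using h1[of m1 m2 "r - 1"] h1[of m1 "m2 - 1" r] unfolding D_def by (simp, algebra)
  have D3: "D t3 m1 m2 r = c * (c * t1 m1 m2 (r - 2) - t1 (m1 - 1) m2 (r - 1))
      - (c * t1 m1 (m2 - 1) (r - 1) - t1 (m1 - 1) (m2 - 1) r)" for m1 m2 r
    using h2[of m1 m2 "r - 1"] h2[of "m1 - 1" m2 r] h1[of m1 m2 "r - 1"] h1[of m1 "m2 - 1" r]
    unfolding D_def by (simp, algebra)
  have half: "c * (D t3 m1 m2 r - d * D t2 m1 m2 r + D t1 m1 m2 r)
      = (1 - c * c) * (t1 (m1 - 1) m2 (r - 1) - c * c * t1 m1 (m2 - 1) (r - 1))" for m1 m2 r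
    unfolding D2 D3 unfolding D_def using d by algebra
  have "c * (D t3 m1 m2 r - d * D t2 m1 m2 r + D t1 m1 m2 r)
      + c * (D t3 m2 m1 r - d * D t2 m2 m1 r + D t1 m2 m1 r) = 0" for m1 m2 r
    unfolding half using h3[of m1 m2 "r - 1"] k by algebra
  moreover have "c * D E m1 m2 r = c * (D t3 m1 m2 r - d * D t2 m1 m2 r + D t1 m1 m2 r)
      + c * (D t3 m2 m1 r - d * D t2 m2 m1 r + D t1 m2 m1 r)" for m1 m2 r
    unfolding D_def E_def by (simp add: algebra_simps)
  ultimately have DE: "D E m1 m2 r = 0" for m1 m2 r using c by simp
  have R: "\<exists>M. \<forall>m1>M. \<forall>r. E m1 m2 r = 0" for m2
    using van[of m2] unfolding E_def by (metis add.right_neutral diff_zero mult_zero_right)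
  define F where "F m1 m2 r = E m1 m2 (r - 1) - c * E m1 (m2 - 1) r" for m1 m2 r
  have F0: "F m1 m2 r = 0" for m1 m2 r
  proof -
    have "F (m1 - 1) m2 r = inverse c * F m1 m2 (r - 1)" for r m1
      using DE[of m1 m2 r] c unfolding F_def D_def by (simp add: field_simps)
    moreover have "\<exists>M. \<forall>m1>M. \<forall>r. F m1 m2 r = 0"
    proof -
      obtain M M' where "\<And>m1 r. m1 > M \<Longrightarrow> E m1 m2 r = 0" "\<And>m1 r. m1 > M' \<Longrightarrow> E m1 (m2 - 1) r = 0"
        using R by metis
      then show ?thesis by (intro exI[of _ "max M M'"]) (simp add: F_def)
    qed
    ultimately show ?thesis
      by (rule one_sided_zero[where F = "\<lambda>m1 r. F m1 m2 r"])
  qed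
  have "E m1 (m2 - 1) r = inverse c * E m1 m2 (r - 1)" for m2 r
    using F0[of m1 m2 r] c unfolding F_def by (simp add: field_simps)
  moreover have sym: "E m1 m2 r = E m2 m1 r" for m1 m2 r by (simp add: E_def)
  have "\<exists>M. \<forall>m2>M. \<forall>r. E m1 m2 r = 0" unfolding sym[of m1] by (rule R)
  ultimately have "E m1 m2 r = 0"
    by (rule one_sided_zero[where F = "\<lambda>m2 r. E m1 m2 r"])
  then show ?thesis by (simp add: E_def)
qed

lemma serre_BAA:
  fixes a1 a2 a3 a4 u v :: "int \<Rightarrow> int \<Rightarrow> int \<Rightarrow> complex" and c d k :: complex
  assumes c: "c \<noteq> 0" and d: "d * c = c * c + 1" and k: "k * c * c = 1"
    and h1: "\<And>m1 m2 r. a1 m1 (m2 - 1) r - k * a1 (m1 - 1) m2 r = k * a4 m1 (m2 - 1) r - a4 (m1 - 1) m2 r"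
    and h4: "\<And>m1 m2 r. a4 m1 m2 (r - 1) - c * a4 (m1 - 1) m2 r = c * u m1 m2 (r - 1) - u (m1 - 1) m2 r"
    and h2: "\<And>m1 m2 r. a2 m1 m2 (r - 1) - c * a2 (m1 - 1) m2 r = c * a3 m1 m2 (r - 1) - a3 (m1 - 1) m2 r"
    and h3: "\<And>m1 m2 r. a3 m1 (m2 - 1) r - k * a3 (m1 - 1) m2 r = k * v m1 (m2 - 1) r - v (m1 - 1) m2 r"
    and h5: "\<And>m1 m2 r. u m1 m2 (r - 1) - c * u m1 (m2 - 1) r = c * v m1 m2 (r - 1) - v m1 (m2 - 1) r"
    and van: "\<exists>M. \<forall>m1>M. \<forall>m2 r. a1 m1 m2 r = 0 \<and> a2 m1 m2 r = 0 \<and> a3 m1 m2 r = 0 \<and> a4 m1 m2 r = 0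
      \<and> u m1 m2 r = 0 \<and> v m1 m2 r = 0"
  shows "a1 m1 m2 r - d * a2 m1 m2 r + a3 m1 m2 r + (a4 m1 m2 r - d * u m1 m2 r + v m1 m2 r) = 0"
proof -
  define E where "E m1 m2 r = a1 m1 m2 r - d * a2 m1 m2 r + a3 m1 m2 r + (a4 m1 m2 r - d * u m1 m2 r + v m1 m2 r)"
    for m1 m2 r
  \<comment> \<open>\<open>D\<close> multiplies by (z2 - k z1)(w - c z1), the denominators for
    moving B(z1) past A(z2) and A'(w), and \<open>N\<close> by the numerators (k z2 - z1)(c w - z1).
    Every word is reduced to u and v, in which B stands on the right.\<close>
  define D where "D t m1 m2 r = t m1 (m2 - 1) (r - 1) - k * t (m1 - 1) m2 (r - 1) - c * t (m1 - 1) (m2 - 1) r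
    + k * c * t (m1 - 2) m2 r" for t :: "int \<Rightarrow> int \<Rightarrow> int \<Rightarrow> complex" and m1 m2 r
  define N where "N t m1 m2 r = k * (c * t m1 (m2 - 1) (r - 1) - t (m1 - 1) (m2 - 1) r)
    - (c * t (m1 - 1) m2 (r - 1) - t (m1 - 2) m2 r)" for t :: "int \<Rightarrow> int \<Rightarrow> int \<Rightarrow> complex" and m1 m2 r
  have D4: "D a4 m1 m2 r = (c * u m1 (m2 - 1) (r - 1) - u (m1 - 1) (m2 - 1) r)
      - k * (c * u (m1 - 1) m2 (r - 1) - u (m1 - 2) m2 r)" for m1 m2 r
    using h4[of m1 "m2 - 1" r] h4[of "m1 - 1" m2 r] unfolding D_def by (simp, algebra)
  have D1: "D a1 m1 m2 r = N u m1 m2 r" for m1 m2 r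
    using h1[of m1 m2 "r - 1"] h1[of "m1 - 1" m2 r] h4[of m1 "m2 - 1" r] h4[of "m1 - 1" m2 r]
    unfolding D_def N_def by (simp, algebra)
  have D3: "D a3 m1 m2 r = (k * v m1 (m2 - 1) (r - 1) - v (m1 - 1) m2 (r - 1))
      - c * (k * v (m1 - 1) (m2 - 1) r - v (m1 - 2) m2 r)" for m1 m2 r
    using h3[of m1 m2 "r - 1"] h3[of "m1 - 1" m2 r] unfolding D_def by (simp, algebra)
  have D2: "D a2 m1 m2 r = N v m1 m2 r" for m1 m2 r
    using h2[of m1 "m2 - 1" r] h2[of "m1 - 1" m2 r] h3[of m1 m2 "r - 1"] h3[of "m1 - 1" m2 r]
    unfolding D_def N_def by (simp, algebra)
  have "D E m1 m2 r = D a1 m1 m2 r - d * D a2 m1 m2 r + D a3 m1 m2 r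
      + (D a4 m1 m2 r - d * D u m1 m2 r + D v m1 m2 r)" for m1 m2 r
    unfolding D_def E_def by (simp add: algebra_simps)
  \<comment> \<open>What remains is a multiple of z1 times the quadratic relation \<open>h5\<close>
    between A(z2) and A'(w): the mixed Serre relation needs no Serre relation of the
    factors.\<close>
  moreover have "c * (D a1 m1 m2 r - d * D a2 m1 m2 r + D a3 m1 m2 r
      + (D a4 m1 m2 r - d * D u m1 m2 r + D v m1 m2 r)) = 0" for m1 m2 r
    unfolding D1 D2 D3 D4 unfolding D_def N_def using h5[of "m1 - 1" m2 r] d k by (simp, algebra)
  ultimately have DE: "D E m1 m2 r = 0" for m1 m2 r using c by simp
  obtain M where M: "\<And>m1 m2 r. m1 > M \<Longrightarrow> E m1 m2 r = 0"
    using van unfolding E_def by (metis add.right_neutral diff_zero mult_zero_right)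
  have k_nz: "k \<noteq> 0" using k by auto
  define F where "F m1 m2 r = E m1 m2 (r - 1) - c * E (m1 - 1) m2 r" for m1 m2 r
  have F0: "F m1 m2 r = 0" for m1 m2 r
  proof -
    have "F (m1 - 1) m2 r = inverse k * F m1 (m2 - 1) r" for m1 m2
      using DE[of m1 m2 r] k_nz unfolding F_def D_def by (simp add: field_simps)
    then show ?thesis
      using M by (intro one_sided_zero[where F = "\<lambda>m1 m2. F m1 m2 r" and k = "inverse k"] exI[of _ "M + 1"])
        (auto simp: F_def)
  qed
  have "E (m1 - 1) m2 r = inverse c * E m1 m2 (r - 1)" for m1 r
    using F0[of m1 m2 r] c unfolding F_def by (simp add: field_simps)
  then have "E m1 m2 r = 0"
    using M by (intro one_sided_zero[where F = "\<lambda>m1 r. E m1 m2 r" and k = "inverse c"] exI[of _ M]) auto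
  then show ?thesis by (simp add: E_def)
qed

lemma serre_BAB:
  fixes b1 b2 b3 b6 u v :: "int \<Rightarrow> int \<Rightarrow> int \<Rightarrow> complex" and c d k :: complex
  assumes c: "c \<noteq> 0" and d: "d * c = c * c + 1" and k: "k * c * c = 1"
    and h1: "\<And>m1 m2 r. b1 m1 (m2 - 1) r - k * b1 (m1 - 1) m2 r = k * u m1 (m2 - 1) r - u (m1 - 1) m2 r"
    and h2: "\<And>m1 m2 r. b2 m1 (m2 - 1) r - c * b2 m1 m2 (r - 1) = c * b1 m1 (m2 - 1) r - b1 m1 m2 (r - 1)"
    and h3: "\<And>m1 m2 r. b3 m1 (m2 - 1) r - k * b3 (m1 - 1) m2 r = k * b6 m1 (m2 - 1) r - b6 (m1 - 1) m2 r"
    and h6: "\<And>m1 m2 r. b6 m1 (m2 - 1) r - c * b6 m1 m2 (r - 1) = c * v m1 (m2 - 1) r - v m1 m2 (r - 1)"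
    and h5: "\<And>m1 m2 r. u m1 m2 (r - 1) - c * u (m1 - 1) m2 r = c * v m1 m2 (r - 1) - v (m1 - 1) m2 r"
    and van1: "\<And>r. \<exists>M. \<forall>m1>M. \<forall>m2. b1 m1 m2 r = 0 \<and> b2 m1 m2 r = 0 \<and> b3 m1 m2 r = 0 \<and> b6 m1 m2 r = 0
      \<and> u m1 m2 r = 0 \<and> v m1 m2 r = 0"
    and van2: "\<And>m1. \<exists>R. \<forall>r>R. \<forall>m2. b1 m1 m2 r = 0 \<and> b2 m1 m2 r = 0 \<and> b3 m1 m2 r = 0 \<and> b6 m1 m2 r = 0
      \<and> u m1 m2 r = 0 \<and> v m1 m2 r = 0"
  shows "b1 m1 m2 r - d * b2 m1 m2 r + b3 m1 m2 r + (u m1 m2 r - d * v m1 m2 r + b6 m1 m2 r) = 0"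
proof -
  define E where "E m1 m2 r = b1 m1 m2 r - d * b2 m1 m2 r + b3 m1 m2 r + (u m1 m2 r - d * v m1 m2 r + b6 m1 m2 r)"
    for m1 m2 r
  \<comment> \<open>\<open>D\<close> multiplies by (z2 - k z1)(z2 - c w): now A(z2) is moved to the
    left of B(z1) and B'(w), and the reduced words u and v differ by the order of the two factors
    B.\<close>
  define D where "D t m1 m2 r = t m1 (m2 - 2) r - k * t (m1 - 1) (m2 - 1) r - c * t m1 (m2 - 1) (r - 1)
    + k * c * t (m1 - 1) m2 (r - 1)" for t :: "int \<Rightarrow> int \<Rightarrow> int \<Rightarrow> complex" and m1 m2 r
  define N where "N t m1 m2 r = k * (c * t m1 (m2 - 2) r - t m1 (m2 - 1) (r - 1))
    - (c * t (m1 - 1) (m2 - 1) r - t (m1 - 1) m2 (r - 1))" for t :: "int \<Rightarrow> int \<Rightarrow> int \<Rightarrow> complex" and m1 m2 r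
  have D1: "D b1 m1 m2 r = (k * u m1 (m2 - 2) r - u (m1 - 1) (m2 - 1) r)
      - c * (k * u m1 (m2 - 1) (r - 1) - u (m1 - 1) m2 (r - 1))" for m1 m2 r
    using h1[of m1 "m2 - 1" r] h1[of m1 m2 "r - 1"] unfolding D_def by (simp, algebra)
  have D2: "D b2 m1 m2 r = N u m1 m2 r" for m1 m2 r
    using h2[of m1 "m2 - 1" r] h2[of "m1 - 1" m2 r] h1[of m1 "m2 - 1" r] h1[of m1 m2 "r - 1"]
    unfolding D_def N_def by (simp, algebra)
  have D6: "D b6 m1 m2 r = (c * v m1 (m2 - 2) r - v m1 (m2 - 1) (r - 1))
      - k * (c * v (m1 - 1) (m2 - 1) r - v (m1 - 1) m2 (r - 1))" for m1 m2 r
    using h6[of m1 "m2 - 1" r] h6[of "m1 - 1" m2 r] unfolding D_def by (simp, algebra)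
  have D3: "D b3 m1 m2 r = N v m1 m2 r" for m1 m2 r
    using h3[of m1 "m2 - 1" r] h3[of m1 m2 "r - 1"] h6[of m1 "m2 - 1" r] h6[of "m1 - 1" m2 r]
    unfolding D_def N_def by (simp, algebra)
  have "D E m1 m2 r = D b1 m1 m2 r - d * D b2 m1 m2 r + D b3 m1 m2 r
      + (D u m1 m2 r - d * D v m1 m2 r + D b6 m1 m2 r)" for m1 m2 r
    unfolding D_def E_def by (simp add: algebra_simps)
  moreover have "c * c * c * (D b1 m1 m2 r - d * D b2 m1 m2 r + D b3 m1 m2 r
      + (D u m1 m2 r - d * D v m1 m2 r + D b6 m1 m2 r)) = 0" for m1 m2 r
    unfolding D1 D2 D3 D6 unfolding D_def N_def using h5[of m1 "m2 - 1" r] d k by (simp, algebra)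
  ultimately have DE: "D E m1 m2 r = 0" for m1 m2 r using c by simp
  have k_nz: "k \<noteq> 0" using k by auto
  have M1: "\<exists>M. \<forall>m1>M. \<forall>m2. E m1 m2 r = 0" for r
    using van1[of r] unfolding E_def by (metis add.right_neutral diff_zero mult_zero_right)
  have M2: "\<exists>R. \<forall>r>R. \<forall>m2. E m1 m2 r = 0" for m1
    using van2[of m1] unfolding E_def by (metis add.right_neutral diff_zero mult_zero_right)
  \<comment> \<open>The words vanish only when m1 + r is large. So z2 - k z1 is cancelled with r
    fixed, and afterwards z2 - c w with m1 fixed.\<close>
  define F where "F m1 m2 r = E m1 (m2 - 1) r - c * E m1 m2 (r - 1)" for m1 m2 r
  have F0: "F m1 m2 r = 0" for m1 m2 r
  proof -
    have "F (m1 - 1) m2 r = inverse k * F m1 (m2 - 1) r" for m1 m2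
      using DE[of m1 m2 r] k_nz unfolding F_def D_def by (simp add: field_simps)
    moreover have "\<exists>M. \<forall>m1>M. \<forall>m2. F m1 m2 r = 0"
    proof -
      obtain M M' where "\<And>m1 m2. m1 > M \<Longrightarrow> E m1 m2 r = 0" "\<And>m1 m2. m1 > M' \<Longrightarrow> E m1 m2 (r - 1) = 0"
        using M1 by metis
      then show ?thesis by (intro exI[of _ "max M M'"]) (simp add: F_def)
    qed
    ultimately show ?thesis
      by (rule one_sided_zero[where F = "\<lambda>m1 m2. F m1 m2 r"])
  qed
  have "E m1 m2 (r - 1) = inverse c * E m1 (m2 - 1) r" for m2 r
    using F0[of m1 m2 r] c unfolding F_def by (simp add: field_simps)
  then have "E m1 m2 r = 0"
    using M2 by (intro one_sided_zero[where F = "\<lambda>r m2. E m1 m2 r" and k = "inverse c"]) auto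
  then show ?thesis by (simp add: E_def)
qed

section \<open>Relations between currents\<close>

definition quad :: "complex \<Rightarrow> (int \<Rightarrow> 'b::{ring,complex_vector}) \<Rightarrow> (int \<Rightarrow> 'b) \<Rightarrow> bool" where
  "quad c F F' \<longleftrightarrow> (\<forall>m r. F m * F' (r - 1) - c *\<^sub>C (F (m - 1) * F' r)
     = c *\<^sub>C (F' (r - 1) * F m) - F' r * F (m - 1))"

definition serre_rel :: "complex \<Rightarrow> (int \<Rightarrow> 'b::{ring,complex_vector}) \<Rightarrow> (int \<Rightarrow> 'b) \<Rightarrow> bool" where
  "serre_rel d F F' \<longleftrightarrow> (\<forall>m1 m2 r.
     F m1 * F m2 * F' r - d *\<^sub>C (F m1 * F' r * F m2) + F' r * F m1 * F m2
     + (F m2 * F m1 * F' r - d *\<^sub>C (F m2 * F' r * F m1) + F' r * F m2 * F m1) = 0)"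

definition commuting :: "(int \<Rightarrow> 'b::ring) \<Rightarrow> (int \<Rightarrow> 'b) \<Rightarrow> bool" where
  "commuting F F' \<longleftrightarrow> (\<forall>m r. F m * F' r = F' r * F m)"

lemma quad_sym: "quad c F F' \<Longrightarrow> quad c F' F"
  unfolding quad_def
proof (intro allI)
  fix m r
  assume *: "\<forall>m r. F m * F' (r - 1) - c *\<^sub>C (F (m - 1) * F' r) = c *\<^sub>C (F' (r - 1) * F m) - F' r * F (m - 1)"
  show "F' m * F (r - 1) - c *\<^sub>C (F' (m - 1) * F r) = c *\<^sub>C (F (r - 1) * F' m) - F r * F' (m - 1)"
    using *[rule_format, of r m] by (simp add: algebra_simps)
qed

lemma quad_add:
  assumes "quad c A A'" "quad c A B'" "quad c B A'" "quad c B B'"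
  shows "quad c (\<lambda>m. A m + B m) (\<lambda>m. A' m + B' m)"
  unfolding quad_def
proof (intro allI)
  fix m r
  have *: "F m * F' (r - 1) = c *\<^sub>C (F (m - 1) * F' r) + c *\<^sub>C (F' (r - 1) * F m) - F' r * F (m - 1)"
    if "quad c F F'" for F F'
    using that unfolding quad_def by (simp add: algebra_simps)
  show "(A m + B m) * (A' (r - 1) + B' (r - 1)) - c *\<^sub>C ((A (m - 1) + B (m - 1)) * (A' r + B' r))
      = c *\<^sub>C ((A' (r - 1) + B' (r - 1)) * (A m + B m)) - (A' r + B' r) * (A (m - 1) + B (m - 1))"
    by (simp add: distrib_left distrib_right scaleC_add_right *[OF assms(1)] *[OF assms(2)]
        *[OF assms(3)] *[OF assms(4)])
qed

section \<open>Lifting identities from coefficients to Laurent series\<close>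

lemma fls_scale_times [simp]:
  "(c *\<^sub>C F) * G = c *\<^sub>C (F * G)" "F * (c *\<^sub>C G) = c *\<^sub>C (F * (G :: 'v::complex_vector endo fls))"
proof -
  obtain M where M: "\<And>k. k < M \<Longrightarrow> fls_nth F k = 0" "\<And>k. k < M \<Longrightarrow> fls_nth G k = 0"
  proof -
    obtain M1 M2 where "\<And>k. k < M1 \<Longrightarrow> fls_nth F k = 0" "\<And>k. k < M2 \<Longrightarrow> fls_nth G k = 0"
      by (metis fls_lower_bound)
    then show thesis by (intro that[of "min M1 M2"]) auto
  qed
  have M': "\<And>k. k < M \<Longrightarrow> fls_nth (c *\<^sub>C F) k = 0" "\<And>k. k < M \<Longrightarrow> fls_nth (c *\<^sub>C G) k = 0"
    using M by simp_all
  show "(c *\<^sub>C F) * G = c *\<^sub>C (F * G)"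
    by (rule fls_eqI) (simp add: fls_times_nth_pairs[OF M'(1) M(2)] fls_times_nth_pairs[OF M]
        cvec.scale_sum_right case_prod_unfold)
  show "F * (c *\<^sub>C G) = c *\<^sub>C (F * G)"
    by (rule fls_eqI) (simp add: fls_times_nth_pairs[OF M(1) M'(2)] fls_times_nth_pairs[OF M]
        cvec.scale_sum_right case_prod_unfold)
qed

text \<open>The coefficients of both factors are matched at a fixed pair (k, l), so the products
  agree summand by summand. E and E' are independent of F and G to allow a power of u to be moved
  from one factor to the other.\<close>

lemma fls_lift_quad:
  fixes F G E E' :: "'v::complex_vector endo fls"
  assumes "\<And>k l. fls_nth F k * fls_nth G l - c *\<^sub>C (fls_nth E k * fls_nth E' l)
      = c *\<^sub>C (fls_nth G l * fls_nth F k) - fls_nth E' l * fls_nth E k"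
  shows "F * G - c *\<^sub>C (E * E') = c *\<^sub>C (G * F) - E' * E"
proof (rule fls_eqI)
  fix N
  obtain M1 M2 M3 M4 where "\<And>k. k < M1 \<Longrightarrow> fls_nth F k = 0" "\<And>k. k < M2 \<Longrightarrow> fls_nth G k = 0"
    "\<And>k. k < M3 \<Longrightarrow> fls_nth E k = 0" "\<And>k. k < M4 \<Longrightarrow> fls_nth E' k = 0"
    by (metis fls_lower_bound)
  then obtain M where M: "\<And>k. k < M \<Longrightarrow> fls_nth F k = 0" "\<And>k. k < M \<Longrightarrow> fls_nth G k = 0"
    "\<And>k. k < M \<Longrightarrow> fls_nth E k = 0" "\<And>k. k < M \<Longrightarrow> fls_nth E' k = 0"
    using that[of "min (min M1 M2) (min M3 M4)"] by auto
  have "fls_nth (F * G - c *\<^sub>C (E * E')) N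
      = (\<Sum>(k, l)\<in>pairs M N. fls_nth F k * fls_nth G l - c *\<^sub>C (fls_nth E k * fls_nth E' l))"
    by (simp add: fls_times_nth_pairs[OF M(1,2)] fls_times_nth_pairs[OF M(3,4)]
        cvec.scale_sum_right case_prod_unfold sum_subtractf)
  also have "\<dots> = (\<Sum>(k, l)\<in>pairs M N. c *\<^sub>C (fls_nth G l * fls_nth F k) - fls_nth E' l * fls_nth E k)"
    by (simp only: assms)
  also have "\<dots> = fls_nth (c *\<^sub>C (G * F) - E' * E) N"
    by (simp add: fls_times_nth_pairs_swap[OF M(1,2)] fls_times_nth_pairs_swap[OF M(3,4)]
        cvec.scale_sum_right case_prod_unfold sum_subtractf)
  finally show "fls_nth (F * G - c *\<^sub>C (E * E')) N = fls_nth (c *\<^sub>C (G * F) - E' * E) N" .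
qed

lemma fls_lift_commute:
  fixes F G :: "'v::complex_vector endo fls"
  assumes "\<And>k l. fls_nth F k * fls_nth G l = fls_nth G l * fls_nth F k"
  shows "F * G = G * F"
  using fls_lift_quad[of F G 1 0 0] assms by (simp add: scaleC_one)

lemma triples_permute:
  "(\<Sum>(k, l, j)\<in>triples M N. h k l j) = (\<Sum>(k, l, j)\<in>triples M N. h l k j)"
  "(\<Sum>(k, l, j)\<in>triples M N. h k l j) = (\<Sum>(k, l, j)\<in>triples M N. h k j l)"
  "(\<Sum>(k, l, j)\<in>triples M N. h k l j) = (\<Sum>(k, l, j)\<in>triples M N. h j k l)"
  "(\<Sum>(k, l, j)\<in>triples M N. h k l j) = (\<Sum>(k, l, j)\<in>triples M N. h l j k)"
  "(\<Sum>(k, l, j)\<in>triples M N. h k l j) = (\<Sum>(k, l, j)\<in>triples M N. h j l k)"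
  by ((rule sum.reindex_bij_witness[of _ "\<lambda>(k, l, j). (l, k, j)" "\<lambda>(k, l, j). (l, k, j)"],
        auto simp: triples_def)[1],
      (rule sum.reindex_bij_witness[of _ "\<lambda>(k, l, j). (k, j, l)" "\<lambda>(k, l, j). (k, j, l)"],
        auto simp: triples_def)[1],
      (rule sum.reindex_bij_witness[of _ "\<lambda>(k, l, j). (j, k, l)" "\<lambda>(k, l, j). (l, j, k)"],
        auto simp: triples_def)[1],
      (rule sum.reindex_bij_witness[of _ "\<lambda>(k, l, j). (l, j, k)" "\<lambda>(k, l, j). (j, k, l)"],
        auto simp: triples_def)[1],
      (rule sum.reindex_bij_witness[of _ "\<lambda>(k, l, j). (j, l, k)" "\<lambda>(k, l, j). (j, l, k)"],
        auto simp: triples_def)[1])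

lemma fls_lift_serre:
  fixes F G H :: "'v::complex_vector endo fls"
  assumes "\<And>k l j. fls_nth F k * fls_nth G l * fls_nth H j - d *\<^sub>C (fls_nth F k * fls_nth H j * fls_nth G l)
      + fls_nth H j * fls_nth F k * fls_nth G l
      + (fls_nth G l * fls_nth F k * fls_nth H j - d *\<^sub>C (fls_nth G l * fls_nth H j * fls_nth F k)
      + fls_nth H j * fls_nth G l * fls_nth F k) = 0"
  shows "F * G * H - d *\<^sub>C (F * H * G) + H * F * G + (G * F * H - d *\<^sub>C (G * H * F) + H * G * F) = 0"
proof (rule fls_eqI)
  fix N
  obtain M1 M2 M3 where "\<And>k. k < M1 \<Longrightarrow> fls_nth F k = 0" "\<And>k. k < M2 \<Longrightarrow> fls_nth G k = 0"
    "\<And>k. k < M3 \<Longrightarrow> fls_nth H k = 0"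
    by (metis fls_lower_bound)
  then obtain M where M: "\<And>k. k < M \<Longrightarrow> fls_nth F k = 0" "\<And>k. k < M \<Longrightarrow> fls_nth G k = 0"
    "\<And>k. k < M \<Longrightarrow> fls_nth H k = 0"
    using that[of "min (min M1 M2) M3"] by auto
  let ?f = "fls_nth F" and ?g = "fls_nth G" and ?h = "fls_nth H"
  have T: "fls_nth (P * Q * R) N = (\<Sum>(k, l, j)\<in>triples M N. fls_nth P k * fls_nth Q l * fls_nth R j)"
    if "P \<in> {F, G, H}" "Q \<in> {F, G, H}" "R \<in> {F, G, H}" for P Q R
    by (rule fls_times_nth_triples) (use that M in auto)
  have eqs: "fls_nth (F * G * H) N = (\<Sum>(k, l, j)\<in>triples M N. ?f k * ?g l * ?h j)"
    "fls_nth (F * H * G) N = (\<Sum>(k, l, j)\<in>triples M N. ?f k * ?h j * ?g l)"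
    "fls_nth (H * F * G) N = (\<Sum>(k, l, j)\<in>triples M N. ?h j * ?f k * ?g l)"
    "fls_nth (G * F * H) N = (\<Sum>(k, l, j)\<in>triples M N. ?g l * ?f k * ?h j)"
    "fls_nth (G * H * F) N = (\<Sum>(k, l, j)\<in>triples M N. ?g l * ?h j * ?f k)"
    "fls_nth (H * G * F) N = (\<Sum>(k, l, j)\<in>triples M N. ?h j * ?g l * ?f k)"
    using T[of F G H] T[of F H G, unfolded triples_permute(2)[of "\<lambda>k l j. ?f k * ?h l * ?g j"]]
      T[of H F G, unfolded triples_permute(3)[of "\<lambda>k l j. ?h k * ?f l * ?g j"]]
      T[of G F H, unfolded triples_permute(1)[of "\<lambda>k l j. ?g k * ?f l * ?h j"]]
      T[of G H F, unfolded triples_permute(4)[of "\<lambda>k l j. ?g k * ?h l * ?f j"]]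
      T[of H G F, unfolded triples_permute(5)[of "\<lambda>k l j. ?h k * ?g l * ?f j"]]
    by simp_all
  have "fls_nth (F * G * H - d *\<^sub>C (F * H * G) + H * F * G + (G * F * H - d *\<^sub>C (G * H * F) + H * G * F)) N
      = (\<Sum>(k, l, j)\<in>triples M N. ?f k * ?g l * ?h j - d *\<^sub>C (?f k * ?h j * ?g l) + ?h j * ?f k * ?g l
        + (?g l * ?f k * ?h j - d *\<^sub>C (?g l * ?h j * ?f k) + ?h j * ?g l * ?f k))"
    by (simp add: eqs sum.distrib sum_subtractf cvec.scale_sum_right case_prod_unfold)
  also have "\<dots> = 0" by (simp only: assms) simp
  finally show "fls_nth (F * G * H - d *\<^sub>C (F * H * G) + H * F * G
      + (G * F * H - d *\<^sub>C (G * H * F) + H * G * F)) N = fls_nth 0 N" by simp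
qed

section \<open>Currents on a tensor product\<close>

text \<open>\<open>cur f g m\<close> is the coefficient of \<open>z^m\<close> in \<open>f(z) \<otimes> g(uz)\<close>, a Laurent series in \<open>u\<close>.\<close>

definition tame :: "(int \<Rightarrow> 'v::complex_vector endo) \<Rightarrow> (int \<Rightarrow> 'w::complex_vector endo) \<Rightarrow> bool" where
  "tame f g \<longleftrightarrow> (\<forall>m. \<exists>M. \<forall>N<M. f (m - N) = 0 \<or> g N = 0)"

definition cur :: "(int \<Rightarrow> 'v::complex_vector endo) \<Rightarrow> (int \<Rightarrow> 'w::complex_vector endo) \<Rightarrow> int
    \<Rightarrow> ('v, 'w) tensor endo fls" where
  "cur f g m = Abs_fls (\<lambda>N. tmap (f (m - N)) (g N))"

lemma cur_nth: "tame f g \<Longrightarrow> fls_nth (cur f g m) N = tmap (f (m - N)) (g N)"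
proof -
  assume "tame f g"
  then obtain M where M: "\<forall>N<M. f (m - N) = 0 \<or> g N = 0" unfolding tame_def by blast
  have "tmap (f (m - N)) (g N) = 0" if "N < M" for N
    using M that by (metis tmap_0)
  then have "\<forall>N<M. tmap (f (m - N)) (g N) = 0" by blast
  then show ?thesis unfolding cur_def by (rule nth_Abs_fls_lower_bound)
qed

lemma cur_quad_left:
  assumes "quad c f f'" "commuting g g'" "tame f g" "tame f' g'"
  shows "quad c (cur f g) (cur f' g')"
  unfolding quad_def
proof (intro allI fls_lift_quad)
  fix m r k l
  have g: "g' l * g k = g k * g' l" using assms(2) by (simp add: commuting_def)
  have f: "f (m - k) * f' (r - 1 - l) - c *\<^sub>C (f (m - 1 - k) * f' (r - l))
      = c *\<^sub>C (f' (r - 1 - l) * f (m - k)) - f' (r - l) * f (m - 1 - k)"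
    using assms(1)[unfolded quad_def, rule_format, of "m - k" "r - l"] by (simp add: algebra_simps)
  show "fls_nth (cur f g m) k * fls_nth (cur f' g' (r - 1)) l
      - c *\<^sub>C (fls_nth (cur f g (m - 1)) k * fls_nth (cur f' g' r) l)
      = c *\<^sub>C (fls_nth (cur f' g' (r - 1)) l * fls_nth (cur f g m) k)
      - fls_nth (cur f' g' r) l * fls_nth (cur f g (m - 1)) k"
    using arg_cong[OF f, of "\<lambda>h. tmap h (g k * g' l)"]
    by (simp add: cur_nth assms(3,4) g tmap_diff tmap_scale)
qed

lemma cur_quad_right:
  assumes "quad c g g'" "commuting f f'" "tame f g" "tame f' g'"
  shows "quad c (cur f g) (cur f' g')"
  unfolding quad_def
proof (intro allI)
  fix m r
  \<comment> \<open>A relation between g(uz) and g'(uw) shifts the exponents of u together with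
    those of z and w. Multiplying one factor by u and the other by u^-1 leaves their product
    unchanged and aligns the indices of the left tensor factors.\<close>
  define E where "E = fls_shift (-1) (cur f g (m - 1))"
  define E' where "E' = fls_shift 1 (cur f' g' r)"
  have E: "cur f g (m - 1) * cur f' g' r = E * E'" "cur f' g' r * cur f g (m - 1) = E' * E"
    by (simp_all add: E_def E'_def fls_shifted_times_simps)
  have Ek: "fls_nth E k = tmap (f (m - k)) (g (k - 1))" "fls_nth E' k = tmap (f' (r - 1 - k)) (g' (k + 1))" for k
    by (simp_all add: E_def E'_def cur_nth assms(3,4) algebra_simps)
  show "cur f g m * cur f' g' (r - 1) - c *\<^sub>C (cur f g (m - 1) * cur f' g' r)
      = c *\<^sub>C (cur f' g' (r - 1) * cur f g m) - cur f' g' r * cur f g (m - 1)"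
    unfolding E
  proof (rule fls_lift_quad)
    fix k l
    have f: "f' a * f b = f b * f' a" for a b using assms(2) by (simp add: commuting_def)
    have g: "g k * g' l - c *\<^sub>C (g (k - 1) * g' (l + 1)) = c *\<^sub>C (g' l * g k) - g' (l + 1) * g (k - 1)"
      using assms(1)[unfolded quad_def, rule_format, of k "l + 1"] by simp
    show "fls_nth (cur f g m) k * fls_nth (cur f' g' (r - 1)) l - c *\<^sub>C (fls_nth E k * fls_nth E' l)
      = c *\<^sub>C (fls_nth (cur f' g' (r - 1)) l * fls_nth (cur f g m) k) - fls_nth E' l * fls_nth E k"
      using arg_cong[OF g, of "tmap (f (m - k) * f' (r - 1 - l))"]
      by (simp add: cur_nth assms(3,4) Ek f tmap_diff tmap_scale)
  qed
qed

lemma cur_commuting: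
  assumes "commuting f f'" "commuting g g'" "tame f g" "tame f' g'"
  shows "commuting (cur f g) (cur f' g')"
  unfolding commuting_def
  using assms(1,2) by (intro allI fls_lift_commute) (simp add: cur_nth assms(3,4) commuting_def)

lemma cur_serre_left:
  assumes "serre_rel d f f'" "commuting g g" "commuting g g'" "tame f g" "tame f' g'"
  shows "serre_rel d (cur f g) (cur f' g')"
  unfolding serre_rel_def
proof (intro allI fls_lift_serre)
  fix m1 m2 r k l j
  have "g l * g k = g k * g l" "g' j * g k = g k * g' j" "g' j * g l = g l * g' j"
    using assms(2,3) by (simp_all add: commuting_def)
  then have g: "g k * g' j * g l = g k * g l * g' j" "g' j * g k * g l = g k * g l * g' j"
    "g l * g k * g' j = g k * g l * g' j" "g l * g' j * g k = g k * g l * g' j"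
    "g' j * g l * g k = g k * g l * g' j"
    by (metis mult.assoc)+
  show "fls_nth (cur f g m1) k * fls_nth (cur f g m2) l * fls_nth (cur f' g' r) j
      - d *\<^sub>C (fls_nth (cur f g m1) k * fls_nth (cur f' g' r) j * fls_nth (cur f g m2) l)
      + fls_nth (cur f' g' r) j * fls_nth (cur f g m1) k * fls_nth (cur f g m2) l
      + (fls_nth (cur f g m2) l * fls_nth (cur f g m1) k * fls_nth (cur f' g' r) j
      - d *\<^sub>C (fls_nth (cur f g m2) l * fls_nth (cur f' g' r) j * fls_nth (cur f g m1) k)
      + fls_nth (cur f' g' r) j * fls_nth (cur f g m2) l * fls_nth (cur f g m1) k) = 0"
    using arg_cong[OF assms(1)[unfolded serre_rel_def, rule_format, of "m1 - k" "m2 - l" "r - j"],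
        of "\<lambda>h. tmap h (g k * g l * g' j)"]
    by (simp add: cur_nth assms(4,5) g tmap_diff tmap_scale tmap_add)
qed

lemma cur_serre_right:
  assumes "serre_rel d g g'" "commuting f f" "commuting f f'" "tame f g" "tame f' g'"
  shows "serre_rel d (cur f g) (cur f' g')"
  unfolding serre_rel_def
proof (intro allI fls_lift_serre)
  fix m1 m2 r k l j
  let ?a = "f (m1 - k)" and ?b = "f (m2 - l)" and ?c = "f' (r - j)"
  have "?b * ?a = ?a * ?b" "?c * ?a = ?a * ?c" "?c * ?b = ?b * ?c"
    using assms(2,3) by (simp_all add: commuting_def)
  then have f: "?a * ?c * ?b = ?a * ?b * ?c" "?c * ?a * ?b = ?a * ?b * ?c"
    "?b * ?a * ?c = ?a * ?b * ?c" "?b * ?c * ?a = ?a * ?b * ?c" "?c * ?b * ?a = ?a * ?b * ?c"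
    by (metis mult.assoc)+
  show "fls_nth (cur f g m1) k * fls_nth (cur f g m2) l * fls_nth (cur f' g' r) j
      - d *\<^sub>C (fls_nth (cur f g m1) k * fls_nth (cur f' g' r) j * fls_nth (cur f g m2) l)
      + fls_nth (cur f' g' r) j * fls_nth (cur f g m1) k * fls_nth (cur f g m2) l
      + (fls_nth (cur f g m2) l * fls_nth (cur f g m1) k * fls_nth (cur f' g' r) j
      - d *\<^sub>C (fls_nth (cur f g m2) l * fls_nth (cur f' g' r) j * fls_nth (cur f g m1) k)
      + fls_nth (cur f' g' r) j * fls_nth (cur f g m2) l * fls_nth (cur f g m1) k) = 0"
    using arg_cong[OF assms(1)[unfolded serre_rel_def, rule_format, of k l j], of "tmap (?a * ?b * ?c)"]
    by (simp add: cur_nth assms(4,5) f tmap_diff tmap_scale tmap_add)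
qed

section \<open>Sums of two crossing families of currents\<close>

text \<open>Linear functionals reduce identities between words in noncommuting operators to
  identities between complex-valued functions of the mode indices, which commutative algebra can
  settle.\<close>

definition functional :: "('v::complex_vector \<Rightarrow> complex) \<Rightarrow> bool" where
  "functional l \<longleftrightarrow> (\<forall>x y. l (x + y) = l x + l y) \<and> (\<forall>c x. l (c *\<^sub>C x) = c * l x)"

lemma functional_add: "functional l \<Longrightarrow> l (x + y) = l x + l y"
  and functional_scale: "functional l \<Longrightarrow> l (c *\<^sub>C x) = c * l x"
  by (auto simp: functional_def)

lemma functional_diff: "functional l \<Longrightarrow> l (x - y) = l x - l y"
  using functional_add[of l "x - y" y] by simp

lemma functional_0: "functional l \<Longrightarrow> l 0 = 0"
  using functional_scale[of l 0 0] by simp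

lemma functionals_separate:
  assumes "\<And>l. functional l \<Longrightarrow> l x = 0"
  shows "x = 0"
proof (rule ccontr)
  assume "x \<noteq> 0"
  then have ind: "cvec.independent {x}" by simp
  define Bs where "Bs = cvec.extend_basis {x}"
  have Bs: "cvec.independent Bs" "cvec.span Bs = UNIV" "x \<in> Bs"
    using cvec.independent_extend_basis[OF ind] cvec.span_extend_basis[OF ind]
      cvec.extend_basis_superset[OF ind] by (auto simp: Bs_def)
  have "functional (\<lambda>y. cvec.representation Bs y x)"
    unfolding functional_def using Bs
    by (simp add: cvec.representation_add cvec.representation_scale)
  then have "cvec.representation Bs x x = 0" by (rule assms)
  then show False using Bs by (simp add: cvec.representation_basis)
qed

lemma fls_endo_eq_0I:
  assumes "\<And>l N. functional l \<Longrightarrow> l (fls_nth F N) = 0"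
  shows "F = (0 :: 'v::complex_vector endo fls)"
proof (rule fls_eqI)
  fix N
  have "fls_nth F N = 0" by (rule functionals_separate) (rule assms)
  then show "fls_nth F N = fls_nth 0 N" by simp
qed

lemmas functional_simps = functional_add functional_diff functional_scale functional_0

text \<open>The two summands of a coproduct current as series in u: A has no negative powers, and B
  m starts at u^m, since its left factor has modes of index at most 0 only. Hence a fixed
  coefficient of a word vanishes once the indices of B are large.\<close>

locale crossing =
  fixes A B :: "int \<Rightarrow> 'v::complex_vector endo fls"
  assumes A_below: "\<And>m N. N < 0 \<Longrightarrow> fls_nth (A m) N = 0"
    and B_below: "\<And>m N. N < m \<Longrightarrow> fls_nth (B m) N = 0"

lemma triple_below:
  fixes F G H :: "'v::complex_vector endo fls"
  assumes "\<And>N. N < a \<Longrightarrow> fls_nth F N = 0" "\<And>N. N < b \<Longrightarrow> fls_nth G N = 0"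
    "\<And>N. N < c \<Longrightarrow> fls_nth H N = 0" "N < a + b + c"
  shows "fls_nth (F * G * H) N = 0"
  by (rule fls_times_below[of "a + b" "F * G" c H]) (use assms fls_times_below[of a F b G] in auto)

text \<open>The Serre expression is additive in each current and symmetric in the two equal ones. Of
  its eight parts two are pure; the other six reduce by symmetry to AAB, BBA, BAA and BAB, which
  follow from quadratic relations alone.\<close>

theorem serre_coproduct:
  fixes A B A' B' :: "int \<Rightarrow> 'v::complex_vector endo fls" and c d k :: complex
  assumes "crossing A B" "crossing A' B'"
    and c: "c \<noteq> 0" and d: "d * c = c * c + 1" and k: "k * c * c = 1"
    and quads: "quad k A A" "quad c A A'" "quad k B B" "quad c B B'" "quad k B A" "quad c B A'" "quad c B' A"
    and serre: "serre_rel d A A'" "serre_rel d B B'"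
  shows "serre_rel d (\<lambda>m. A m + B m) (\<lambda>m. A' m + B' m)"
  unfolding serre_rel_def
proof (intro allI)
  interpret X: crossing A B by fact
  interpret Y: crossing A' B' by fact
  fix m1 m2 r
  have quadL: "l (fls_nth (F m * F' (r - 1) * Q) N) - e * l (fls_nth (F (m - 1) * F' r * Q) N)
      = e * l (fls_nth (F' (r - 1) * F m * Q) N) - l (fls_nth (F' r * F (m - 1) * Q) N)"
    if "quad e F F'" "functional l" for e F F' l N m r and Q :: "'v endo fls"
  proof -
    have "(F m * F' (r - 1) - e *\<^sub>C (F (m - 1) * F' r)) * Q
        = (e *\<^sub>C (F' (r - 1) * F m) - F' r * F (m - 1)) * Q"
      using that(1) unfolding quad_def by simp
    then have "l (fls_nth ((F m * F' (r - 1) - e *\<^sub>C (F (m - 1) * F' r)) * Q) N)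
        = l (fls_nth ((e *\<^sub>C (F' (r - 1) * F m) - F' r * F (m - 1)) * Q) N)" by simp
    then show ?thesis by (simp add: left_diff_distrib functional_simps[OF that(2)])
  qed
  have quadR: "l (fls_nth (P * F m * F' (r - 1)) N) - e * l (fls_nth (P * F (m - 1) * F' r) N)
      = e * l (fls_nth (P * F' (r - 1) * F m) N) - l (fls_nth (P * F' r * F (m - 1)) N)"
    if "quad e F F'" "functional l" for e F F' l N m r and P :: "'v endo fls"
  proof -
    have "P * (F m * F' (r - 1) - e *\<^sub>C (F (m - 1) * F' r))
        = P * (e *\<^sub>C (F' (r - 1) * F m) - F' r * F (m - 1))"
      using that(1) unfolding quad_def by simp
    then have "l (fls_nth (P * (F m * F' (r - 1) - e *\<^sub>C (F (m - 1) * F' r))) N)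
        = l (fls_nth (P * (e *\<^sub>C (F' (r - 1) * F m) - F' r * F (m - 1))) N)" by simp
    then show ?thesis by (simp add: right_diff_distrib functional_simps[OF that(2)] mult.assoc)
  qed
  note below = X.A_below X.B_below Y.A_below Y.B_below
  have AAB: "A m1 * A m2 * B' r - d *\<^sub>C (A m1 * B' r * A m2) + B' r * A m1 * A m2
      + (A m2 * A m1 * B' r - d *\<^sub>C (A m2 * B' r * A m1) + B' r * A m2 * A m1) = 0" for m1 m2 r
  proof (rule fls_endo_eq_0I)
    fix l :: "'v endo \<Rightarrow> complex" and N assume l: "functional l"
    define t1 where "t1 m1 m2 r = l (fls_nth (A m1 * A m2 * B' r) N)" for m1 m2 r
    define t2 where "t2 m1 m2 r = l (fls_nth (A m1 * B' r * A m2) N)" for m1 m2 r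
    define t3 where "t3 m1 m2 r = l (fls_nth (B' r * A m1 * A m2) N)" for m1 m2 r
    have "t1 m1 m2 r - d * t2 m1 m2 r + t3 m1 m2 r + (t1 m2 m1 r - d * t2 m2 m1 r + t3 m2 m1 r) = 0"
    proof (rule serre_AAB[OF c d k])
      show "t2 m1 (m2 - 1) r - c * t2 m1 m2 (r - 1) = c * t1 m1 (m2 - 1) r - t1 m1 m2 (r - 1)" for m1 m2 r
        unfolding t1_def t2_def using quadR[OF quads(7) l, of "A m1" r m2] by simp
      show "t3 (m1 - 1) m2 r - c * t3 m1 m2 (r - 1) = c * t2 (m1 - 1) m2 r - t2 m1 m2 (r - 1)" for m1 m2 r
        unfolding t3_def t2_def using quadL[OF quads(7) l, of r m1 "A m2"] by simp
      show "t1 m1 (m2 - 1) r - k * t1 (m1 - 1) m2 r = k * t1 (m2 - 1) m1 r - t1 m2 (m1 - 1) r" for m1 m2 r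
        unfolding t1_def using quadL[OF quads(1) l, of m1 m2 "B' r"] by simp
      have "t1 m1 m2 r = 0 \<and> t2 m1 m2 r = 0 \<and> t3 m1 m2 r = 0" if "r > N" for m1 m2 r
        using triple_below[of 0 "A m1" 0 "A m2" r "B' r" N] triple_below[of 0 "A m1" r "B' r" 0 "A m2" N]
          triple_below[of r "B' r" 0 "A m1" 0 "A m2" N] below that
        by (simp add: t1_def t2_def t3_def functional_0[OF l])
      then show "\<exists>R. \<forall>r>R. \<forall>m1 m2. t1 m1 m2 r = 0 \<and> t2 m1 m2 r = 0 \<and> t3 m1 m2 r = 0" by blast
    qed
    then show "l (fls_nth (A m1 * A m2 * B' r - d *\<^sub>C (A m1 * B' r * A m2) + B' r * A m1 * A m2
      + (A m2 * A m1 * B' r - d *\<^sub>C (A m2 * B' r * A m1) + B' r * A m2 * A m1)) N) = 0"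
      by (simp add: functional_simps[OF l] t1_def t2_def t3_def)
  qed
  have BBA: "B m1 * B m2 * A' r - d *\<^sub>C (B m1 * A' r * B m2) + A' r * B m1 * B m2
      + (B m2 * B m1 * A' r - d *\<^sub>C (B m2 * A' r * B m1) + A' r * B m2 * B m1) = 0" for m1 m2 r
  proof (rule fls_endo_eq_0I)
    fix l :: "'v endo \<Rightarrow> complex" and N assume l: "functional l"
    define t1 where "t1 m1 m2 r = l (fls_nth (A' r * B m1 * B m2) N)" for m1 m2 r
    define t2 where "t2 m1 m2 r = l (fls_nth (B m1 * A' r * B m2) N)" for m1 m2 r
    define t3 where "t3 m1 m2 r = l (fls_nth (B m1 * B m2 * A' r) N)" for m1 m2 r
    have "t3 m1 m2 r - d * t2 m1 m2 r + t1 m1 m2 r + (t3 m2 m1 r - d * t2 m2 m1 r + t1 m2 m1 r) = 0"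
    proof (rule serre_BBA[OF c d k])
      show "t2 m1 m2 (r - 1) - c * t2 (m1 - 1) m2 r = c * t1 m1 m2 (r - 1) - t1 (m1 - 1) m2 r" for m1 m2 r
        unfolding t1_def t2_def using quadL[OF quads(6) l, of m1 r "B m2"] by simp
      show "t3 m1 m2 (r - 1) - c * t3 m1 (m2 - 1) r = c * t2 m1 m2 (r - 1) - t2 m1 (m2 - 1) r" for m1 m2 r
        unfolding t3_def t2_def using quadR[OF quads(6) l, of "B m1" m2 r] by simp
      show "t1 m1 (m2 - 1) r - k * t1 (m1 - 1) m2 r = k * t1 (m2 - 1) m1 r - t1 m2 (m1 - 1) r" for m1 m2 r
        unfolding t1_def using quadR[OF quads(3) l, of "A' r" m1 m2] by simp
      fix m2
      have "t1 m1 m2 r = 0 \<and> t2 m1 m2 r = 0 \<and> t3 m1 m2 r = 0" if "m1 + m2 > N" for m1 m2 r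
        using triple_below[of 0 "A' r" m1 "B m1" m2 "B m2" N] triple_below[of m1 "B m1" 0 "A' r" m2 "B m2" N]
          triple_below[of m1 "B m1" m2 "B m2" 0 "A' r" N] below that
        by (simp add: t1_def t2_def t3_def functional_0[OF l])
      then show "\<exists>M. \<forall>m1>M. \<forall>r. t1 m1 m2 r = 0 \<and> t2 m1 m2 r = 0 \<and> t3 m1 m2 r = 0
          \<and> t1 m2 m1 r = 0 \<and> t2 m2 m1 r = 0 \<and> t3 m2 m1 r = 0"
        by (intro exI[of _ "N - m2"]) (simp add: algebra_simps)
    qed
    then show "l (fls_nth (B m1 * B m2 * A' r - d *\<^sub>C (B m1 * A' r * B m2) + A' r * B m1 * B m2
      + (B m2 * B m1 * A' r - d *\<^sub>C (B m2 * A' r * B m1) + A' r * B m2 * B m1)) N) = 0"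
      by (simp add: functional_simps[OF l] t1_def t2_def t3_def)
  qed
  have BAA: "B m1 * A m2 * A' r - d *\<^sub>C (B m1 * A' r * A m2) + A' r * B m1 * A m2
      + (A m2 * B m1 * A' r - d *\<^sub>C (A m2 * A' r * B m1) + A' r * A m2 * B m1) = 0" for m1 m2 r
  proof (rule fls_endo_eq_0I)
    fix l :: "'v endo \<Rightarrow> complex" and N assume l: "functional l"
    define a1 where "a1 m1 m2 r = l (fls_nth (B m1 * A m2 * A' r) N)" for m1 m2 r
    define a2 where "a2 m1 m2 r = l (fls_nth (B m1 * A' r * A m2) N)" for m1 m2 r
    define a3 where "a3 m1 m2 r = l (fls_nth (A' r * B m1 * A m2) N)" for m1 m2 r
    define a4 where "a4 m1 m2 r = l (fls_nth (A m2 * B m1 * A' r) N)" for m1 m2 r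
    define u where "u m1 m2 r = l (fls_nth (A m2 * A' r * B m1) N)" for m1 m2 r
    define v where "v m1 m2 r = l (fls_nth (A' r * A m2 * B m1) N)" for m1 m2 r
    note defs = a1_def a2_def a3_def a4_def u_def v_def
    have "a1 m1 m2 r - d * a2 m1 m2 r + a3 m1 m2 r + (a4 m1 m2 r - d * u m1 m2 r + v m1 m2 r) = 0"
    proof (rule serre_BAA[OF c d k])
      show "a1 m1 (m2 - 1) r - k * a1 (m1 - 1) m2 r = k * a4 m1 (m2 - 1) r - a4 (m1 - 1) m2 r" for m1 m2 r
        unfolding defs using quadL[OF quads(5) l, of m1 m2 "A' r"] by simp
      show "a4 m1 m2 (r - 1) - c * a4 (m1 - 1) m2 r = c * u m1 m2 (r - 1) - u (m1 - 1) m2 r" for m1 m2 r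
        unfolding defs using quadR[OF quads(6) l, of "A m2" m1 r] by simp
      show "a2 m1 m2 (r - 1) - c * a2 (m1 - 1) m2 r = c * a3 m1 m2 (r - 1) - a3 (m1 - 1) m2 r" for m1 m2 r
        unfolding defs using quadL[OF quads(6) l, of m1 r "A m2"] by simp
      show "a3 m1 (m2 - 1) r - k * a3 (m1 - 1) m2 r = k * v m1 (m2 - 1) r - v (m1 - 1) m2 r" for m1 m2 r
        unfolding defs using quadR[OF quads(5) l, of "A' r" m1 m2] by simp
      show "u m1 m2 (r - 1) - c * u m1 (m2 - 1) r = c * v m1 m2 (r - 1) - v m1 (m2 - 1) r" for m1 m2 r
        unfolding defs using quadL[OF quads(2) l, of m2 r "B m1"] by simp
      have "a1 m1 m2 r = 0 \<and> a2 m1 m2 r = 0 \<and> a3 m1 m2 r = 0 \<and> a4 m1 m2 r = 0 \<and> u m1 m2 r = 0 \<and> v m1 m2 r = 0"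
        if "m1 > N" for m1 m2 r
        using triple_below[of m1 "B m1" 0 "A m2" 0 "A' r" N] triple_below[of m1 "B m1" 0 "A' r" 0 "A m2" N]
          triple_below[of 0 "A' r" m1 "B m1" 0 "A m2" N] triple_below[of 0 "A m2" m1 "B m1" 0 "A' r" N]
          triple_below[of 0 "A m2" 0 "A' r" m1 "B m1" N] triple_below[of 0 "A' r" 0 "A m2" m1 "B m1" N] below that
        by (simp add: defs functional_0[OF l])
      then show "\<exists>M. \<forall>m1>M. \<forall>m2 r. a1 m1 m2 r = 0 \<and> a2 m1 m2 r = 0 \<and> a3 m1 m2 r = 0 \<and> a4 m1 m2 r = 0
          \<and> u m1 m2 r = 0 \<and> v m1 m2 r = 0" by blast
    qed
    then show "l (fls_nth (B m1 * A m2 * A' r - d *\<^sub>C (B m1 * A' r * A m2) + A' r * B m1 * A m2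
      + (A m2 * B m1 * A' r - d *\<^sub>C (A m2 * A' r * B m1) + A' r * A m2 * B m1)) N) = 0"
      by (simp add: functional_simps[OF l] defs)
  qed
  have BAB: "B m1 * A m2 * B' r - d *\<^sub>C (B m1 * B' r * A m2) + B' r * B m1 * A m2
      + (A m2 * B m1 * B' r - d *\<^sub>C (A m2 * B' r * B m1) + B' r * A m2 * B m1) = 0" for m1 m2 r
  proof (rule fls_endo_eq_0I)
    fix l :: "'v endo \<Rightarrow> complex" and N assume l: "functional l"
    define b1 where "b1 m1 m2 r = l (fls_nth (B m1 * A m2 * B' r) N)" for m1 m2 r
    define b2 where "b2 m1 m2 r = l (fls_nth (B m1 * B' r * A m2) N)" for m1 m2 r
    define b3 where "b3 m1 m2 r = l (fls_nth (B' r * B m1 * A m2) N)" for m1 m2 r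
    define b6 where "b6 m1 m2 r = l (fls_nth (B' r * A m2 * B m1) N)" for m1 m2 r
    define u where "u m1 m2 r = l (fls_nth (A m2 * B m1 * B' r) N)" for m1 m2 r
    define v where "v m1 m2 r = l (fls_nth (A m2 * B' r * B m1) N)" for m1 m2 r
    note defs = b1_def b2_def b3_def b6_def u_def v_def
    have "b1 m1 m2 r - d * b2 m1 m2 r + b3 m1 m2 r + (u m1 m2 r - d * v m1 m2 r + b6 m1 m2 r) = 0"
    proof (rule serre_BAB[OF c d k])
      show "b1 m1 (m2 - 1) r - k * b1 (m1 - 1) m2 r = k * u m1 (m2 - 1) r - u (m1 - 1) m2 r" for m1 m2 r
        unfolding defs using quadL[OF quads(5) l, of m1 m2 "B' r"] by simp
      show "b2 m1 (m2 - 1) r - c * b2 m1 m2 (r - 1) = c * b1 m1 (m2 - 1) r - b1 m1 m2 (r - 1)" for m1 m2 r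
        unfolding defs using quadR[OF quads(7) l, of "B m1" r m2] by simp
      show "b3 m1 (m2 - 1) r - k * b3 (m1 - 1) m2 r = k * b6 m1 (m2 - 1) r - b6 (m1 - 1) m2 r" for m1 m2 r
        unfolding defs using quadR[OF quads(5) l, of "B' r" m1 m2] by simp
      show "b6 m1 (m2 - 1) r - c * b6 m1 m2 (r - 1) = c * v m1 (m2 - 1) r - v m1 m2 (r - 1)" for m1 m2 r
        unfolding defs using quadL[OF quads(7) l, of r m2 "B m1"] by simp
      show "u m1 m2 (r - 1) - c * u (m1 - 1) m2 r = c * v m1 m2 (r - 1) - v (m1 - 1) m2 r" for m1 m2 r
        unfolding defs using quadR[OF quads(4) l, of "A m2" m1 r] by simp
      have zero: "b1 m1 m2 r = 0 \<and> b2 m1 m2 r = 0 \<and> b3 m1 m2 r = 0 \<and> b6 m1 m2 r = 0 \<and> u m1 m2 r = 0 \<and> v m1 m2 r = 0"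
        if "m1 + r > N" for m1 m2 r
        using triple_below[of m1 "B m1" 0 "A m2" r "B' r" N] triple_below[of m1 "B m1" r "B' r" 0 "A m2" N]
          triple_below[of r "B' r" m1 "B m1" 0 "A m2" N] triple_below[of r "B' r" 0 "A m2" m1 "B m1" N]
          triple_below[of 0 "A m2" m1 "B m1" r "B' r" N] triple_below[of 0 "A m2" r "B' r" m1 "B m1" N] below that
        by (simp add: defs functional_0[OF l] add.commute)
      show "\<exists>M. \<forall>m1>M. \<forall>m2. b1 m1 m2 r = 0 \<and> b2 m1 m2 r = 0 \<and> b3 m1 m2 r = 0 \<and> b6 m1 m2 r = 0
          \<and> u m1 m2 r = 0 \<and> v m1 m2 r = 0" for r
        using zero by (intro exI[of _ "N - r"]) (simp add: algebra_simps)
      show "\<exists>R. \<forall>r>R. \<forall>m2. b1 m1 m2 r = 0 \<and> b2 m1 m2 r = 0 \<and> b3 m1 m2 r = 0 \<and> b6 m1 m2 r = 0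
          \<and> u m1 m2 r = 0 \<and> v m1 m2 r = 0" for m1
        using zero by (intro exI[of _ "N - m1"]) (simp add: algebra_simps)
    qed
    then show "l (fls_nth (B m1 * A m2 * B' r - d *\<^sub>C (B m1 * B' r * A m2) + B' r * B m1 * A m2
      + (A m2 * B m1 * B' r - d *\<^sub>C (A m2 * B' r * B m1) + B' r * A m2 * B m1)) N) = 0"
      by (simp add: functional_simps[OF l] defs)
  qed
  define S where "S F G H = F * G * H - d *\<^sub>C (F * H * G) + H * F * G + (G * F * H - d *\<^sub>C (G * H * F) + H * G * F)"
    for F G H :: "'v endo fls"
  have S_add: "S (F + F') G H = S F G H + S F' G H" "S F (G + G') H = S F G H + S F G' H"
    "S F G (H + H') = S F G H + S F G H'" for F F' G G' H H'
    by (simp_all add: S_def distrib_left distrib_right scaleC_add_right)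
  have S_sym: "S F G H = S G F H" for F G H by (simp add: S_def add.commute)
  have zero: "S (A m1) (A m2) (A' r) = 0" "S (B m1) (B m2) (B' r) = 0"
    using serre unfolding serre_rel_def S_def by blast+
  have mixed: "S (A m1) (A m2) (B' r) = 0" "S (B m1) (B m2) (A' r) = 0"
    "S (B m) (A m') (A' r) = 0" "S (B m) (A m') (B' r) = 0" for m m'
    using AAB BBA BAA BAB unfolding S_def by blast+
  have "S (A m1 + B m1) (A m2 + B m2) (A' r + B' r) = 0"
    unfolding S_add zero mixed S_sym[of "A m1" "B m2"] by simp
  then show "(A m1 + B m1) * (A m2 + B m2) * (A' r + B' r)
      - d *\<^sub>C ((A m1 + B m1) * (A' r + B' r) * (A m2 + B m2)) + (A' r + B' r) * (A m1 + B m1) * (A m2 + B m2)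
      + ((A m2 + B m2) * (A m1 + B m1) * (A' r + B' r)
      - d *\<^sub>C ((A m2 + B m2) * (A' r + B' r) * (A m1 + B m1)) + (A' r + B' r) * (A m2 + B m2) * (A m1 + B m1)) = 0"
    by (simp only: S_def)
qed

text \<open>A factor w - c z may be cancelled since both sides start at order m in u, so that each
  coefficient of their difference vanishes for large m.\<close>

lemma one_sided_eq:
  fixes F G :: "int \<Rightarrow> int \<Rightarrow> 'v::complex_vector endo fls"
  assumes "\<And>m r. F m (r - 1) - c *\<^sub>C F (m - 1) r = G m (r - 1) - c *\<^sub>C G (m - 1) r" "c \<noteq> 0"
    and "\<And>m r N. N < m \<Longrightarrow> fls_nth (F m r) N = 0" "\<And>m r N. N < m \<Longrightarrow> fls_nth (G m r) N = 0"
  shows "F m r = G m r"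
proof -
  have "F m r - G m r = 0"
  proof (rule fls_endo_eq_0I)
    fix l :: "'v endo \<Rightarrow> complex" and N assume l: "functional l"
    define D where "D m r = l (fls_nth (F m r - G m r) N)" for m r
    have "D (m - 1) r = inverse c * D m (r - 1)" for m r
    proof -
      have "F m (r - 1) - G m (r - 1) = c *\<^sub>C (F (m - 1) r - G (m - 1) r)"
        using assms(1)[of m r] by (simp add: cvec.scale_right_diff_distrib algebra_simps)
      then have "D m (r - 1) = c * D (m - 1) r"
        by (simp add: D_def functional_scale[OF l])
      then show ?thesis using assms(2) by simp
    qed
    moreover have "\<exists>M. \<forall>m>M. \<forall>r. D m r = 0"
      using assms(3,4) by (intro exI[of _ N]) (simp add: D_def functional_0[OF l])
    ultimately have "D m r = 0" by (rule one_sided_zero)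
    then show "l (fls_nth (F m r - G m r) N) = 0" by (simp add: D_def)
  qed
  then show ?thesis by simp
qed

text \<open>Between B and A' only (w - z)[B(z), A'(w)] = 0 is available. A multiple of a delta
  function could survive in the commutator, but the lower bound on the order in u excludes
  it.\<close>

lemma commuting_coproduct:
  fixes A B A' B' :: "int \<Rightarrow> 'v::complex_vector endo fls"
  assumes "crossing A B" "crossing A' B'"
    and "commuting A A'" "commuting B B'" "quad 1 B A'" "quad 1 B' A"
  shows "commuting (\<lambda>m. A m + B m) (\<lambda>m. A' m + B' m)"
proof -
  have BA: "B m * A' r = A' r * B m" if "quad 1 B A'" "crossing A B" "crossing A' B'"
    for A B A' B' :: "int \<Rightarrow> 'v endo fls" and m r
  proof (rule one_sided_eq[where F = "\<lambda>m r. B m * A' r" and G = "\<lambda>m r. A' r * B m" and c = 1])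
    show "B m * A' (r - 1) - 1 *\<^sub>C (B (m - 1) * A' r) = A' (r - 1) * B m - 1 *\<^sub>C (A' r * B (m - 1))" for m r
      using that(1) unfolding quad_def by (simp add: scaleC_one)
    show "fls_nth (B m * A' r) N = 0" "fls_nth (A' r * B m) N = 0" if "N < m" for m r N
      using fls_times_below[of m "B m" 0 "A' r" N] fls_times_below[of 0 "A' r" m "B m" N] that
        crossing.B_below[OF \<open>crossing A B\<close>] crossing.A_below[OF \<open>crossing A' B'\<close>] by auto
  qed simp
  show ?thesis
    using assms(3,4) BA[OF assms(5,1,2)] BA[OF assms(6,2,1)] unfolding commuting_def
    by (simp add: distrib_left distrib_right add_ac)
qed

section \<open>Evaluation of rational series at \<open>u = 1\<close>\<close>

text \<open>The value at u = 1 of the Laurent polynomial with coefficients S. As T multiplies by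
  u^-1, \<open>act p\<close> multiplies this value by p(1).\<close>

definition has_fsum :: "(int \<Rightarrow> 'x::complex_vector) \<Rightarrow> 'x \<Rightarrow> bool" where
  "has_fsum S y \<longleftrightarrow> (\<exists>K. finite K \<and> (\<forall>r. r \<notin> K \<longrightarrow> S r = 0) \<and> sum S K = y)"

lemma has_fsumI: "finite K \<Longrightarrow> (\<And>r. r \<notin> K \<Longrightarrow> S r = 0) \<Longrightarrow> has_fsum S (sum S K)"
  unfolding has_fsum_def by blast

lemma has_fsum_unique: "has_fsum S y \<Longrightarrow> has_fsum S y' \<Longrightarrow> y = y'"
proof -
  assume "has_fsum S y" "has_fsum S y'"
  then obtain K K' where K: "finite K" "\<And>r. r \<notin> K \<Longrightarrow> S r = 0" "sum S K = y"
    and K': "finite K'" "\<And>r. r \<notin> K' \<Longrightarrow> S r = 0" "sum S K' = y'"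
    unfolding has_fsum_def by blast
  have "sum S K = sum S (K \<union> K')" "sum S K' = sum S (K \<union> K')"
    using K K' by (auto intro!: sum.mono_neutral_left)
  then show ?thesis using K K' by simp
qed

lemma has_fsum_add:
  assumes "has_fsum S y" "has_fsum S' y'"
  shows "has_fsum (\<lambda>r. S r + S' r) (y + y')"
proof -
  obtain K K' where K: "finite K" "\<And>r. r \<notin> K \<Longrightarrow> S r = 0" "sum S K = y"
    and K': "finite K'" "\<And>r. r \<notin> K' \<Longrightarrow> S' r = 0" "sum S' K' = y'"
    using assms unfolding has_fsum_def by blast
  have "sum S K = sum S (K \<union> K')" "sum S' K' = sum S' (K \<union> K')"
    using K K' by (auto intro!: sum.mono_neutral_left)
  then have "(\<Sum>r\<in>K \<union> K'. S r + S' r) = y + y'" using K K' by (simp add: sum.distrib)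
  then show ?thesis
    unfolding has_fsum_def using K K' by (intro exI[of _ "K \<union> K'"]) auto
qed

lemma has_fsum_linear: "has_fsum S y \<Longrightarrow> clinear f \<Longrightarrow> has_fsum (\<lambda>r. f (S r)) (f y)"
  unfolding has_fsum_def by (metis clinear_sum clinear_zero)

lemma has_fsum_scale: "has_fsum S y \<Longrightarrow> has_fsum (\<lambda>r. c *\<^sub>C S r) (c *\<^sub>C y)"
  by (rule has_fsum_linear[OF _ clinear_scaleC])

lemma has_fsum_zero [simp]: "has_fsum (\<lambda>r. 0) 0"
  unfolding has_fsum_def by (intro exI[of _ "{}"]) simp

lemma has_fsum_shift: "has_fsum S y \<Longrightarrow> has_fsum (\<lambda>r. S (r + m)) y"
  unfolding has_fsum_def
proof (elim exE conjE)
  fix K assume K: "finite K" "\<forall>r. r \<notin> K \<longrightarrow> S r = 0" "sum S K = y"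
  have "(\<Sum>r\<in>(\<lambda>r. r - m) ` K. S (r + m)) = y"
    using K(3) by (subst sum.reindex) (auto simp: inj_on_def)
  moreover have "S (r + m) = 0" if "r \<notin> (\<lambda>r. r - m) ` K" for r
    using K(2) that by (metis add_diff_cancel_right' image_eqI)
  ultimately show "\<exists>K. finite K \<and> (\<forall>r. r \<notin> K \<longrightarrow> S (r + m) = 0) \<and> (\<Sum>r\<in>K. S (r + m)) = y"
    using K(1) by (intro exI[of _ "(\<lambda>r. r - m) ` K"]) blast
qed

lemma has_fsum_act: "has_fsum S y \<Longrightarrow> has_fsum (act p S) (poly p 1 *\<^sub>C y)"
proof (induction p)
  case (pCons c p)
  have "has_fsum (\<lambda>r. c *\<^sub>C S r + act p S (r + 1)) (c *\<^sub>C y + poly p 1 *\<^sub>C y)"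
    using pCons by (intro has_fsum_add has_fsum_scale has_fsum_shift[where S = "act p S"]) auto
  then show ?case by (simp add: act_pCons[abs_def] scaleC_add_left)
qed simp

text \<open>\<open>reg S y\<close>: the series \<open>\<Sum>S\<^sub>ku^k\<close> is the expansion of a rational function with the value \<open>y\<close>
  at \<open>u = 1\<close>. Multiplication with \<open>Q(u\<^sup>-\<^sup>1)\<close> is \<open>act Q\<close>.\<close>

definition reg :: "(int \<Rightarrow> 'x::complex_vector) \<Rightarrow> 'x \<Rightarrow> bool" where
  "reg S y \<longleftrightarrow> (\<exists>L. \<forall>k<L. S k = 0) \<and> (\<exists>Q. poly Q 1 \<noteq> 0 \<and> has_fsum (act Q S) (poly Q 1 *\<^sub>C y))"

lemma reg_unique: "reg S y \<Longrightarrow> reg S y' \<Longrightarrow> y = y'"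
proof -
  assume "reg S y" "reg S y'"
  then obtain Q Q' where Q: "poly Q 1 \<noteq> 0" "has_fsum (act Q S) (poly Q 1 *\<^sub>C y)"
    and Q': "poly Q' 1 \<noteq> 0" "has_fsum (act Q' S) (poly Q' 1 *\<^sub>C y')"
    unfolding reg_def by blast
  have "has_fsum (act Q' (act Q S)) (poly Q' 1 *\<^sub>C poly Q 1 *\<^sub>C y)"
    by (rule has_fsum_act[OF Q(2)])
  moreover have "has_fsum (act Q' (act Q S)) (poly Q 1 *\<^sub>C poly Q' 1 *\<^sub>C y')"
    unfolding act_comm[of Q'] by (rule has_fsum_act[OF Q'(2)])
  ultimately have "poly Q' 1 *\<^sub>C poly Q 1 *\<^sub>C y = poly Q' 1 *\<^sub>C poly Q 1 *\<^sub>C y'"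
    using has_fsum_unique by (metis scaleC_scaleC mult.commute)
  then show ?thesis using Q Q' by (simp add: scaleC_scaleC cvec.scale_cancel_left)
qed

lemma reg_add:
  assumes "reg S y" "reg S' y'"
  shows "reg (\<lambda>r. S r + S' r) (y + y')"
proof -
  obtain L L' Q Q' where L: "\<forall>k<L. S k = 0" "\<forall>k<L'. S' k = 0"
    and Q: "poly Q 1 \<noteq> 0" "has_fsum (act Q S) (poly Q 1 *\<^sub>C y)"
    and Q': "poly Q' 1 \<noteq> 0" "has_fsum (act Q' S') (poly Q' 1 *\<^sub>C y')"
    using assms unfolding reg_def by blast
  have "has_fsum (\<lambda>r. act Q' (act Q S) r + act Q (act Q' S') r)
      (poly Q' 1 *\<^sub>C poly Q 1 *\<^sub>C y + poly Q 1 *\<^sub>C poly Q' 1 *\<^sub>C y')"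
    by (intro has_fsum_add has_fsum_act Q Q')
  also have "(\<lambda>r. act Q' (act Q S) r + act Q (act Q' S') r) = act (Q * Q') (\<lambda>r. S r + S' r)"
    unfolding act_seq_add unfolding act_mult act_comm[of Q' Q] ..
  finally have "has_fsum (act (Q * Q') (\<lambda>r. S r + S' r)) (poly (Q * Q') 1 *\<^sub>C (y + y'))"
    by (simp add: scaleC_scaleC scaleC_add_right mult.commute)
  moreover have "\<forall>k<min L L'. S k + S' k = 0" using L by simp
  ultimately show ?thesis
    unfolding reg_def using Q(1) Q'(1) by (metis mult_eq_0_iff poly_mult)
qed

lemma reg_linear:
  assumes "reg S y" "clinear f"
  shows "reg (\<lambda>r. f (S r)) (f y)"
proof -
  obtain L Q where L: "\<forall>k<L. S k = 0" and Q: "poly Q 1 \<noteq> 0" "has_fsum (act Q S) (poly Q 1 *\<^sub>C y)"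
    using assms(1) unfolding reg_def by blast
  have "has_fsum (act Q (\<lambda>r. f (S r))) (poly Q 1 *\<^sub>C f y)"
    using has_fsum_linear[OF Q(2) assms(2)] by (simp add: act_linear[OF assms(2)] clinear_scale[OF assms(2)])
  moreover have "\<forall>k<L. f (S k) = 0" using L by (simp add: clinear_zero[OF assms(2)])
  ultimately show ?thesis unfolding reg_def using Q(1) by blast
qed

lemma reg_scale: "reg S y \<Longrightarrow> reg (\<lambda>r. c *\<^sub>C S r) (c *\<^sub>C y)"
  by (rule reg_linear[OF _ clinear_scaleC])

lemma reg_diff: "reg S y \<Longrightarrow> reg S' y' \<Longrightarrow> reg (\<lambda>r. S r - S' r) (y - y')"
  using reg_add[of S y "\<lambda>r. (-1) *\<^sub>C S' r" "(-1) *\<^sub>C y'"] reg_scale[of S' y' "-1"] by (simp add: scaleC_one)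

lemma reg_fsum:
  assumes "has_fsum S y"
  shows "reg S y"
proof -
  obtain K where K: "finite K" "\<And>r. r \<notin> K \<Longrightarrow> S r = 0" using assms unfolding has_fsum_def by blast
  have "S k = 0" if "k < Min (insert 0 K)" for k
  proof (rule K(2))
    show "k \<notin> K" using that K(1) by auto
  qed
  moreover have "has_fsum (act 1 S) (poly 1 1 *\<^sub>C y)" using assms by (simp add: scaleC_one)
  ultimately show ?thesis unfolding reg_def by (metis poly_1 zero_neq_one)
qed

lemma reg_zero: "reg (\<lambda>r. 0) 0" by (simp add: reg_fsum)

lemma reg_sum: "finite K \<Longrightarrow> (\<And>k. k \<in> K \<Longrightarrow> reg (S k) (y k)) \<Longrightarrow> reg (\<lambda>r. \<Sum>k\<in>K. S k r) (\<Sum>k\<in>K. y k)"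
  by (induction K rule: finite_induct) (simp_all add: reg_zero reg_add)

lemma reg_shift:
  assumes "reg S y"
  shows "reg (\<lambda>r. S (r + m)) y"
proof -
  obtain L Q where L: "\<forall>k<L. S k = 0" and Q: "poly Q 1 \<noteq> 0" "has_fsum (act Q S) (poly Q 1 *\<^sub>C y)"
    using assms(1) unfolding reg_def by blast
  have "has_fsum (act Q (\<lambda>r. S (r + m))) (poly Q 1 *\<^sub>C y)"
    unfolding act_shift by (rule has_fsum_shift[OF Q(2)])
  moreover have "\<forall>k<L - m. S (k + m) = 0" using L by simp
  ultimately show ?thesis unfolding reg_def using Q(1) by blast
qed

lemma reg_act_cancel:
  assumes "reg (act Q S) (poly Q 1 *\<^sub>C y)" "poly Q 1 \<noteq> 0" "\<forall>k<L. S k = 0"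
  shows "reg S y"
proof -
  obtain P where P: "poly P 1 \<noteq> 0" "has_fsum (act P (act Q S)) (poly P 1 *\<^sub>C poly Q 1 *\<^sub>C y)"
    using assms(1) unfolding reg_def by blast
  then have "has_fsum (act (P * Q) S) (poly (P * Q) 1 *\<^sub>C y)" by (simp add: act_mult scaleC_scaleC)
  then show ?thesis unfolding reg_def using P(1) assms(2,3) by (metis mult_eq_0_iff poly_mult)
qed

text \<open>After the cut at m, \<open>act Q\<close> leaves only the finitely many boundary terms
  whose window contains the cut. So the one-sided series is rational, with all poles among the roots
  of Q.\<close>

lemma reg_truncation:
  assumes "act Q E = (\<lambda>r. 0)" "poly Q 1 \<noteq> 0"
  shows "\<exists>y. reg (\<lambda>r. if r > m then E r else 0) y"
proof -
  let ?S = "\<lambda>r. if r > m then E r else 0"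
  have "act Q ?S r = 0" if "r \<notin> {m - int (degree Q)..m}" for r
  proof (cases "r > m")
    case True
    then have "act Q ?S r = act Q E r" by (simp add: act_def)
    then show ?thesis using assms by simp
  next
    case False
    then have "r + int (degree Q) < m" using that by auto
    then show ?thesis unfolding act_def by (intro sum.neutral) auto
  qed
  then have "has_fsum (act Q ?S) (sum (act Q ?S) {m - int (degree Q)..m})"
    by (intro has_fsumI) auto
  then have "has_fsum (act Q ?S) (poly Q 1 *\<^sub>C (1 / poly Q 1) *\<^sub>C sum (act Q ?S) {m - int (degree Q)..m})"
    using assms(2) by (simp add: scaleC_scaleC scaleC_one)
  moreover have "\<forall>k<m. ?S k = 0" by simp
  ultimately show ?thesis unfolding reg_def using assms(2) by blast
qed

text \<open>If a sequence bounded below is killed by Q, the leading coefficient of Q isolates its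
  first possibly non-zero term, which therefore vanishes.\<close>

lemma act_injective_below:
  assumes "act Q S = (\<lambda>r. 0)" "Q \<noteq> 0" "\<forall>k<L. S k = 0"
  shows "S = (\<lambda>r. 0)"
proof -
  have "S (L + int k) = 0" for k
  proof (induction k rule: less_induct)
    case (less k)
    have below: "S j = 0" if "j < L + int k" for j
    proof (cases "j < L")
      case False
      then have "S (L + int (nat (j - L))) = 0" using that by (intro less) auto
      then show ?thesis using False by simp
    qed (use assms(3) in simp)
    have "0 = act Q S (L + int k - int (degree Q))" using assms(1) by simp
    also have "\<dots> = (\<Sum>j\<le>degree Q. if j = degree Q then lead_coeff Q *\<^sub>C S (L + int k) else 0)"
      unfolding act_def by (intro sum.cong refl) (auto intro!: below)
    also have "\<dots> = lead_coeff Q *\<^sub>C S (L + int k)" by simp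
    finally show ?case using assms(2) by (simp add: cvec.scale_eq_0_iff)
  qed
  then have "S r = 0" for r
    using assms(3) by (cases "r < L") (auto simp: not_less dest!: zle_iff_zadd[THEN iffD1])
  then show ?thesis by blast
qed

text \<open>With d the degree of Q and R its reflection, Q(u^-1) = u^-d R(u). Hence the series is
  the sum over \<open>K\<close> of the vectors \<open>act Q S r\<close> with the coefficients u^(r +
  d)/R(u), an explicit element of the tensor product with C(u), and R(1) = Q(1).\<close>

lemma reg_regular_with_value:
  assumes "reg S y"
  shows "regular_with_value S y"
proof -
  obtain L Q where L: "\<forall>k<L. S k = 0" and Q: "poly Q 1 \<noteq> 0" "has_fsum (act Q S) (poly Q 1 *\<^sub>C y)"
    using assms unfolding reg_def by blast
  obtain K where K: "finite K" "\<And>r. r \<notin> K \<Longrightarrow> act Q S r = 0" "sum (act Q S) K = poly Q 1 *\<^sub>C y"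
    using Q(2) unfolding has_fsum_def by blast
  define d where "d = degree Q"
  define R where "R = reflect_poly Q"
  have "Q \<noteq> 0" using Q(1) by auto
  have R1: "poly R 1 = poly Q 1" by (simp add: R_def poly_reflect_poly_nz)
  have R0: "coeff R 0 \<noteq> 0" using \<open>Q \<noteq> 0\<close> by (simp add: R_def)
  have coeff_R: "coeff R k = (if k > d then 0 else coeff Q (d - k))" for k
    by (simp add: R_def d_def coeff_reflect_poly)
  define RF where "RF = fps_to_fls (fps_of_poly R)"
  have RF_nz: "RF \<noteq> 0" using R0 by (auto simp: RF_def)
  define G where "G = inverse RF"
  have RG: "RF * G = 1" using RF_nz by (simp add: G_def)
  have G_below: "fls_nth G k = 0" if "k < 0" for k
  proof -
    have "fls_subdegree RF = 0"
      unfolding RF_def using R0 by (simp add: fls_subdegree_fls_to_fps subdegree_eq_0_iff)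
    then have "fls_subdegree G = 0" by (simp add: G_def)
    then show ?thesis using that by (simp add: fls_eq0_below_subdegree)
  qed
  have G_nz: "0 \<le> k" if "fls_nth G k \<noteq> 0" for k using G_below[of k] that by linarith
  \<comment> \<open>The expansion of u^m/R(u) is the fundamental solution: \<open>act Q\<close> maps
    it to the single power u^(m - d).\<close>
  have act_G: "act Q (\<lambda>k. fls_nth G (k - m) *\<^sub>C x) r = (if r = m - int d then x else 0)" for m r and x :: 'a
  proof -
    have "(\<Sum>k\<le>d. coeff Q k * fls_nth G (r + int k - m)) = (\<Sum>k\<le>d. coeff R k * fls_nth G (r + int d - m - int k))"
      by (rule sum.reindex_bij_witness[of _ "\<lambda>k. d - k" "\<lambda>k. d - k"]) (auto simp: coeff_R of_nat_diff algebra_simps)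
    also have "\<dots> = fls_nth (RF * G) (r + int d - m)"
    proof -
      have "fls_nth (RF * G) N = (\<Sum>k\<le>d. coeff R k * fls_nth G (N - int k))" for N
      proof -
        have "fls_nth (RF * G) N = (\<Sum>(k, l)\<in>pairs 0 N. fls_nth RF k * fls_nth G l)"
          by (rule fls_times_nth_pairs) (auto simp: RF_def G_below)
        also have "\<dots> = (\<Sum>k\<in>{k. k \<le> d \<and> int k \<le> N}. coeff R k * fls_nth G (N - int k))"
        proof (rule sum.reindex_bij_witness_not_neutral[of "{(k, l). (k, l) \<in> pairs 0 N \<and> k > int d}" "{}" _
              "\<lambda>k. (int k, N - int k)" "\<lambda>(k, l). nat k"])
          show "finite {(k, l). (k, l) \<in> pairs 0 N \<and> int d < k}"
            by (rule finite_subset[OF _ finite_pairs[of 0 N]]) auto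
        qed (auto simp: pairs_def RF_def coeff_R)
        also have "\<dots> = (\<Sum>k\<le>d. coeff R k * fls_nth G (N - int k))"
          by (rule sum.mono_neutral_left) (auto dest!: G_nz)
        finally show ?thesis .
      qed
      then show ?thesis by simp
    qed
    also have "\<dots> = (if r = m - int d then 1 else 0)" by (auto simp: RG)
    finally show ?thesis by (simp add: act_scalar_seq d_def scaleC_one)
  qed
  \<comment> \<open>\<open>S'\<close> is the proposed expansion. It has the same image under
    \<open>act Q\<close> as \<open>S\<close>, and both are bounded below, so they coincide.\<close>
  define S' where "S' k = (\<Sum>r\<in>K. fls_nth G (k - (r + int d)) *\<^sub>C act Q S r)" for k
  have "act Q S' r = act Q S r" for r
  proof -
    have "act Q S' r = (\<Sum>r'\<in>K. if r' = r then act Q S r' else 0)"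
      unfolding S'_def[abs_def] act_seq_sum by (auto simp: act_G intro!: sum.cong)
    then show ?thesis using K(1,2) by auto
  qed
  then have eq0: "act Q (\<lambda>k. S k - S' k) = (\<lambda>r. 0)" by (simp add: act_seq_diff)
  have "S' k = 0" if "k < Min (insert 0 K) + int d" for k
  proof -
    have "fls_nth G (k - (r + int d)) = 0" if "r \<in> K" for r
    proof (rule G_below)
      have "Min (insert 0 K) \<le> r" using K(1) that by simp
      then show "k - (r + int d) < 0" using \<open>k < _\<close> by linarith
    qed
    then show ?thesis by (simp add: S'_def)
  qed
  then have "\<forall>k<min L (Min (insert 0 K) + int d). S k - S' k = 0" using L by simp
  then have "(\<lambda>k. S k - S' k) = (\<lambda>r. 0)" by (rule act_injective_below[OF eq0 \<open>Q \<noteq> 0\<close>])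
  then have "S k - S' k = 0" for k by (rule fun_cong)
  then have S: "S k = (\<Sum>r\<in>K. fls_nth G (k - (r + int d)) *\<^sub>C act Q S r)" for k
    by (simp add: S'_def)
  \<comment> \<open>Numerators and denominators must be polynomials, so both are multiplied by u^M
    to make all exponents natural numbers.\<close>
  obtain M :: nat where M: "\<And>r. r \<in> K \<Longrightarrow> - int M \<le> r + int d"
  proof
    fix r assume "r \<in> K"
    then have "- r \<le> Max ((\<lambda>r. - r) ` K)" using K(1) by simp
    then show "- int (nat (Max ((\<lambda>r. - r) ` K))) \<le> r + int d" by linarith
  qed
  obtain f where f: "bij_betw f {0..<card K} K" using K(1) ex_bij_betw_nat_finite by blast
  define P where "P j = monom (1 :: complex) (nat (f j + int d + int M))" for j
  define D where "D = monom 1 M * R"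
  have fls_PD: "fls_nth (fps_to_fls (fps_of_poly (P j)) / fps_to_fls (fps_of_poly D)) k
      = fls_nth G (k - (f j + int d))" if "j < card K" for j k
  proof -
    have "f j \<in> K" using f that by (auto simp: bij_betw_def)
    then have exp: "0 \<le> f j + int d + int M" using M[of "f j"] by simp
    have "fps_to_fls (fps_of_poly D) = fls_X ^ M * RF"
      by (simp add: D_def RF_def fps_of_poly_mult fls_times_fps_to_fls fps_of_poly_monom' fps_to_fls_power)
    moreover have "fps_to_fls (fps_of_poly (P j)) = fls_X ^ nat (f j + int d + int M)"
      by (simp add: P_def fps_of_poly_monom' fps_to_fls_power)
    ultimately have "fps_to_fls (fps_of_poly (P j)) / fps_to_fls (fps_of_poly D)
        = fls_X ^ nat (f j + int d + int M) * inverse (fls_X ^ M) * G"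
      by (simp add: G_def divide_inverse)
    also have "\<dots> = fls_shift (- (f j + int d)) G"
      by (simp add: fls_X_power_conv_shift_1 fls_shifted_times_simps fls_inverse_shift exp flip: power_inverse)
    finally show ?thesis by (simp add: algebra_simps)
  qed
  have D1: "poly D 1 = poly Q 1" by (simp add: D_def poly_monom R1)
  show ?thesis
    unfolding regular_with_value_def
  proof (rule exI[of _ "card K"], rule exI[of _ "\<lambda>j. act Q S (f j)"], rule exI[of _ P],
      rule exI[of _ "\<lambda>j. D"], intro conjI allI impI)
    show "poly D 1 \<noteq> 0" if "j < card K" for j using Q(1) D1 by simp
    show "S k = (\<Sum>j<card K. fls_nth (fps_to_fls (fps_of_poly (P j)) / fps_to_fls (fps_of_poly D)) k *\<^sub>C act Q S (f j))" for k
    proof -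
      have "S k = (\<Sum>j\<in>{0..<card K}. fls_nth G (k - (f j + int d)) *\<^sub>C act Q S (f j))"
        unfolding S[of k] by (rule sum.reindex_bij_betw[OF f, symmetric])
      then show ?thesis by (simp add: fls_PD lessThan_atLeast0)
    qed
    have "(\<Sum>j<card K. (poly (P j) 1 / poly D 1) *\<^sub>C act Q S (f j)) = (1 / poly Q 1) *\<^sub>C (\<Sum>j\<in>{0..<card K}. act Q S (f j))"
      by (simp add: P_def poly_monom D1 cvec.scale_sum_right lessThan_atLeast0)
    also have "(\<Sum>j\<in>{0..<card K}. act Q S (f j)) = poly Q 1 *\<^sub>C y"
      unfolding K(3)[symmetric] by (rule sum.reindex_bij_betw[OF f])
    finally show "y = (\<Sum>j<card K. (poly (P j) 1 / poly D 1) *\<^sub>C act Q S (f j))"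
      using Q(1) by (simp add: scaleC_scaleC scaleC_one)
  qed
qed

section \<open>Evaluation of operator series at u = 1\<close>

definition regE :: "'v::complex_vector endo fls \<Rightarrow> 'v endo \<Rightarrow> bool" where
  "regE F f \<longleftrightarrow> (\<forall>T. reg (\<lambda>N. app (fls_nth F N) T) (app f T))"

lemma regE_unique: "regE F f \<Longrightarrow> regE F g \<Longrightarrow> f = g"
  unfolding regE_def by (metis endo_eqI reg_unique)

lemma regE_add: "regE F f \<Longrightarrow> regE G g \<Longrightarrow> regE (F + G) (f + g)"
  by (simp add: regE_def reg_add)

lemma regE_diff: "regE F f \<Longrightarrow> regE G g \<Longrightarrow> regE (F - G) (f - g)"
  by (simp add: regE_def reg_diff)

lemma regE_scale: "regE F f \<Longrightarrow> regE (c *\<^sub>C F) (c *\<^sub>C f)"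
  by (simp add: regE_def reg_scale)

lemma regE_0: "regE 0 0"
  by (simp add: regE_def reg_zero)

lemma regE_finite:
  assumes "finite K" "\<And>N. N \<notin> K \<Longrightarrow> fls_nth F N = 0"
  shows "regE F (\<Sum>N\<in>K. fls_nth F N)"
  unfolding regE_def app_sum using assms by (intro allI reg_fsum has_fsumI) auto

text \<open>Clear the denominator of G(u)T by Q. The same Q turns (FG)(u)T into a finite sum of
  powers of u times F(u) applied to fixed vectors, and each summand is regular. Only the denominator
  belonging to the one vector T is needed.\<close>

lemma regE_times:
  assumes "regE F f" "regE G g"
  shows "regE (F * G) (f * g)"
  unfolding regE_def
proof
  fix T
  define S where "S k = app (fls_nth G k) T" for k
  define S2 where "S2 N = app (fls_nth (F * G) N) T" for N
  have "reg S (app g T)" using assms(2) by (simp add: regE_def S_def[abs_def])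
  then obtain Q where Q: "poly Q 1 \<noteq> 0" "has_fsum (act Q S) (poly Q 1 *\<^sub>C app g T)"
    unfolding reg_def by blast
  obtain K where K: "finite K" "\<And>r. r \<notin> K \<Longrightarrow> act Q S r = 0" "sum (act Q S) K = poly Q 1 *\<^sub>C app g T"
    using Q(2) unfolding has_fsum_def by blast
  obtain M1 M2 where "\<And>k. k < M1 \<Longrightarrow> fls_nth F k = 0" "\<And>k. k < M2 \<Longrightarrow> fls_nth G k = 0"
    by (metis fls_lower_bound)
  then obtain M where M: "\<And>k. k < M \<Longrightarrow> fls_nth F k = 0" "\<And>k. k < M \<Longrightarrow> fls_nth G k = 0"
    using that[of "min M1 M2"] by auto
  \<comment> \<open>The summation range may be extended downwards by any \<open>a\<close>, the new
    terms being zero. This slack aligns the ranges of all shifts up to the degree of Q.\<close>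
  have S2: "S2 N = (\<Sum>l\<in>{M - int a..N - M}. app (fls_nth F (N - l)) (S l))" for N a
  proof -
    have "S2 N = (\<Sum>(k, l)\<in>pairs M N. app (fls_nth F k) (S l))"
      by (simp add: S2_def fls_times_nth_pairs[OF M] app_sum S_def case_prod_unfold)
    also have "\<dots> = (\<Sum>l\<in>{M..N - M}. app (fls_nth F (N - l)) (S l))"
      by (rule sum.reindex_bij_witness[of _ "\<lambda>l. (N - l, l)" snd]) (auto simp: pairs_def)
    also have "\<dots> = (\<Sum>l\<in>{M - int a..N - M}. app (fls_nth F (N - l)) (S l))"
      by (rule sum.mono_neutral_left) (auto simp: S_def M app_simps)
    finally show ?thesis .
  qed
  have act_S2: "act Q S2 r = (\<Sum>k\<in>K. app (fls_nth F (r + - k)) (act Q S k))" for r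
  proof -
    let ?I = "{M - int (degree Q)..r - M}"
    have S2_shift: "S2 (r + int j) = (\<Sum>l\<in>?I. app (fls_nth F (r - l)) (S (l + int j)))" if "j \<le> degree Q" for j
    proof -
      have "S2 (r + int j) = (\<Sum>l\<in>{M - int (degree Q - j)..r + int j - M}. app (fls_nth F (r + int j - l)) (S l))"
        by (rule S2)
      also have "\<dots> = (\<Sum>l\<in>?I. app (fls_nth F (r - l)) (S (l + int j)))"
        using that by (intro sum.reindex_bij_witness[of _ "\<lambda>l. l + int j" "\<lambda>l. l - int j"])
          (auto simp: of_nat_diff algebra_simps)
      finally show ?thesis .
    qed
    have "act Q S2 r = (\<Sum>j\<le>degree Q. \<Sum>l\<in>?I. app (fls_nth F (r - l)) (coeff Q j *\<^sub>C S (l + int j)))"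
      unfolding act_def by (intro sum.cong refl) (simp add: S2_shift cvec.scale_sum_right app_simps)
    also have "\<dots> = (\<Sum>l\<in>?I. app (fls_nth F (r - l)) (act Q S l))"
      by (subst sum.swap) (simp add: act_def app_simps)
    also have "\<dots> = (\<Sum>l\<in>?I \<union> K. app (fls_nth F (r - l)) (act Q S l))"
    proof (rule sum.mono_neutral_left)
      show "\<forall>l\<in>?I \<union> K - ?I. app (fls_nth F (r - l)) (act Q S l) = 0"
      proof
        fix l assume "l \<in> ?I \<union> K - ?I"
        then consider "r - l < M" | "l < M - int (degree Q)" by fastforce
        then show "app (fls_nth F (r - l)) (act Q S l) = 0"
        proof cases
          case 1
          then show ?thesis by (simp add: M)
        next
          case 2
          then have "act Q S l = 0" unfolding act_def by (intro sum.neutral) (simp add: S_def M)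
          then show ?thesis by (simp add: app_simps)
        qed
      qed
    qed (use K in auto)
    also have "\<dots> = (\<Sum>k\<in>K. app (fls_nth F (r - k)) (act Q S k))"
      by (rule sum.mono_neutral_right) (use K in \<open>auto simp: app_simps\<close>)
    finally show ?thesis by simp
  qed
  have "reg (\<lambda>r. \<Sum>k\<in>K. app (fls_nth F (r + - k)) (act Q S k)) (\<Sum>k\<in>K. app f (act Q S k))"
  proof (rule reg_sum[OF K(1)])
    fix k
    have "reg (\<lambda>r. app (fls_nth F r) (act Q S k)) (app f (act Q S k))"
      using assms(1) by (simp add: regE_def)
    then show "reg (\<lambda>r. app (fls_nth F (r + - k)) (act Q S k)) (app f (act Q S k))"
      by (rule reg_shift)
  qed
  moreover have "(\<Sum>k\<in>K. app f (act Q S k)) = poly Q 1 *\<^sub>C app (f * g) T"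
    using K(3) by (simp add: app_simps flip: clinear_sum[OF app_linear])
  ultimately have "reg (act Q S2) (poly Q 1 *\<^sub>C app (f * g) T)"
    by (simp add: act_S2[abs_def])
  moreover have "\<forall>N<M + M. S2 N = 0"
    unfolding S2_def using fls_times_below[of M F M G] M by simp
  ultimately show "reg (\<lambda>N. app (fls_nth (F * G) N) T) (app (f * g) T)"
    using Q(1) reg_act_cancel unfolding S2_def[abs_def] by blast
qed

text \<open>Regularity on pure tensors extends to sums, and the uniqueness of values makes the
  resulting map linear.\<close>

lemma regE_exists:
  fixes F :: "('v::complex_vector, 'w::complex_vector) tensor endo fls"
  assumes "\<And>v w. \<exists>y. reg (\<lambda>N. app (fls_nth F N) (v \<otimes>\<^sub>V w)) y"
  shows "\<exists>f. regE F f"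
proof -
  have "\<exists>y. reg (\<lambda>N. app (fls_nth F N) T) y" for T
  proof (induction T rule: tensor_induct)
    case (add S T)
    then show ?case using reg_add by (fastforce simp: app_simps)
  qed (rule assms)
  then obtain h where h: "\<And>T. reg (\<lambda>N. app (fls_nth F N) T) (h T)" by metis
  have "clinear h"
  proof (rule clinearI)
    show "h (S + T) = h S + h T" for S T
      using reg_add[OF h[of S] h[of T]] h[of "S + T"] by (simp add: app_simps reg_unique)
    show "h (c *\<^sub>C T) = c *\<^sub>C h T" for c T
      using reg_scale[OF h[of T], of c] h[of "c *\<^sub>C T"] by (simp add: app_simps reg_unique)
  qed
  then show ?thesis using h by (intro exI[of _ "Endo h"]) (simp add: regE_def app_Endo)
qed

section \<open>The defining relations as identities of endomorphisms\<close>

context toroidal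
begin

definition xe :: "pm \<Rightarrow> nat \<Rightarrow> int \<Rightarrow> 'v endo" where "xe \<epsilon> i m = Endo (x \<epsilon> i m)"
definition pe :: "pm \<Rightarrow> nat \<Rightarrow> int \<Rightarrow> 'v endo" where "pe \<epsilon> i m = Endo (\<phi> \<epsilon> i m)"
definition ke :: "cartan \<Rightarrow> 'v endo" where "ke h = Endo (k h)"

lemma app_xe [simp]: "i \<le> n \<Longrightarrow> app (xe \<epsilon> i m) v = x \<epsilon> i m v"
  by (simp add: xe_def app_Endo lin_x)

lemma app_pe [simp]: "i \<le> n \<Longrightarrow> app (pe \<epsilon> i m) v = \<phi> \<epsilon> i m v"
  by (simp add: pe_def app_Endo lin_phi)

lemma app_ke [simp]: "h \<in> cartan_space n \<Longrightarrow> app (ke h) v = k h v"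
  by (simp add: ke_def app_Endo lin_k)

lemma xe_quad:
  assumes "i \<le> n" "j \<le> n"
  shows "quad (q powi (pmi \<epsilon> * cartan_matrix n i j)) (xe \<epsilon> i) (xe \<epsilon> j)"
  unfolding quad_def using x_x[OF assms] by (intro allI endo_eqI) (simp add: assms)

lemma pe_xe_quad:
  assumes "i \<le> n" "j \<le> n"
  shows "quad (q powi (pmi \<epsilon> * cartan_matrix n i j)) (pe \<eta> i) (xe \<epsilon> j)"
  unfolding quad_def using phi_x[OF assms] by (intro allI endo_eqI) (simp add: assms)

lemma pe_commuting:
  assumes "i \<le> n" "j \<le> n"
  shows "commuting (pe \<epsilon> i) (pe \<eta> j)"
  unfolding commuting_def by (intro allI endo_eqI) (simp add: assms phi_phi[OF assms, of \<epsilon> _ \<eta>])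

lemma xe_serre:
  assumes "i \<le> n" "j \<le> n" "cartan_matrix n i j = - 1"
  shows "serre_rel (q + inverse q) (xe \<epsilon> i) (xe \<epsilon> j)"
  unfolding serre_rel_def
  by (intro allI endo_eqI) (simp only: app_add app_diff app_scaleC app_times app_0 app_xe assms(1,2) serre[OF assms])

lemma xe_commuting:
  assumes "i \<le> n" "j \<le> n" "cartan_matrix n i j = 0"
  shows "commuting (xe \<epsilon> i) (xe \<epsilon> j)"
  unfolding commuting_def by (intro allI endo_eqI) (simp only: app_times app_xe assms x_commute[OF assms])

lemma xe_bracket:
  assumes "i \<le> n" "j \<le> n"
  shows "xe Pos i m * xe Neg j r - xe Neg j r * xe Pos i m
    = (if i = j then (1 / (q - inverse q)) *\<^sub>C (pe Pos i (m + r) - pe Neg i (m + r)) else 0)"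
proof (rule endo_eqI)
  fix v
  show "app (xe Pos i m * xe Neg j r - xe Neg j r * xe Pos i m) v
    = app (if i = j then (1 / (q - inverse q)) *\<^sub>C (pe Pos i (m + r) - pe Neg i (m + r)) else 0) v"
    using x_pos_neg[OF assms, of m r v] assms by (cases "i = j") simp_all
qed

lemma ke_mult: "h \<in> cartan_space n \<Longrightarrow> h' \<in> cartan_space n \<Longrightarrow> ke h * ke h' = ke (h + h')"
  by (rule endo_eqI) (simp add: k_mult add_space)

lemma zero_space: "0 \<in> cartan_space n" by (simp add: cartan_space_def)

lemma ke_0: "ke 0 = 1"
  by (rule endo_eqI) (simp add: zero_space)

lemma ke_pe: "h \<in> cartan_space n \<Longrightarrow> i \<le> n \<Longrightarrow> ke h * pe \<epsilon> i m = pe \<epsilon> i m * ke h"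
  by (rule endo_eqI) (simp add: k_phi)

lemma ke_xe_ke:
  "h \<in> cartan_space n \<Longrightarrow> j \<le> n \<Longrightarrow>
    ke h * (xe \<epsilon> j r * ke (- h)) = qpow t (of_int (pmi \<epsilon>) * simple_root n j h) *\<^sub>C xe \<epsilon> j r"
  by (rule endo_eqI) (simp add: k_x_k uminus_space)

lemma pe_0: "i \<le> n \<Longrightarrow> pe \<epsilon> i 0 = ke (kpm \<epsilon> i)"
  by (rule endo_eqI) (use phi_nat[of \<epsilon> i 0] in \<open>simp add: kpm_space op_exp_coeff_def scaleC_one\<close>)

lemma pe_wrong_sign: "i \<le> n \<Longrightarrow> pmi \<epsilon> * m < 0 \<Longrightarrow> pe \<epsilon> i m = 0"
  by (rule endo_eqI) (simp add: phi_wrong_sign)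

lemma pe_vanish: "i \<le> n \<Longrightarrow> m < 0 \<Longrightarrow> pe Pos i m = 0" "i \<le> n \<Longrightarrow> m > 0 \<Longrightarrow> pe Neg i m = 0"
  by (simp_all add: pe_wrong_sign)

end

definition one_seq :: "int \<Rightarrow> 'v::complex_vector endo" where
  "one_seq m = (if m = 0 then 1 else 0)"

lemma commuting_one_seq [simp]: "commuting one_seq F" "commuting F one_seq"
  by (simp_all add: commuting_def one_seq_def)

lemma tame_left: "(\<And>m. m > 0 \<Longrightarrow> f m = 0) \<Longrightarrow> tame f g"
  unfolding tame_def by (metis diff_gt_0_iff_gt)

lemma tame_right: "(\<And>m. m < 0 \<Longrightarrow> g m = 0) \<Longrightarrow> tame f g"
  unfolding tame_def by blast

section \<open>The Drinfeld coproduct\<close>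

locale drinfeld_tensor =
  V: supported_module n t \<rho>V GV + W: supported_module n t \<rho>W GW
  for n t and \<rho>V :: "'v::complex_vector toroidal_ops" and GV
    and \<rho>W :: "'w::complex_vector toroidal_ops" and GW +
  assumes disjoint: "\<And>i. i \<le> n \<Longrightarrow> GV i \<inter> GW i = {}" and zero_notin: "\<And>i. 0 \<notin> GV i"
begin

abbreviation q where "q \<equiv> exp t"

text \<open>The coproduct currents are x(z) \<otimes> g(uz) + f(z) \<otimes> x(uz). Here g is 1 or
  \<phi>^+ and f is \<phi>^- or 1, according to the sign; \<open>gA\<close> and \<open>fB\<close>
  treat both signs uniformly.\<close>

definition gA :: "pm \<Rightarrow> nat \<Rightarrow> int \<Rightarrow> 'w endo" where
  "gA \<epsilon> i = (if \<epsilon> = Pos then one_seq else W.pe Pos i)"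

definition fB :: "pm \<Rightarrow> nat \<Rightarrow> int \<Rightarrow> 'v endo" where
  "fB \<epsilon> i = (if \<epsilon> = Pos then V.pe Neg i else one_seq)"

definition A where "A \<epsilon> i = cur (V.xe \<epsilon> i) (gA \<epsilon> i)"
definition B where "B \<epsilon> i = cur (fB \<epsilon> i) (W.xe \<epsilon> i)"
definition X where "X \<epsilon> i m = A \<epsilon> i m + B \<epsilon> i m"
definition P where "P \<epsilon> i = cur (V.pe \<epsilon> i) (W.pe \<epsilon> i)"

lemma gA_neg: "i \<le> n \<Longrightarrow> m < 0 \<Longrightarrow> gA \<epsilon> i m = 0"
  by (simp add: gA_def one_seq_def W.pe_vanish)

lemma fB_pos: "i \<le> n \<Longrightarrow> m > 0 \<Longrightarrow> fB \<epsilon> i m = 0"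
  by (simp add: fB_def one_seq_def V.pe_vanish)

lemma tame_A: "i \<le> n \<Longrightarrow> tame f (gA \<epsilon> i)"
  by (rule tame_right) (rule gA_neg)

lemma tame_B: "i \<le> n \<Longrightarrow> tame (fB \<epsilon> i) g"
  by (rule tame_left) (rule fB_pos)

lemma tame_P: "i \<le> n \<Longrightarrow> tame (V.pe \<epsilon> i) (W.pe \<epsilon> i)"
  by (cases \<epsilon>) (auto intro: tame_left tame_right simp: V.pe_vanish W.pe_vanish)

lemma A_nth: "i \<le> n \<Longrightarrow> fls_nth (A \<epsilon> i m) N = tmap (V.xe \<epsilon> i (m - N)) (gA \<epsilon> i N)"
  by (simp add: A_def cur_nth tame_A)

lemma B_nth: "i \<le> n \<Longrightarrow> fls_nth (B \<epsilon> i m) N = tmap (fB \<epsilon> i (m - N)) (W.xe \<epsilon> i N)"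
  by (simp add: B_def cur_nth tame_B)

lemma P_nth: "i \<le> n \<Longrightarrow> fls_nth (P \<epsilon> i m) N = tmap (V.pe \<epsilon> i (m - N)) (W.pe \<epsilon> i N)"
  by (simp add: P_def cur_nth tame_P)

lemma crossing_AB: "i \<le> n \<Longrightarrow> crossing (A \<epsilon> i) (B \<epsilon> i)"
  by unfold_locales (simp_all add: A_nth B_nth gA_neg fB_pos)

lemma commuting_gA: "i \<le> n \<Longrightarrow> j \<le> n \<Longrightarrow> commuting (gA \<epsilon> i) (gA \<epsilon> j)"
  by (simp add: gA_def W.pe_commuting)

lemma commuting_fB: "i \<le> n \<Longrightarrow> j \<le> n \<Longrightarrow> commuting (fB \<epsilon> i) (fB \<epsilon> j)"
  by (simp add: fB_def V.pe_commuting)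

lemma A_quad: "i \<le> n \<Longrightarrow> j \<le> n \<Longrightarrow> quad (q powi (pmi \<epsilon> * cartan_matrix n i j)) (A \<epsilon> i) (A \<epsilon> j)"
  unfolding A_def by (intro cur_quad_left V.xe_quad commuting_gA tame_A)

lemma B_quad: "i \<le> n \<Longrightarrow> j \<le> n \<Longrightarrow> quad (q powi (pmi \<epsilon> * cartan_matrix n i j)) (B \<epsilon> i) (B \<epsilon> j)"
  unfolding B_def by (intro cur_quad_right W.xe_quad commuting_fB tame_B)

text \<open>For x^+ the crossing takes place in the left tensor factor, between \<phi>^- and x^+;
  for x^- it takes place in the right one, between x^- and \<phi>^+. Both times the exchange factor
  is that of the two currents themselves.\<close>

lemma BA_quad:
  assumes "i \<le> n" "j \<le> n"
  shows "quad (q powi (pmi \<epsilon> * cartan_matrix n i j)) (B \<epsilon> i) (A \<epsilon> j)"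
proof (cases \<epsilon>)
  case Pos
  show ?thesis
    unfolding A_def B_def
    by (rule cur_quad_left) (use assms in \<open>simp_all add: Pos fB_def gA_def V.pe_xe_quad[where \<epsilon> = Pos, simplified]
        tame_A[where \<epsilon> = Pos, unfolded gA_def] tame_B[where \<epsilon> = Pos, unfolded fB_def] tame_right one_seq_def
        commuting_def tame_left V.pe_vanish\<close>)
next
  case Neg
  have "quad (q powi (pmi Neg * cartan_matrix n i j)) (W.xe Neg i) (W.pe Pos j)"
    using W.pe_xe_quad[OF assms(2,1), of Neg Pos] quad_sym cartan_matrix_sym[of n i j] by metis
  then show ?thesis
    unfolding A_def B_def
    by (intro cur_quad_right tame_A tame_B assms) (simp_all add: Neg fB_def gA_def)
qed

lemma X_quad:
  assumes "i \<le> n" "j \<le> n"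
  shows "quad (q powi (pmi \<epsilon> * cartan_matrix n i j)) (X \<epsilon> i) (X \<epsilon> j)"
  unfolding X_def
proof (rule quad_add[OF A_quad[OF assms] _ BA_quad[OF assms] B_quad[OF assms]])
  show "quad (q powi (pmi \<epsilon> * cartan_matrix n i j)) (A \<epsilon> i) (B \<epsilon> j)"
    using quad_sym[OF BA_quad[OF assms(2,1), of \<epsilon>]] unfolding cartan_matrix_sym[of n j i] .
qed

lemma PX_quad:
  assumes "i \<le> n" "j \<le> n"
  shows "quad (q powi (pmi \<epsilon> * cartan_matrix n i j)) (P \<eta> i) (X \<epsilon> j)"
proof -
  let ?c = "q powi (pmi \<epsilon> * cartan_matrix n i j)"
  have A: "quad ?c (P \<eta> i) (A \<epsilon> j)"
    unfolding P_def A_def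
    by (intro cur_quad_left V.pe_xe_quad tame_P tame_A assms) (simp add: gA_def W.pe_commuting assms)
  have B: "quad ?c (P \<eta> i) (B \<epsilon> j)"
    unfolding P_def B_def
    by (intro cur_quad_right W.pe_xe_quad tame_P tame_B assms) (simp add: fB_def V.pe_commuting assms)
  have "quad ?c (\<lambda>m. P \<eta> i m + 0) (\<lambda>m. A \<epsilon> j m + B \<epsilon> j m)"
    by (rule quad_add[OF A B]) (simp_all add: quad_def)
  then show ?thesis by (simp add: X_def[abs_def])
qed

lemma P_commuting: "i \<le> n \<Longrightarrow> j \<le> n \<Longrightarrow> commuting (P \<epsilon> i) (P \<eta> j)"
  unfolding P_def by (intro cur_commuting V.pe_commuting W.pe_commuting tame_P)

lemma X_serre:
  assumes "i \<le> n" "j \<le> n" "cartan_matrix n i j = - 1"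
  shows "serre_rel (q + inverse q) (X \<epsilon> i) (X \<epsilon> j)"
  unfolding X_def
proof (rule serre_coproduct[OF crossing_AB crossing_AB])
  let ?c = "q powi (pmi \<epsilon> * - 1)" and ?k = "q powi (pmi \<epsilon> * 2)"
  note ij = assms(3) assms(3)[unfolded cartan_matrix_sym[of n i j]]
  show "?c \<noteq> 0" by simp
  show "(q + inverse q) * ?c = ?c * ?c + 1"
    by (cases \<epsilon>) (simp_all add: power_int_minus field_simps)
  show "?k * ?c * ?c = 1"
    by (cases \<epsilon>) (simp_all add: power_int_minus power_int_def field_simps power2_eq_square)
  show "quad ?k (A \<epsilon> i) (A \<epsilon> i)" "quad ?k (B \<epsilon> i) (B \<epsilon> i)" "quad ?k (B \<epsilon> i) (A \<epsilon> i)"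
    using A_quad[OF assms(1,1), of \<epsilon>] B_quad[OF assms(1,1), of \<epsilon>] BA_quad[OF assms(1,1), of \<epsilon>] by simp_all
  show "quad ?c (A \<epsilon> i) (A \<epsilon> j)" "quad ?c (B \<epsilon> i) (B \<epsilon> j)" "quad ?c (B \<epsilon> i) (A \<epsilon> j)" "quad ?c (B \<epsilon> j) (A \<epsilon> i)"
    using A_quad[OF assms(1,2), of \<epsilon>] B_quad[OF assms(1,2), of \<epsilon>] BA_quad[OF assms(1,2), of \<epsilon>]
      BA_quad[OF assms(2,1), of \<epsilon>] unfolding ij by simp_all
  show "serre_rel (q + inverse q) (A \<epsilon> i) (A \<epsilon> j)"
    unfolding A_def by (intro cur_serre_left V.xe_serre commuting_gA tame_A assms)
  show "serre_rel (q + inverse q) (B \<epsilon> i) (B \<epsilon> j)"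
    unfolding B_def by (intro cur_serre_right W.xe_serre commuting_fB tame_B assms)
qed (fact assms)+

lemma X_commuting:
  assumes "i \<le> n" "j \<le> n" "cartan_matrix n i j = 0"
  shows "commuting (X \<epsilon> i) (X \<epsilon> j)"
  unfolding X_def
proof (rule commuting_coproduct[OF crossing_AB crossing_AB])
  show "commuting (A \<epsilon> i) (A \<epsilon> j)"
    unfolding A_def by (intro cur_commuting V.xe_commuting commuting_gA tame_A assms)
  show "commuting (B \<epsilon> i) (B \<epsilon> j)"
    unfolding B_def by (intro cur_commuting W.xe_commuting commuting_fB tame_B assms)
  show "quad 1 (B \<epsilon> i) (A \<epsilon> j)" "quad 1 (B \<epsilon> j) (A \<epsilon> i)"
    using BA_quad[OF assms(1,2), of \<epsilon>] BA_quad[OF assms(2,1), of \<epsilon>] assms(3) cartan_matrix_sym[of n i j]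
    by simp_all
qed (fact assms)+

text \<open>The two currents \<open>\<phi>\<^sup>-(z) \<otimes> x\<^sup>+(z)\<close> and \<open>x\<^sup>-(w) \<otimes> \<phi>\<^sup>+(w)\<close> commute because the factors picked
  up on the two sides are inverse to each other.\<close>

lemma B_A_commute:
  assumes i: "i \<le> n" and j: "j \<le> n"
  shows "B Pos i m * A Neg j r = A Neg j r * B Pos i m"
proof (rule one_sided_eq[where F = "\<lambda>m r. B Pos i m * A Neg j r" and G = "\<lambda>m r. A Neg j r * B Pos i m"
      and c = "q powi (- cartan_matrix n i j)"])
  let ?c = "q powi (- cartan_matrix n i j)"
  fix m r :: int
  let ?f = "V.pe Neg i" and ?x = "V.xe Neg j" and ?y = "W.xe Pos i" and ?g = "W.pe Pos j"
  have nth: "fls_nth (B Pos i m) N = tmap (?f (m - N)) (?y N)"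
    "fls_nth (A Neg j m) N = tmap (?x (m - N)) (?g N)" for m N
    by (simp_all add: A_nth B_nth i j gA_def fB_def)
  have Vrel: "?f a * ?x (b - 1) - ?c *\<^sub>C (?f (a - 1) * ?x b) = ?c *\<^sub>C (?x (b - 1) * ?f a) - ?x b * ?f (a - 1)" for a b
    using V.pe_xe_quad[OF i j, of Neg Neg] unfolding quad_def by simp
  \<comment> \<open>The relation between \<phi>^+ and x^+ is multiplied by the inverse of its
    factor, so that it cancels the factor arising from \<phi>^- and x^- on the left.\<close>
  have Wrel: "?c *\<^sub>C (?y k * ?g l) - ?y (k - 1) * ?g (l + 1) = ?g l * ?y k - ?c *\<^sub>C (?g (l + 1) * ?y (k - 1))" for k l
  proof -
    let ?e = "q powi (cartan_matrix n i j)"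
    have ce: "?c * ?e = 1" "?e * ?c = 1" by (simp_all add: power_int_minus)
    have "?g (l + 1) * ?y (k - 1) - ?e *\<^sub>C (?g l * ?y k) = ?e *\<^sub>C (?y (k - 1) * ?g (l + 1)) - ?y k * ?g l"
      using W.pe_xe_quad[OF j i, of Pos Pos, unfolded quad_def, rule_format, of "l + 1" k]
      unfolding cartan_matrix_sym[of n j i] by simp
    from arg_cong[OF this, of "\<lambda>z. ?c *\<^sub>C z"] show ?thesis
      by (simp add: cvec.scale_right_diff_distrib scaleC_scaleC ce scaleC_one algebra_simps)
  qed
  show "B Pos i m * A Neg j (r - 1) - ?c *\<^sub>C (B Pos i (m - 1) * A Neg j r)
      = A Neg j (r - 1) * B Pos i m - ?c *\<^sub>C (A Neg j r * B Pos i (m - 1))"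
  proof (rule fls_eqI)
    fix N
    \<comment> \<open>The margin below min m 0 keeps every non-zero term in range both before and
      after the index shift by one.\<close>
    define M where "M = min m 0 - 2"
    have below: "\<And>k. k < M \<Longrightarrow> fls_nth (B Pos i m') k = 0" "\<And>k. k < M \<Longrightarrow> fls_nth (A Neg j r') k = 0"
      if "m' \<ge> m - 1" for m' r'
      using that by (simp_all add: nth M_def V.pe_vanish W.pe_vanish i j)
    have BA: "fls_nth (B Pos i m' * A Neg j r') N = (\<Sum>(k, l)\<in>pairs M N. tmap (?f (m' - k) * ?x (r' - l)) (?y k * ?g l))"
      if "m' \<ge> m - 1" for m' r'
      using fls_times_nth_pairs[OF below(1)[OF that] below(2)[OF that], where N = N] by (simp add: nth case_prod_unfold)
    have AB: "fls_nth (A Neg j r' * B Pos i m') N = (\<Sum>(k, l)\<in>pairs M N. tmap (?x (r' - l) * ?f (m' - k)) (?g l * ?y k))"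
      if "m' \<ge> m - 1" for m' r'
      using fls_times_nth_pairs_swap[OF below(1)[OF that] below(2)[OF that], where N = N] by (simp add: nth case_prod_unfold)
    \<comment> \<open>Moving one unit from k to l preserves k + l. The terms lost at the ends vanish
      because \<phi>^- has no positive modes and H no negative second index.\<close>
    have shift: "(\<Sum>(k, l)\<in>pairs M N. tmap (?x (r - l) * ?f (m - 1 - k)) (H k l))
        = (\<Sum>(k, l)\<in>pairs M N. tmap (?x (r - 1 - l) * ?f (m - k)) (H (k - 1) (l + 1)))"
      if H: "\<And>k l. l < 0 \<Longrightarrow> H k l = 0" for H
    proof (rule sum.reindex_bij_witness_not_neutral[of "{p \<in> pairs M N. snd p < 0 \<or> fst p < m - 1}" "{p \<in> pairs M N. fst p < m \<or> snd p < - 1}" _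
          "\<lambda>(k, l). (k - 1, l + 1)" "\<lambda>(k, l). (k + 1, l - 1)"])
      show "finite {p \<in> pairs M N. snd p < 0 \<or> fst p < m - 1}" "finite {p \<in> pairs M N. fst p < m \<or> snd p < - 1}"
        using finite_pairs by auto
    qed (auto simp: pairs_def M_def H V.pe_vanish i algebra_simps)
    have "fls_nth (B Pos i m * A Neg j (r - 1) - ?c *\<^sub>C (B Pos i (m - 1) * A Neg j r)) N
        = (\<Sum>(k, l)\<in>pairs M N. tmap (?f (m - k) * ?x (r - l - 1) - ?c *\<^sub>C (?f (m - k - 1) * ?x (r - l))) (?y k * ?g l))"
      by (simp add: BA cvec.scale_sum_right sum_subtractf case_prod_unfold tmap_diff tmap_scale algebra_simps)
    also have "\<dots> = (\<Sum>(k, l)\<in>pairs M N. ?c *\<^sub>C tmap (?x (r - 1 - l) * ?f (m - k)) (?y k * ?g l))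
        - (\<Sum>(k, l)\<in>pairs M N. tmap (?x (r - l) * ?f (m - 1 - k)) (?y k * ?g l))"
      unfolding Vrel by (simp add: sum_subtractf case_prod_unfold tmap_diff tmap_scale algebra_simps)
    also have "(\<Sum>(k, l)\<in>pairs M N. tmap (?x (r - l) * ?f (m - 1 - k)) (?y k * ?g l))
        = (\<Sum>(k, l)\<in>pairs M N. tmap (?x (r - 1 - l) * ?f (m - k)) (?y (k - 1) * ?g (l + 1)))"
      by (rule shift) (simp add: W.pe_vanish j)
    also have "(\<Sum>(k, l)\<in>pairs M N. ?c *\<^sub>C tmap (?x (r - 1 - l) * ?f (m - k)) (?y k * ?g l)) - \<dots>
        = (\<Sum>(k, l)\<in>pairs M N. tmap (?x (r - 1 - l) * ?f (m - k)) (?c *\<^sub>C (?y k * ?g l) - ?y (k - 1) * ?g (l + 1)))"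
      by (simp add: sum_subtractf case_prod_unfold tmap_diff tmap_scale)
    also have "\<dots> = (\<Sum>(k, l)\<in>pairs M N. tmap (?x (r - 1 - l) * ?f (m - k)) (?g l * ?y k))
        - ?c *\<^sub>C (\<Sum>(k, l)\<in>pairs M N. tmap (?x (r - 1 - l) * ?f (m - k)) (?g (l + 1) * ?y (k - 1)))"
      unfolding Wrel by (simp add: sum_subtractf case_prod_unfold tmap_diff tmap_scale cvec.scale_sum_right)
    also have "(\<Sum>(k, l)\<in>pairs M N. tmap (?x (r - 1 - l) * ?f (m - k)) (?g (l + 1) * ?y (k - 1)))
        = (\<Sum>(k, l)\<in>pairs M N. tmap (?x (r - l) * ?f (m - 1 - k)) (?g l * ?y k))"
      by (rule shift[symmetric]) (simp add: W.pe_vanish j)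
    also have "(\<Sum>(k, l)\<in>pairs M N. tmap (?x (r - 1 - l) * ?f (m - k)) (?g l * ?y k)) - ?c *\<^sub>C \<dots>
        = fls_nth (A Neg j (r - 1) * B Pos i m - ?c *\<^sub>C (A Neg j r * B Pos i (m - 1))) N"
      by (simp add: AB)
    finally show "fls_nth (B Pos i m * A Neg j (r - 1) - ?c *\<^sub>C (B Pos i (m - 1) * A Neg j r)) N
      = fls_nth (A Neg j (r - 1) * B Pos i m - ?c *\<^sub>C (A Neg j r * B Pos i (m - 1))) N" .
  qed
next
  show "fls_nth (B Pos i m * A Neg j r) N = 0" "fls_nth (A Neg j r * B Pos i m) N = 0" if "N < m" for m r N
    using fls_times_below[of m "B Pos i m" 0 "A Neg j r" N] fls_times_below[of 0 "A Neg j r" m "B Pos i m" N] that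
      crossing.B_below[OF crossing_AB[OF i]] crossing.A_below[OF crossing_AB[OF j]] by auto
qed simp

text \<open>The commutator of the two A summands gives (\<phi>^+ - \<phi>^-) \<otimes> \<phi>^+,
  that of the two B summands gives \<phi>^- \<otimes> (\<phi>^+ - \<phi>^-). The middle term
  \<open>Z\<close>, with \<phi>^- \<otimes> \<phi>^+, cancels, and the mixed commutators are
  zero.\<close>

lemma X_bracket:
  assumes i: "i \<le> n" and j: "j \<le> n"
  shows "X Pos i m * X Neg j r - X Neg j r * X Pos i m
    = (if i = j then (1 / (q - inverse q)) *\<^sub>C (P Pos i (m + r) - P Neg i (m + r)) else 0)"
proof -
  let ?d = "1 / (q - inverse q)"
  define Z where "Z = cur (V.pe Neg i) (W.pe Pos i) (m + r)"
  have Z: "fls_nth Z N = tmap (V.pe Neg i (m + r - N)) (W.pe Pos i N)" for N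
    unfolding Z_def by (intro cur_nth tame_left) (simp add: V.pe_vanish i)
  have A_const: "A Pos i m = fls_const (tmap (V.xe Pos i m) 1)"
    by (rule fls_eqI) (simp add: A_nth i gA_def one_seq_def)
  have AA: "A Pos i m * A Neg j r - A Neg j r * A Pos i m = (if i = j then ?d *\<^sub>C (P Pos i (m + r) - Z) else 0)"
  proof (rule fls_eqI)
    fix N
    have "fls_nth (A Pos i m * A Neg j r - A Neg j r * A Pos i m) N
        = tmap (V.xe Pos i m * V.xe Neg j (r - N) - V.xe Neg j (r - N) * V.xe Pos i m) (W.pe Pos j N)"
      unfolding A_const by (simp add: A_nth j gA_def tmap_diff)
    also have "\<dots> = fls_nth (if i = j then ?d *\<^sub>C (P Pos i (m + r) - Z) else 0) N"
      unfolding V.xe_bracket[OF i j]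
      by (cases "i = j") (simp_all add: P_nth Z i j tmap_scale tmap_diff algebra_simps)
    finally show "fls_nth (A Pos i m * A Neg j r - A Neg j r * A Pos i m) N
      = fls_nth (if i = j then ?d *\<^sub>C (P Pos i (m + r) - Z) else 0) N" .
  qed
  have B_shift: "B Neg j r = fls_shift (- r) (fls_const (tmap 1 (W.xe Neg j r)))"
    by (rule fls_eqI) (auto simp: B_nth j fB_def one_seq_def)
  have BB: "B Pos i m * B Neg j r - B Neg j r * B Pos i m = (if i = j then ?d *\<^sub>C (Z - P Neg i (m + r)) else 0)"
  proof (rule fls_eqI)
    fix N
    have "fls_nth (B Pos i m * B Neg j r - B Neg j r * B Pos i m) N
        = tmap (V.pe Neg i (m - (N - r))) (W.xe Pos i (N - r) * W.xe Neg j r - W.xe Neg j r * W.xe Pos i (N - r))"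
      unfolding B_shift by (simp add: fls_shifted_times_simps B_nth i fB_def tmap_diff)
    also have "\<dots> = fls_nth (if i = j then ?d *\<^sub>C (Z - P Neg i (m + r)) else 0) N"
      unfolding W.xe_bracket[OF i j]
      by (cases "i = j") (simp_all add: P_nth Z i j tmap_scale tmap_diff algebra_simps)
    finally show "fls_nth (B Pos i m * B Neg j r - B Neg j r * B Pos i m) N
      = fls_nth (if i = j then ?d *\<^sub>C (Z - P Neg i (m + r)) else 0) N" .
  qed
  have AB: "A Pos i m * B Neg j r = B Neg j r * A Pos i m"
    by (rule fls_lift_commute) (simp add: A_nth B_nth i j gA_def fB_def one_seq_def)
  have "X Pos i m * X Neg j r - X Neg j r * X Pos i m
      = (A Pos i m * A Neg j r - A Neg j r * A Pos i m) + (B Pos i m * B Neg j r - B Neg j r * B Pos i m)"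
    unfolding X_def using AB B_A_commute[OF i j, of m r] by (simp add: algebra_simps)
  also have "\<dots> = (if i = j then ?d *\<^sub>C (P Pos i (m + r) - P Neg i (m + r)) else 0)"
    unfolding AA BB by (simp add: cvec.scale_right_diff_distrib)
  finally show ?thesis .
qed

end

section \<open>Regularity at u = 1 and the operators on the tensor product\<close>

context drinfeld_tensor
begin

text \<open>A root 1 would be a quotient of two equal points, one from each support; disjointness
  forbids this.\<close>

lemma ratio_annihilator:
  assumes "i \<le> n" "ann {\<gamma> / \<alpha> | \<gamma> \<alpha>. \<gamma> \<in> GW i \<and> \<alpha> \<in> GV i} Q"
  shows "poly Q 1 \<noteq> 0"
proof
  assume "poly Q 1 = 0"
  then obtain \<gamma> \<alpha> where *: "1 = \<gamma> / \<alpha>" "\<gamma> \<in> GW i" "\<alpha> \<in> GV i"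
    using assms(2) unfolding ann_def by blast
  then have "\<gamma> = \<alpha>" by (cases "\<alpha> = 0") auto
  then show False using * disjoint[OF assms(1)] by blast
qed

lemma product_truncation_regular:
  fixes S :: "int \<Rightarrow> 'v" and S' :: "int \<Rightarrow> 'w"
  assumes "i \<le> n" "supported (GV i) S" "supported (GW i) S'"
  shows "\<exists>y. reg (\<lambda>r. if r > m then S (a - r) \<otimes>\<^sub>V S' r else 0) y"
proof -
  obtain p p' where p: "ann (GV i) p" "act p S = (\<lambda>r. 0)" and p': "ann (GW i) p'" "act p' S' = (\<lambda>r. 0)"
    using assms(2,3) unfolding supported_def by blast
  have lin: "clinear (\<lambda>v. v \<otimes>\<^sub>V w)" "clinear (\<lambda>w. v \<otimes>\<^sub>V w)" for v :: 'v and w :: 'w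
    by (rule clinearI; simp add: tens_add_left tens_add_right tens_scaleC_left tens_scaleC_right)+
  have "\<exists>Q. ann {\<gamma> / \<alpha> | \<gamma> \<alpha>. \<gamma> \<in> GW i \<and> \<alpha> \<in> GV i} Q \<and> (\<forall>m. act Q (\<lambda>r. S (m - r) \<otimes>\<^sub>V S' r) = (\<lambda>r. 0))"
  proof (rule supported_product[OF p(1) p'(1) zero_notin])
    show "act p (\<lambda>a. S a \<otimes>\<^sub>V S' b) = (\<lambda>a. 0)" for b
      using act_linear[OF lin(1)[of "S' b"], of p S] by (simp add: p(2))
    show "act p' (\<lambda>b. S a \<otimes>\<^sub>V S' b) = (\<lambda>b. 0)" for a
      using act_linear[OF lin(2)[of "S a"], of p' S'] by (simp add: p'(2))
  qed
  then obtain Q where Q: "ann {\<gamma> / \<alpha> | \<gamma> \<alpha>. \<gamma> \<in> GW i \<and> \<alpha> \<in> GV i} Q" "act Q (\<lambda>r. S (a - r) \<otimes>\<^sub>V S' r) = (\<lambda>r. 0)"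
    by blast
  show ?thesis by (rule reg_truncation[OF Q(2) ratio_annihilator[OF assms(1) Q(1)]])
qed

lemma reg_delta: "reg (\<lambda>r. if r = m then y else 0) y"
  by (rule reg_fsum) (auto simp: has_fsum_def intro!: exI[of _ "{m}"])

lemma X_nth_tens:
  assumes "i \<le> n"
  shows "app (fls_nth (X Pos i m) N) (v \<otimes>\<^sub>V w) = (if N = 0 then V.x Pos i m v \<otimes>\<^sub>V w else 0)
      + V.\<phi> Neg i (m - N) v \<otimes>\<^sub>V W.x Pos i N w"
    and "app (fls_nth (X Neg i m) N) (v \<otimes>\<^sub>V w) = V.x Neg i (m - N) v \<otimes>\<^sub>V W.\<phi> Pos i N w
      + (if N = m then v \<otimes>\<^sub>V W.x Neg i m w else 0)"
  using assms by (simp_all add: X_def A_nth B_nth gA_def fB_def one_seq_def)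

lemma X_nth_drinfeld_series:
  assumes "i \<le> n"
  shows "app (fls_nth (X \<epsilon> i m) N) (v \<otimes>\<^sub>V w) = drinfeld_series t \<rho>V \<rho>W \<epsilon> i m v w N"
proof (cases \<epsilon>)
  case Pos
  then show ?thesis
    using V.phi_pos_neg_index(2)[of "m - N" i v] by (auto simp: X_nth_tens[OF assms])
next
  case Neg
  then show ?thesis
    using W.phi_pos_neg_index(1)[of N i w] by (auto simp: X_nth_tens[OF assms])
qed

lemma X_regular:
  assumes i: "i \<le> n"
  shows "\<exists>f. regE (X \<epsilon> i m) f"
proof (rule regE_exists)
  fix v w
  show "\<exists>y. reg (\<lambda>N. app (fls_nth (X \<epsilon> i m) N) (v \<otimes>\<^sub>V w)) y"
  proof (cases \<epsilon>)
    case Pos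
    \<comment> \<open>At negative indices \<phi>^+ vanishes, so \<phi>^- equals -D there and the
      truncated series is built from a sequence of known support. The index 0, where both series
      have a term, is split off.\<close>
    define D where "D k = V.\<phi> Pos i k v - V.\<phi> Neg i k v" for k
    have "supported (GV i) (\<lambda>k. (-1) *\<^sub>C D k)"
      unfolding D_def by (intro supported_scale V.supported_phi_diff i)
    then obtain y where y: "reg (\<lambda>r. if r > m then ((-1) *\<^sub>C D (m - r)) \<otimes>\<^sub>V W.x Pos i r w else 0) y"
      using product_truncation_regular[OF i _ W.supported_x[OF i]] by blast
    have "app (fls_nth (X Pos i m) N) (v \<otimes>\<^sub>V w) = (if N = 0 then V.x Pos i m v \<otimes>\<^sub>V w else 0)
        + (if N = m then V.\<phi> Neg i 0 v \<otimes>\<^sub>V W.x Pos i m w else 0)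
        + (if N > m then ((-1) *\<^sub>C D (m - N)) \<otimes>\<^sub>V W.x Pos i N w else 0)" for N
      using V.phi_pos_neg_index(2)[of "m - N" i v] V.phi_pos_neg_index(1)[of "m - N" i v]
      by (auto simp: X_nth_tens[OF i] D_def scaleC_one)
    then show ?thesis unfolding Pos using reg_add[OF reg_add[OF reg_delta reg_delta] y] by (metis (no_types, lifting) ext)
  next
    case Neg
    define D where "D k = W.\<phi> Pos i k w - W.\<phi> Neg i k w" for k
    have "supported (GW i) D"
      unfolding D_def by (intro W.supported_phi_diff i)
    then obtain y where y: "reg (\<lambda>r. if r > 0 then V.x Neg i (m - r) v \<otimes>\<^sub>V D r else 0) y"
      using product_truncation_regular[OF i V.supported_x[OF i]] by blast
    have "app (fls_nth (X Neg i m) N) (v \<otimes>\<^sub>V w) = (if N = m then v \<otimes>\<^sub>V W.x Neg i m w else 0)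
        + (if N = 0 then V.x Neg i m v \<otimes>\<^sub>V W.\<phi> Pos i 0 w else 0)
        + (if N > 0 then V.x Neg i (m - N) v \<otimes>\<^sub>V D N else 0)" for N
      using W.phi_pos_neg_index(1)[of N i w] W.phi_pos_neg_index(2)[of N i w]
      by (auto simp: X_nth_tens[OF i] D_def)
    then show ?thesis unfolding Neg using reg_add[OF reg_add[OF reg_delta reg_delta] y] by (metis (no_types, lifting) ext)
  qed
qed

definition xval where "xval \<epsilon> i m = (SOME f. regE (X \<epsilon> i m) f)"

lemma regE_X: "i \<le> n \<Longrightarrow> regE (X \<epsilon> i m) (xval \<epsilon> i m)"
  unfolding xval_def by (rule someI_ex[OF X_regular])

definition pval where
  "pval \<epsilon> i m = (if 0 \<le> pmi \<epsilon> * m then \<Sum>p\<le>nat (pmi \<epsilon> * m).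
     tmap (V.pe \<epsilon> i (pmi \<epsilon> * int p)) (W.pe \<epsilon> i (pmi \<epsilon> * int (nat (pmi \<epsilon> * m) - p))) else 0)"

text \<open>For the modes of \<phi> the series in u is a Laurent polynomial: both tensor factors
  have modes of one sign only, which leaves finitely many terms for a given m.\<close>

lemma regE_P:
  assumes i: "i \<le> n"
  shows "regE (P \<epsilon> i m) (pval \<epsilon> i m)"
proof (cases "0 \<le> pmi \<epsilon> * m")
  case False
  have "fls_nth (P \<epsilon> i m) N = 0" for N
  proof (cases "pmi \<epsilon> * N < 0")
    case True
    then show ?thesis by (simp add: P_nth i W.pe_wrong_sign)
  next
    case False
    then have "pmi \<epsilon> * (m - N) < 0" using \<open>\<not> 0 \<le> pmi \<epsilon> * m\<close> by (simp add: right_diff_distrib)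
    then show ?thesis by (simp add: P_nth i V.pe_wrong_sign)
  qed
  then show ?thesis using False regE_finite[of "{}" "P \<epsilon> i m"] by (simp add: pval_def)
next
  case True
  define b where "b = nat (pmi \<epsilon> * m)"
  have m: "m = pmi \<epsilon> * int b" using True by (simp add: b_def)
  define K where "K = (\<lambda>p. pmi \<epsilon> * int (b - p)) ` {..b}"
  have inj: "inj_on (\<lambda>p. pmi \<epsilon> * int (b - p)) {..b}"
    by (auto simp: inj_on_def)
  have "fls_nth (P \<epsilon> i m) N = 0" if "N \<notin> K" for N
  proof -
    consider "pmi \<epsilon> * N < 0" | "pmi \<epsilon> * N > int b" | "0 \<le> pmi \<epsilon> * N" "pmi \<epsilon> * N \<le> int b" by linarith
    then show ?thesis
    proof cases
      case 1
      then show ?thesis by (simp add: P_nth i W.pe_wrong_sign)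
    next
      case 2
      then have "pmi \<epsilon> * (m - N) < 0" by (simp add: m right_diff_distrib)
      then show ?thesis by (simp add: P_nth i V.pe_wrong_sign)
    next
      case 3
      define p where "p = b - nat (pmi \<epsilon> * N)"
      have "p \<le> b" "int (b - p) = pmi \<epsilon> * N" using 3 by (auto simp: p_def)
      then have "N = pmi \<epsilon> * int (b - p)" by simp
      then show ?thesis using that \<open>p \<le> b\<close> by (auto simp: K_def)
    qed
  qed
  then have "regE (P \<epsilon> i m) (\<Sum>N\<in>K. fls_nth (P \<epsilon> i m) N)"
    by (intro regE_finite) (auto simp: K_def)
  also have "(\<Sum>N\<in>K. fls_nth (P \<epsilon> i m) N) = (\<Sum>p\<le>b. fls_nth (P \<epsilon> i m) (pmi \<epsilon> * int (b - p)))"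
    unfolding K_def by (subst sum.reindex[OF inj]) simp
  also have "\<dots> = pval \<epsilon> i m"
    unfolding pval_def b_def[symmetric] using True
    by (auto simp: P_nth i m of_nat_diff right_diff_distrib intro!: sum.cong)
  finally show ?thesis .
qed

definition kval where "kval h = tmap (V.ke h) (W.ke h)"

lemma regE_const: "regE (fls_const f) f"
  using regE_finite[of "{0}" "fls_const f"] by simp

lemma kval_mult: "h \<in> cartan_space n \<Longrightarrow> h' \<in> cartan_space n \<Longrightarrow> kval h * kval h' = kval (h + h')"
  by (simp add: kval_def V.ke_mult W.ke_mult)

lemma kval_0: "kval 0 = 1"
  by (simp add: kval_def V.ke_0 W.ke_0)

lemma pval_0: "i \<le> n \<Longrightarrow> pval \<epsilon> i 0 = kval (V.kpm \<epsilon> i)"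
  by (simp add: pval_def kval_def V.pe_0 W.pe_0 V.kpm_def W.kpm_def)

text \<open>The operators \<open>h\<^bsub>i,m\<^esub>\<close> on the tensor product are read off the logarithm of \<open>k\<^sub>i\<^sup>\<minusplus>\<^sup>1\<phi>\<^sub>i\<^sup>\<plusminus>(z)\<close>.\<close>

definition hlog where
  "hlog \<epsilon> i = op_log_coeff (\<lambda>a. app (kval (- V.kpm \<epsilon> i) * pval \<epsilon> i (pmi \<epsilon> * int a)))"

definition tensor_ops :: "('v, 'w) tensor toroidal_ops" where
  "tensor_ops = \<lparr> xop = (\<lambda>\<epsilon> i m. app (xval \<epsilon> i m)), kop = (\<lambda>h. app (kval h)),
     hop = (\<lambda>i m T. let \<epsilon> = (if m > 0 then Pos else Neg) in
       (1 / (of_int (pmi \<epsilon>) * (q - inverse q))) *\<^sub>C hlog \<epsilon> i (nat \<bar>m\<bar>) T) \<rparr>"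

lemma tensor_ops_simps [simp]:
  "xop tensor_ops \<epsilon> i m = app (xval \<epsilon> i m)" "kop tensor_ops h = app (kval h)"
  by (simp_all add: tensor_ops_def)

lemma hlog_linear: "clinear (hlog \<epsilon> i m)"
  unfolding hlog_def by (intro op_log_coeff_linear app_linear)

text \<open>In \<open>phi\<close> the exponential undoes the logarithm defining h, and the factor
  k_i^(+-1) restores what was divided off. So the prescribed products of \<phi> are the actual
  \<phi> of the new operators.\<close>

lemma phi_tensor:
  assumes i: "i \<le> n"
  shows "phi t tensor_ops \<epsilon> i m = app (pval \<epsilon> i m)"
proof (rule V.phi_index_cases[of m \<epsilon>])
  fix a assume m: "m = pmi \<epsilon> * int a"
  have coeff: "(\<lambda>p u. if p = 0 then 0 else (of_int (pmi \<epsilon>) * (qq t - inverse (qq t))) *\<^sub>C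
      hop tensor_ops i (pmi \<epsilon> * int p) u) = hlog \<epsilon> i"
  proof (intro ext)
    fix p u
    show "(if p = 0 then 0 else (of_int (pmi \<epsilon>) * (qq t - inverse (qq t))) *\<^sub>C
      hop tensor_ops i (pmi \<epsilon> * int p) u) = hlog \<epsilon> i p u"
    proof (cases "p = 0")
      case True
      then show ?thesis by (simp add: hlog_def)
    next
      case False
      have e: "(if pmi \<epsilon> * int p > 0 then Pos else Neg) = \<epsilon>" "nat \<bar>pmi \<epsilon> * int p\<bar> = p"
        using False by (cases \<epsilon>; simp)+
      have nz: "complex_of_int (pmi \<epsilon>) * (q - inverse q) \<noteq> 0"
        using V.q_diff_nz by (cases \<epsilon>) simp_all
      have "hop tensor_ops i (pmi \<epsilon> * int p) u = (1 / (of_int (pmi \<epsilon>) * (q - inverse q))) *\<^sub>C hlog \<epsilon> i p u"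
        unfolding tensor_ops_def by (simp add: Let_def e)
      then show ?thesis
        using False nz by (simp only: scaleC_scaleC if_False) (simp add: scaleC_one)
    qed
  qed
  have "op_exp_coeff (hlog \<epsilon> i) a T = app (kval (- V.kpm \<epsilon> i) * pval \<epsilon> i (pmi \<epsilon> * int a)) T" for T
  proof (cases "a = 0")
    case True
    have "kval (- V.kpm \<epsilon> i) * kval (V.kpm \<epsilon> i) = 1"
      by (simp add: kval_mult V.kpm_space V.uminus_space i kval_0)
    then show ?thesis using True i by (simp add: op_exp_coeff_def scaleC_one pval_0 del: app_times)
  next
    case False
    then show ?thesis unfolding hlog_def by (intro op_exp_log_coeff app_linear) simp
  qed
  moreover have "kval (V.kpm \<epsilon> i) * (kval (- V.kpm \<epsilon> i) * z) = z" for z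
    by (simp add: kval_mult V.kpm_space V.uminus_space i kval_0 flip: mult.assoc)
  ultimately have "app (kval (V.kpm \<epsilon> i)) (op_exp_coeff (hlog \<epsilon> i) a T) = app (pval \<epsilon> i m) T" for T
    unfolding m by (simp only: app_times[symmetric])
  then show ?thesis
    unfolding phi_def coeff by (simp add: m V.kpm_def fun_eq_iff)
next
  assume "pmi \<epsilon> * m < 0"
  then show ?thesis by (simp add: phi_def pval_def fun_eq_iff)
qed

lemma regE_eqI: "F = G \<Longrightarrow> regE F f \<Longrightarrow> regE G g \<Longrightarrow> f = g"
  using regE_unique by blast

lemmas regE_rules = regE_add regE_diff regE_scale regE_times

text \<open>Each relation holds identically in u. Its two sides evaluate by the rules for
  \<open>regE\<close>, and the uniqueness of values turns the identity of series into one of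
  operators.\<close>

lemma toroidal_tensor: "toroidal_module n t tensor_ops"
proof (unfold toroidal_module_def tensor_ops_simps, intro conjI allI ballI impI, goal_cases)
  case (1 \<epsilon> i r)
  show ?case by (rule app_linear)
next
  case (2 h)
  show ?case by (rule app_linear)
next
  case (3 i m)
  show ?case
    unfolding tensor_ops_def toroidal_ops.simps Let_def
    by (rule clinearI) (simp_all add: clinear_simps[OF hlog_linear] scaleC_add_right scaleC_scaleC mult.commute)
next
  case (4 h h' T)
  then show ?case using kval_mult[of h h'] by (metis app_times)
next
  case (5 T)
  show ?case by (simp add: kval_0)
next
  case (6 h \<epsilon> i m T)
  have "fls_const (kval h) * P \<epsilon> i m = P \<epsilon> i m * fls_const (kval h)"
    by (rule fls_eqI) (use 6 in \<open>simp add: P_nth kval_def V.ke_pe W.ke_pe\<close>)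
  then have "kval h * pval \<epsilon> i m = pval \<epsilon> i m * kval h"
    by (rule regE_eqI) (intro regE_rules regE_const regE_P 6(2))+
  then show ?case using 6 by (metis app_times phi_tensor)
next
  case (7 \<epsilon> \<epsilon>' i j m m' T)
  have "P \<epsilon> i m * P \<epsilon>' j m' = P \<epsilon>' j m' * P \<epsilon> i m"
    using P_commuting[OF 7, of \<epsilon> \<epsilon>'] by (simp add: commuting_def)
  then have "pval \<epsilon> i m * pval \<epsilon>' j m' = pval \<epsilon>' j m' * pval \<epsilon> i m"
    by (rule regE_eqI) (intro regE_rules regE_P 7)+
  then show ?case using 7 by (metis app_times phi_tensor)
next
  case (8 h \<epsilon> j r T)
  let ?s = "qpow t (of_int (pmi \<epsilon>) * simple_root n j h)"
  have one: "V.ke h * (V.ke (- h)) = 1" "W.ke h * W.ke (- h) = 1"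
    using 8 by (simp_all add: V.ke_mult W.ke_mult V.uminus_space V.ke_0 W.ke_0)
  have pe: "V.ke h * (V.pe \<eta> j N * V.ke (- h)) = V.pe \<eta> j N" "W.ke h * (W.pe \<eta> j N * W.ke (- h)) = W.pe \<eta> j N" for \<eta> N
    using 8 one by (simp_all add: V.ke_pe W.ke_pe V.ke_pe[OF V.uminus_space, symmetric]
        W.ke_pe[OF V.uminus_space, symmetric] flip: mult.assoc)
  have "fls_const (kval h) * (X \<epsilon> j r * fls_const (kval (- h))) = ?s *\<^sub>C X \<epsilon> j r"
  proof (rule fls_eqI)
    fix N
    show "fls_nth (fls_const (kval h) * (X \<epsilon> j r * fls_const (kval (- h)))) N = fls_nth (?s *\<^sub>C X \<epsilon> j r) N"
      using 8 one pe
      by (cases \<epsilon>) (simp_all add: X_def A_nth B_nth kval_def gA_def fB_def one_seq_def distrib_left distrib_right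
          V.ke_xe_ke W.ke_xe_ke tmap_scale scaleC_add_right)
  qed
  then have "kval h * (xval \<epsilon> j r * kval (- h)) = ?s *\<^sub>C xval \<epsilon> j r"
    by (rule regE_eqI) (intro regE_rules regE_const regE_X 8(2))+
  then show ?case by (metis app_times app_scaleC)
next
  case (9 \<eta> \<epsilon> i j m r T)
  let ?c = "qq t powi (pmi \<epsilon> * cartan_matrix n i j)"
  have "P \<eta> i m * X \<epsilon> j (r - 1) - ?c *\<^sub>C (P \<eta> i (m - 1) * X \<epsilon> j r)
      = ?c *\<^sub>C (X \<epsilon> j (r - 1) * P \<eta> i m) - X \<epsilon> j r * P \<eta> i (m - 1)"
    using PX_quad[OF 9, of \<epsilon> \<eta>] by (simp add: quad_def)
  then have "pval \<eta> i m * xval \<epsilon> j (r - 1) - ?c *\<^sub>C (pval \<eta> i (m - 1) * xval \<epsilon> j r)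
      = ?c *\<^sub>C (xval \<epsilon> j (r - 1) * pval \<eta> i m) - xval \<epsilon> j r * pval \<eta> i (m - 1)"
    by (rule regE_eqI) (intro regE_rules regE_P regE_X 9)+
  from arg_cong[OF this, of "\<lambda>f. app f T"] show ?case using 9 by (simp add: phi_tensor)
next
  case (10 i j m r T)
  let ?d = "1 / (qq t - inverse (qq t))"
  have "X Pos i m * X Neg j r - X Neg j r * X Pos i m
      = (if i = j then ?d *\<^sub>C (P Pos i (m + r) - P Neg i (m + r)) else 0)"
    by (rule X_bracket[OF 10])
  then have "xval Pos i m * xval Neg j r - xval Neg j r * xval Pos i m
      = (if i = j then ?d *\<^sub>C (pval Pos i (m + r) - pval Neg i (m + r)) else 0)"
  proof (rule regE_eqI)
    show "regE (if i = j then ?d *\<^sub>C (P Pos i (m + r) - P Neg i (m + r)) else 0)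
        (if i = j then ?d *\<^sub>C (pval Pos i (m + r) - pval Neg i (m + r)) else 0)"
      using 10 by (auto intro!: regE_rules regE_P regE_0)
  qed (intro regE_rules regE_X 10)
  from arg_cong[OF this, of "\<lambda>f. app f T"] show ?case using 10 by (cases "i = j") (simp_all add: phi_tensor)
next
  case (11 \<epsilon> i j m r T)
  let ?c = "qq t powi (pmi \<epsilon> * cartan_matrix n i j)"
  have "X \<epsilon> i m * X \<epsilon> j (r - 1) - ?c *\<^sub>C (X \<epsilon> i (m - 1) * X \<epsilon> j r)
      = ?c *\<^sub>C (X \<epsilon> j (r - 1) * X \<epsilon> i m) - X \<epsilon> j r * X \<epsilon> i (m - 1)"
    using X_quad[OF 11, of \<epsilon>] by (simp add: quad_def)
  then have "xval \<epsilon> i m * xval \<epsilon> j (r - 1) - ?c *\<^sub>C (xval \<epsilon> i (m - 1) * xval \<epsilon> j r)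
      = ?c *\<^sub>C (xval \<epsilon> j (r - 1) * xval \<epsilon> i m) - xval \<epsilon> j r * xval \<epsilon> i (m - 1)"
    by (rule regE_eqI) (intro regE_rules regE_X 11)+
  from arg_cong[OF this, of "\<lambda>f. app f T"] show ?case by simp
next
  case (12 \<epsilon> i j m1 m2 r T)
  let ?d = "qq t + inverse (qq t)"
  have "X \<epsilon> i m1 * X \<epsilon> i m2 * X \<epsilon> j r - ?d *\<^sub>C (X \<epsilon> i m1 * X \<epsilon> j r * X \<epsilon> i m2) + X \<epsilon> j r * X \<epsilon> i m1 * X \<epsilon> i m2
     + (X \<epsilon> i m2 * X \<epsilon> i m1 * X \<epsilon> j r - ?d *\<^sub>C (X \<epsilon> i m2 * X \<epsilon> j r * X \<epsilon> i m1) + X \<epsilon> j r * X \<epsilon> i m2 * X \<epsilon> i m1) = 0"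
    using X_serre[OF 12, of \<epsilon>] unfolding serre_rel_def by blast
  then have "xval \<epsilon> i m1 * xval \<epsilon> i m2 * xval \<epsilon> j r - ?d *\<^sub>C (xval \<epsilon> i m1 * xval \<epsilon> j r * xval \<epsilon> i m2)
     + xval \<epsilon> j r * xval \<epsilon> i m1 * xval \<epsilon> i m2
     + (xval \<epsilon> i m2 * xval \<epsilon> i m1 * xval \<epsilon> j r - ?d *\<^sub>C (xval \<epsilon> i m2 * xval \<epsilon> j r * xval \<epsilon> i m1)
     + xval \<epsilon> j r * xval \<epsilon> i m2 * xval \<epsilon> i m1) = 0"
    by (rule regE_eqI) (intro regE_rules regE_X regE_0 12)+
  from arg_cong[OF this, of "\<lambda>f. app f T"] show ?case by (simp add: Let_def)
next
  case (13 \<epsilon> i j m r T)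
  have "X \<epsilon> i m * X \<epsilon> j r = X \<epsilon> j r * X \<epsilon> i m"
    using X_commuting[OF 13, of \<epsilon>] by (simp add: commuting_def)
  then have "xval \<epsilon> i m * xval \<epsilon> j r = xval \<epsilon> j r * xval \<epsilon> i m"
    by (rule regE_eqI) (intro regE_rules regE_X 13)+
  then show ?case by (metis app_times)
qed

lemma drinfeld_value:
  assumes "i \<le> n"
  shows "regular_with_value (drinfeld_series t \<rho>V \<rho>W \<epsilon> i m v w) (app (xval \<epsilon> i m) (v \<otimes>\<^sub>V w))"
proof -
  have "reg (\<lambda>N. app (fls_nth (X \<epsilon> i m) N) (v \<otimes>\<^sub>V w)) (app (xval \<epsilon> i m) (v \<otimes>\<^sub>V w))"
    using regE_X[OF assms] by (simp add: regE_def)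
  then show ?thesis
    using reg_regular_with_value by (simp add: X_nth_drinfeld_series[OF assms])
qed

lemma well_defined: "drinfeld_well_defined n t \<rho>V \<rho>W"
  unfolding drinfeld_well_defined_def using drinfeld_value by blast

lemma acts_tensor: "acts_by_drinfeld_coproduct n t \<rho>V \<rho>W tensor_ops"
  unfolding acts_by_drinfeld_coproduct_def tensor_ops_simps
proof (intro conjI allI ballI impI)
  show "regular_with_value (drinfeld_series t \<rho>V \<rho>W \<epsilon> i m v w) (app (xval \<epsilon> i m) (v \<otimes>\<^sub>V w))"
    if "i \<le> n" for \<epsilon> i m v w by (rule drinfeld_value[OF that])
  show "app (kval h) (v \<otimes>\<^sub>V w) = kop \<rho>V h v \<otimes>\<^sub>V kop \<rho>W h w" if "h \<in> cartan_space n" for h v w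
    using that by (simp add: kval_def)
  show "phi t tensor_ops \<epsilon> i (pmi \<epsilon> * int m) (v \<otimes>\<^sub>V w)
      = (\<Sum>p\<le>m. phi t \<rho>V \<epsilon> i (pmi \<epsilon> * int p) v \<otimes>\<^sub>V phi t \<rho>W \<epsilon> i (pmi \<epsilon> * int (m - p)) w)"
    if "i \<le> n" for \<epsilon> i m v w
    using that by (simp add: phi_tensor pval_def app_sum)
qed

end

text \<open>A common point gives a q^m = b q^-m' with m and m' exceeding the distances of i to l and
  to 0. Hence a/b = q^-(m + m') with m + m' at least d_l + 2, which are exactly the excluded
  quotients.\<close>

lemma highest_weight_supports_disjoint:
  assumes "highest_weight n t \<rho> l s a v" "highest_weight n t \<rho>' 0 s' (inverse b) v'" "b \<noteq> 0" "i \<le> n"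
    and ab: "a / b \<notin> {exp t powi (- 2 - int (dmin n l) - int m) | m :: nat. True}"
  shows "highest_weight.\<Gamma> n t l a i \<inter> inverse ` highest_weight.\<Gamma> n t 0 (inverse b) i = {}"
proof -
  interpret V: highest_weight n t \<rho> l s a v by fact
  interpret W: highest_weight n t \<rho>' 0 s' "inverse b" v' by fact
  let ?q = "exp t"
  have False if gV: "g \<in> V.\<Gamma> i" and gW: "g \<in> inverse ` W.\<Gamma> i" for g
  proof -
    obtain m where m: "g = a * ?q powi m" "m \<ge> cyc_dist n l i + 1" using gV unfolding V.\<Gamma>_def by blast
    obtain m' where m': "g = inverse (inverse b * ?q powi m')" "m' \<ge> cyc_dist n 0 i + 1"
      using gW unfolding W.\<Gamma>_def by blast
    have "a * ?q powi m * ?q powi m' = b"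
      using m(1) m'(1) \<open>b \<noteq> 0\<close> by (simp add: field_simps)
    then have "a * ?q powi (m + m') = b" by (simp add: power_int_add mult.assoc)
    then have eq: "a / b = ?q powi (- (m + m'))"
      using \<open>b \<noteq> 0\<close> unfolding power_int_minus by (auto simp: field_simps)
    have "int (dmin n l) + 2 \<le> m + m'"
      using cyc_dist_dmin[OF V.l_le \<open>i \<le> n\<close>] m(2) m'(2) by linarith
    then have "- (m + m') = - 2 - int (dmin n l) - int (nat (m + m' - 2 - int (dmin n l)))" by simp
    then have "a / b = ?q powi (- 2 - int (dmin n l) - int (nat (m + m' - 2 - int (dmin n l))))"
      using eq by metis
    then show False using ab by blast
  qed
  then show ?thesis by blast
qed

theorem theorem3p1:
  fixes n l s :: nat and t a b :: complex
    and V :: "'v::complex_vector toroidal_ops"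
    and W :: "'w::complex_vector toroidal_ops"
  assumes "2 \<le> n"
    and "\<forall>m::nat. 0 < m \<longrightarrow> exp t ^ m \<noteq> 1"
    and "l \<in> {1..n}" and "1 \<le> s" and "a \<noteq> 0" and "b \<noteq> 0"
    and "is_V_highest n t l s a V"
    and "is_V_lowest n t s b W"
    and "a / b \<notin> {exp t powi (- 2 - int (dmin n l) - int m) | m :: nat. True}"
  shows "drinfeld_well_defined n t V W \<and>
    (\<exists>\<rho>. toroidal_module n t \<rho> \<and> acts_by_drinfeld_coproduct n t V W \<rho>)"
proof -
  have q: "\<And>m::nat. 0 < m \<Longrightarrow> exp t ^ m \<noteq> 1" using assms(2) by blast
  have "l \<le> n" using assms(3) by simp
  obtain v where v: "highest_weight n t V l s a v"
    using is_V_highest_locale[OF assms(1) q \<open>l \<le> n\<close> assms(5,7)] by blast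
  obtain w where w: "highest_weight n t (flip W) 0 s (inverse b) w"
    using is_V_lowest_locale[OF assms(1) q assms(6,8)] by blast
  interpret HV: highest_weight n t V l s a v by (rule v)
  interpret HW: highest_weight n t "flip W" 0 s "inverse b" w by (rule w)
  have W_module: "toroidal_module n t W"
    using assms(8) unfolding is_V_lowest_def simple_l_extremal_module_def simple_toroidal_module_def by blast
  have "supported_module n t V HV.\<Gamma>" by (rule HV.supported_module)
  moreover have "supported_module n t W (\<lambda>i. inverse ` HW.\<Gamma> i)"
    by (rule supported_module_flip[OF HW.supported_module W_module])
      (use assms(6) in \<open>auto simp: HW.\<Gamma>_def\<close>)
  moreover have "HV.\<Gamma> i \<inter> inverse ` HW.\<Gamma> i = {}" if "i \<le> n" for i
    by (rule highest_weight_supports_disjoint[OF v w assms(6) that assms(9)])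
  moreover have "0 \<notin> HV.\<Gamma> i" for i
    using assms(5) by (auto simp: HV.\<Gamma>_def)
  ultimately interpret D: drinfeld_tensor n t V HV.\<Gamma> W "\<lambda>i. inverse ` HW.\<Gamma> i"
    by (intro drinfeld_tensor.intro drinfeld_tensor_axioms.intro)
  show ?thesis using D.well_defined D.toroidal_tensor D.acts_tensor by blast
qed

end
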